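(* Let $H$ be a fixed graph with no isolated vertices, and let $n$ be even. Then with probability tending to $1$ as $n\to\infty$, $\tau_{\mathsf M}=\tau_1$, where $\tau_{\mathsf M}=\min\{i:\bar G_i(H,n)\text{ has a perfect matching}\}$ and $\tau_1=\min\{i:\delta(\bar G_i(H,n))\ge 1\}$.
   Context: A copy of $H$ in $K_n$ is a subgraph of the complete graph on $[n]$ isomorphic to $H$; let $N$ be the total number of such copies. The random motif graph process $\bar G_0(H,n),\dots,\bar G_N(H,n)$: $\bar G_0(H,n)$ is the empty graph on $[n]$, and $\bar G_{i+1}(H,n)$ is obtained from $\bar G_i(H,n)$ by adding a copy $H_{i+1}$ of $H$ chosen uniformly at random among all copies of $H$ in $K_n$ other than $H_1,\dots,H_i$. $\delta(\cdot)$ denotes minimum degree. *)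

theory Defs
  imports "HOL-Probability.Probability" "HOL-Library.Ramsey"
begin

type_synonym 'a ugraph = "'a set \<times> 'a set set"

abbreviation verts :: "'a ugraph \<Rightarrow> 'a set" where
  "verts \<equiv> fst"

abbreviation edges :: "'a ugraph \<Rightarrow> 'a set set" where
  "edges \<equiv> snd"

definition simple_graph :: "'a ugraph \<Rightarrow> bool" where
  "simple_graph G \<longleftrightarrow> finite (verts G) \<and> edges G \<subseteq> nsets (verts G) 2"

definition complete_graph :: "nat \<Rightarrow> nat ugraph" where
  "complete_graph n = ({1..n}, nsets {1..n} 2)"

definition subgraph :: "'a ugraph \<Rightarrow> 'a ugraph \<Rightarrow> bool" where
  "subgraph G G' \<longleftrightarrow> simple_graph G \<and> verts G \<subseteq> verts G' \<and> edges G \<subseteq> edges G'"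

definition isomorphic :: "'a ugraph \<Rightarrow> 'b ugraph \<Rightarrow> bool" where
  "isomorphic G G' \<longleftrightarrow>
     (\<exists>f. bij_betw f (verts G) (verts G') \<and> edges G' = (\<lambda>e. f ` e) ` edges G)"

definition degree :: "'a ugraph \<Rightarrow> 'a \<Rightarrow> nat" where
  "degree G v = card {e \<in> edges G. v \<in> e}"

definition min_degree :: "'a ugraph \<Rightarrow> nat" where
  "min_degree G = Min (degree G ` verts G)"

definition no_isolated_vertices :: "'a ugraph \<Rightarrow> bool" where
  "no_isolated_vertices G \<longleftrightarrow> (\<forall>v \<in> verts G. degree G v \<noteq> 0)"

definition has_perfect_matching :: "'a ugraph \<Rightarrow> bool" where
  "has_perfect_matching G \<longleftrightarrow> (\<exists>M \<subseteq> edges G. \<forall>v \<in> verts G. \<exists>!e. e \<in> M \<and> v \<in> e)"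

definition copies :: "'a ugraph \<Rightarrow> nat \<Rightarrow> nat ugraph set" where
  "copies H n = {H'. subgraph H' (complete_graph n) \<and> isomorphic H H'}"

text \<open>Distribution of the list of the first \<open>i\<close> copies chosen. It is meaningful for
  \<open>i \<le> card (copies H n)\<close>, in which case \<open>pmf_of_set\<close> is only ever applied to nonempty finite
  sets.\<close>

primrec motif_sequence :: "'a ugraph \<Rightarrow> nat \<Rightarrow> nat \<Rightarrow> nat ugraph list pmf" where
  "motif_sequence H n 0 = return_pmf []"
| "motif_sequence H n (Suc i) =
     bind_pmf (motif_sequence H n i) (\<lambda>Hs.
       map_pmf (\<lambda>H'. Hs @ [H']) (pmf_of_set (copies H n - set Hs)))"

definition motif_process :: "'a ugraph \<Rightarrow> nat \<Rightarrow> nat ugraph list pmf" where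
  "motif_process H n = motif_sequence H n (card (copies H n))"

definition motif_graph :: "nat \<Rightarrow> nat ugraph list \<Rightarrow> nat \<Rightarrow> nat ugraph" where
  "motif_graph n Hs i = ({1..n}, \<Union> (edges ` set (take i Hs)))"

text \<open>The hitting times below are of interest when the process ends in the complete graph on an
  even positive number of vertices, i.e. for even \<open>n \<ge> card (verts H)\<close> with \<open>H\<close> having an edge.
  Then both minima are attained; otherwise \<open>LEAST\<close> may be unspecified, which
  concerns only finitely many even \<open>n\<close>.\<close>

definition \<tau>\<^sub>M :: "nat \<Rightarrow> nat ugraph list \<Rightarrow> nat" where
  "\<tau>\<^sub>M n Hs = (LEAST i. i \<le> length Hs \<and> has_perfect_matching (motif_graph n Hs i))"

definition \<tau>\<^sub>1 :: "nat \<Rightarrow> nat ugraph list \<Rightarrow> nat" where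
  "\<tau>\<^sub>1 n Hs = (LEAST i. i \<le> length Hs \<and> min_degree (motif_graph n Hs i) \<ge> 1)"

end

theory Submission
  imports Defs "HOL-Probability.Random_Permutations" "HOL-Real_Asymp.Real_Asymp"
begin

text \<open>
  Write \<open>k\<close> for the number of vertices of \<open>H\<close>. The process is a uniformly random permutation of
  all copies; we look at it after \<open>m\<^sub>0 = 2 n ln n / (3 k)\<close> and after \<open>m\<^sub>1 = 2 n ln n / k\<close>
  steps. With high probability some vertex is still isolated at time \<open>m\<^sub>0\<close> (second moment) and
  none is at time \<open>m\<^sub>1\<close> (first moment), so \<open>m\<^sub>0 < \<tau>\<^sub>1 \<le> m\<^sub>1\<close>. Call a vertex small
  if it lies in fewer than \<open>10 k\<close> of the first \<open>m\<^sub>0\<close> copies. With high probability no two small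
  vertices are joined by a chain of at most four of the first \<open>m\<^sub>1\<close> copies, no small set \<open>X\<close> of
  vertices is met twice by \<open>2 card X\<close> of the first \<open>m\<^sub>1\<close> copies, and the first \<open>m\<^sub>0\<close> copies leave
  no large hole. Hence at time \<open>\<tau>\<^sub>1\<close> every set \<open>A\<close> of at most \<open>n / 4\<close> vertices has at least
  \<open>card A\<close> outer neighbours: the small vertices in \<open>A\<close> have private neighbours, the others expand by
  a factor of four. Together with the absence of holes this excludes a Tutte set.
\<close>

section \<open>Hall's and Tutte's theorems\<close>

text \<open>The graph at time \<open>\<tau>\<^sub>1\<close> is not a uniform sample, because
  \<open>\<tau>\<^sub>1\<close> depends on the process. This obstacle is met by monotonicity:
  whatever must be plentiful (copies at large vertices, edges leaving large sets) is secured at time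
  \<open>m\<^sub>0\<close>, whatever must be rare (dense sets, short chains) is bounded at time
  \<open>m\<^sub>1\<close>, and both persist at every time in between. The one fact special to time
  \<open>\<tau>\<^sub>1\<close> is that every vertex is covered; it supplies the small vertices with
  neighbours. The factor 2/3 in \<open>m\<^sub>0\<close>, in units of n ln n / k, has to lie
  strictly between 1/2 and 1. The expected number of isolated vertices is about n * n^(-2/3) and
  must tend to infinity, whereas two small vertices joined by a short chain cost about n * n^(-4/3),
  up to powers of ln n, and this must vanish. At \<open>m\<^sub>1\<close> the expected number of
  isolated vertices is at most n * n^(-2). Degrees are counted in copies, not in edges, since the
  copies are what is sampled. All estimates compare families of copies with the total number of
  copies, and symmetry gives these proportions.\<close>

theorem hall_marriage:
  assumes "finite I" "\<And>i. i \<in> I \<Longrightarrow> finite (A i)"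
    and "\<And>J. J \<subseteq> I \<Longrightarrow> card J \<le> card (\<Union>i\<in>J. A i)"
  shows "\<exists>f. inj_on f I \<and> (\<forall>i\<in>I. f i \<in> A i)"
  using assms
proof (induction "card I" arbitrary: I A rule: less_induct)
  case less
  show ?case
  proof (cases "I = {}")
    case True
    then show ?thesis by auto
  next
    case False
    show ?thesis
    \<comment> \<open>The Halmos-Vaughan dichotomy: a proper tight subfamily is matched inside its
      own union and the rest outside it; without one, every nonempty proper subfamily has an element
      to spare, so one choice may be fixed arbitrarily.\<close>
    proof (cases "\<exists>J. J \<noteq> {} \<and> J \<subset> I \<and> card (\<Union>i\<in>J. A i) = card J")
      case True
      then obtain J where J: "J \<noteq> {}" "J \<subset> I" "card (\<Union>i\<in>J. A i) = card J" by blast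
      let ?N = "\<Union>i\<in>J. A i"
      have fJ: "finite J" using J less.prems(1) by (meson finite_subset psubset_imp_subset)
      have fN: "finite ?N" using J less.prems(2) fJ by auto
      have "\<exists>f. inj_on f J \<and> (\<forall>i\<in>J. f i \<in> A i)"
      proof (rule less.hyps)
        show "card J < card I" using J less.prems(1) by (simp add: psubset_card_mono)
        show "finite J" by fact
        show "finite (A i)" if "i \<in> J" for i using that J less.prems(2) by auto
        show "card K \<le> card (\<Union> (A ` K))" if "K \<subseteq> J" for K
          using that J less.prems(3) by auto
      qed
      then obtain f where f: "inj_on f J" "\<And>i. i \<in> J \<Longrightarrow> f i \<in> A i" by auto
      have "\<exists>g. inj_on g (I - J) \<and> (\<forall>i\<in>I - J. g i \<in> A i - ?N)"
      proof (rule less.hyps)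
        show "card (I - J) < card I" using J less.prems(1)
          by (intro psubset_card_mono) auto
        show "finite (I - J)" using less.prems(1) by simp
        show "finite (A i - ?N)" if "i \<in> I - J" for i using that less.prems(2) by auto
        show "card K \<le> card (\<Union>i\<in>K. A i - ?N)" if K: "K \<subseteq> I - J" for K
        proof -
          have fK: "finite K" using K less.prems(1) by (meson finite_Diff finite_subset)
          have fUK: "finite (\<Union>i\<in>K. A i - ?N)" using fK K less.prems(2) by auto
          have "card K + card J = card (K \<union> J)"
            using K fK fJ by (subst card_Un_disjoint) auto
          also have "\<dots> \<le> card (\<Union>i\<in>K \<union> J. A i)" using K J by (intro less.prems(3)) auto
          also have "(\<Union>i\<in>K \<union> J. A i) = (\<Union>i\<in>K. A i - ?N) \<union> ?N" by auto
          also have "card \<dots> = card (\<Union>i\<in>K. A i - ?N) + card J"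
            using fUK fN J(3) by (subst card_Un_disjoint) auto
          finally show ?thesis by simp
        qed
      qed
      then obtain g where g: "inj_on g (I - J)" "\<And>i. i \<in> I - J \<Longrightarrow> g i \<in> A i - ?N" by auto
      let ?h = "\<lambda>i. if i \<in> J then f i else g i"
      have "inj_on ?h I"
      proof (rule inj_onI)
        fix x y assume xy: "x \<in> I" "y \<in> I" "?h x = ?h y"
        show "x = y"
          using xy f(1) g(1) f(2)[of x] f(2)[of y] g(2)[of x] g(2)[of y]
          by (auto split: if_splits simp: inj_on_def)
      qed
      moreover have "\<forall>i\<in>I. ?h i \<in> A i" using f g by auto
      ultimately show ?thesis by blast
    next
      case no: False
      obtain i where i: "i \<in> I" using False by auto
      have "card {i} \<le> card (\<Union>j\<in>{i}. A j)" using i by (intro less.prems(3)) auto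
      then obtain x where x: "x \<in> A i" by fastforce
      have "\<exists>g. inj_on g (I - {i}) \<and> (\<forall>j\<in>I - {i}. g j \<in> A j - {x})"
      proof (rule less.hyps)
        show "card (I - {i}) < card I" using i less.prems(1) by (meson card_Diff1_less)
        show "finite (I - {i})" using less.prems(1) by simp
        show "finite (A j - {x})" if "j \<in> I - {i}" for j using that less.prems(2) by auto
        show "card K \<le> card (\<Union>j\<in>K. A j - {x})" if K: "K \<subseteq> I - {i}" for K
        proof (cases "K = {}")
          case False
          have "K \<subset> I" using K i by auto
          then have "card K < card (\<Union>j\<in>K. A j)"
            using no False less.prems(3)[of K] by (metis order_less_le psubset_imp_subset)
          moreover have "(\<Union>j\<in>K. A j - {x}) = (\<Union>j\<in>K. A j) - {x}" by auto
          ultimately show ?thesis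
            by (cases "x \<in> (\<Union>j\<in>K. A j)") (simp_all add: card_Diff_singleton)
        qed auto
      qed
      then obtain g where g: "inj_on g (I - {i})" "\<And>j. j \<in> I - {i} \<Longrightarrow> g j \<in> A j - {x}" by auto
      let ?h = "g(i := x)"
      have "inj_on ?h I"
        using g by (auto simp: inj_on_def)
      moreover have "\<forall>j\<in>I. ?h j \<in> A j" using g x by auto
      ultimately show ?thesis by blast
    qed
  qed
qed

text \<open>Components are taken as the minimal nonempty closed sets, the atoms of the Boolean algebra of
  closed sets; this avoids reachability.\<close>

definition closed_in :: "'a set set \<Rightarrow> 'a set \<Rightarrow> 'a set \<Rightarrow> bool" where
  "closed_in E W C \<longleftrightarrow> C \<subseteq> W \<and> (\<forall>e\<in>E. e \<subseteq> W \<longrightarrow> e \<subseteq> C \<or> e \<inter> C = {})"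

definition comps :: "'a set set \<Rightarrow> 'a set \<Rightarrow> 'a set set" where
  "comps E W = {C. C \<noteq> {} \<and> closed_in E W C \<and> (\<forall>D. closed_in E W D \<and> D \<subseteq> C \<longrightarrow> D = {} \<or> D = C)}"

definition odd_comps :: "'a set set \<Rightarrow> 'a set \<Rightarrow> 'a set set" where
  "odd_comps E W = {C \<in> comps E W. odd (card C)}"

text \<open>The edge set stays fixed while the vertex set varies: members of \<open>E\<close>
  reaching outside \<open>W\<close> are barred from \<open>M\<close>, so this is a perfect matching
  of the subgraph induced on \<open>W\<close>.\<close>

definition matchable :: "'a set set \<Rightarrow> 'a set \<Rightarrow> bool" where
  "matchable E W \<longleftrightarrow> (\<exists>M\<subseteq>E. (\<forall>e\<in>M. e \<subseteq> W) \<and> (\<forall>v\<in>W. \<exists>!e. e \<in> M \<and> v \<in> e))"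

lemma closed_in_subset: "closed_in E W C \<Longrightarrow> C \<subseteq> W"
  by (simp add: closed_in_def)

lemma closed_in_self: "closed_in E W W"
  by (auto simp: closed_in_def)

lemma closed_in_cases:
  assumes "closed_in E W C" "e \<in> E" "e \<subseteq> W"
  obtains "e \<subseteq> C" | "e \<inter> C = {}"
  using assms unfolding closed_in_def by auto

lemma closed_in_Diff:
  assumes "closed_in E W C" "closed_in E W D"
  shows "closed_in E W (C - D)"
  unfolding closed_in_def
proof (intro conjI ballI impI)
  show "C - D \<subseteq> W" using closed_in_subset[OF assms(1)] by auto
  fix e assume "e \<in> E" "e \<subseteq> W"
  then show "e \<subseteq> C - D \<or> e \<inter> (C - D) = {}"
    using closed_in_cases[OF assms(1)] closed_in_cases[OF assms(2)] by (metis Diff_disjoint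
      Diff_eq_empty_iff Int_Diff Int_empty_left Diff_triv inf.absorb1 inf_commute order_refl)
qed

lemma closed_in_Int:
  assumes "closed_in E W C" "closed_in E W D"
  shows "closed_in E W (C \<inter> D)"
proof -
  have "C \<inter> D = C - (C - D)" by auto
  then show ?thesis using assms closed_in_Diff by metis
qed

lemma closed_in_Union:
  assumes "\<And>C. C \<in> \<C> \<Longrightarrow> closed_in E W C"
  shows "closed_in E W (\<Union>\<C>)"
  unfolding closed_in_def
proof (intro conjI ballI impI)
  show "\<Union>\<C> \<subseteq> W" using closed_in_subset[OF assms] by auto
  fix e assume e: "e \<in> E" "e \<subseteq> W"
  show "e \<subseteq> \<Union>\<C> \<or> e \<inter> \<Union>\<C> = {}"
  proof (cases "\<exists>C\<in>\<C>. e \<subseteq> C")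
    case False
    then have "e \<inter> C = {}" if "C \<in> \<C>" for C using closed_in_cases[OF assms[OF that] e] that by auto
    then show ?thesis by auto
  qed auto
qed

lemma closed_in_trans: "closed_in E W C \<Longrightarrow> closed_in E C D \<Longrightarrow> closed_in E W D"
  unfolding closed_in_def by (metis disjoint_iff subset_iff)

lemma closed_in_mono: "closed_in E W D \<Longrightarrow> D \<subseteq> C \<Longrightarrow> C \<subseteq> W \<Longrightarrow> closed_in E C D"
  unfolding closed_in_def by blast

lemma comps_closed: "C \<in> comps E W \<Longrightarrow> closed_in E W C"
  by (simp add: comps_def)

lemma comps_subset: "C \<in> comps E W \<Longrightarrow> C \<subseteq> W"
  by (simp add: comps_def closed_in_def)

lemma comps_nonempty: "C \<in> comps E W \<Longrightarrow> C \<noteq> {}"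
  by (simp add: comps_def)

lemma finite_comps: "finite W \<Longrightarrow> finite (comps E W)"
  by (rule finite_subset[of _ "Pow W"]) (auto dest: comps_subset)

lemma comps_cases:
  assumes "C \<in> comps E W" "closed_in E W D"
  shows "C \<inter> D = {} \<or> C \<subseteq> D"
  using assms closed_in_Int[of E W C D] unfolding comps_def by blast

lemma comps_disjoint: "C \<in> comps E W \<Longrightarrow> D \<in> comps E W \<Longrightarrow> C \<noteq> D \<Longrightarrow> C \<inter> D = {}"
  by (metis comps_cases comps_closed inf_commute subset_antisym)

text \<open>A closed set of least size containing \<open>x\<close> is an atom: a closed part
  containing \<open>x\<close> cannot be smaller, and a nonempty closed part avoiding
  \<open>x\<close> could be removed.\<close>

lemma comps_cover:
  assumes "finite W" "x \<in> W"
  shows "\<exists>C\<in>comps E W. x \<in> C"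
proof -
  let ?P = "\<lambda>C. closed_in E W C \<and> x \<in> C"
  have "?P W" using assms closed_in_self by auto
  then obtain C where C: "?P C" and min: "\<And>D. ?P D \<Longrightarrow> card C \<le> card D"
    using ex_has_least_nat[of ?P W card] by blast
  have fC: "finite C" using C assms closed_in_subset finite_subset by metis
  have "C \<in> comps E W"
    unfolding comps_def
  proof (intro CollectI conjI allI impI)
    fix D assume D: "closed_in E W D \<and> D \<subseteq> C"
    show "D = {} \<or> D = C"
    proof (cases "x \<in> D")
      case True
      then show ?thesis using min[of D] D fC by (metis card_seteq)
    next
      case False
      then have "?P (C - D)" using C D closed_in_Diff by blast
      then have "card C \<le> card (C - D)" using min by blast
      then have "C - D = C" using fC by (meson Diff_subset card_seteq)
      then show ?thesis using D by blast
    qed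
  qed (use C in auto)
  then show ?thesis using C by blast
qed

lemma Union_comps: "finite W \<Longrightarrow> \<Union>(comps E W) = W"
  using comps_cover comps_subset by fastforce

lemma comps_closed_iff:
  assumes "closed_in E W C"
  shows "D \<in> comps E C \<longleftrightarrow> D \<in> comps E W \<and> D \<subseteq> C"
proof -
  have *: "closed_in E C D \<longleftrightarrow> closed_in E W D \<and> D \<subseteq> C" for D
    using assms closed_in_trans closed_in_mono closed_in_subset by metis
  show ?thesis unfolding comps_def by (auto simp: *)
qed

lemma odd_comps_closed_iff:
  "closed_in E W C \<Longrightarrow> D \<in> odd_comps E C \<longleftrightarrow> D \<in> odd_comps E W \<and> D \<subseteq> C"
  unfolding odd_comps_def using comps_closed_iff by blast

lemma finite_odd_comps: "finite W \<Longrightarrow> finite (odd_comps E W)"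
  by (simp add: odd_comps_def finite_comps)

text \<open>An atom lies in \<open>C\<close> or in the complement, as both are closed. This is how
  the odd count is followed when vertices are deleted inside a single component.\<close>

lemma card_odd_comps_split:
  assumes "finite W" "closed_in E W C"
  shows "card (odd_comps E W) = card (odd_comps E C) + card (odd_comps E (W - C))"
proof -
  have cl: "closed_in E W (W - C)" using assms closed_in_self closed_in_Diff by blast
  have "odd_comps E W = odd_comps E C \<union> odd_comps E (W - C)"
  proof (rule set_eqI)
    fix D
    have "D \<in> odd_comps E W \<Longrightarrow> D \<subseteq> C \<or> D \<subseteq> W - C"
      using comps_cases[OF _ assms(2)] comps_subset unfolding odd_comps_def by blast
    then show "D \<in> odd_comps E W \<longleftrightarrow> D \<in> odd_comps E C \<union> odd_comps E (W - C)"
      using odd_comps_closed_iff[OF assms(2)] odd_comps_closed_iff[OF cl] by blast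
  qed
  moreover have "odd_comps E C \<inter> odd_comps E (W - C) = {}"
  proof -
    have "False" if "D \<in> odd_comps E C" "D \<in> odd_comps E (W - C)" for D
      using that comps_subset[of D E C] comps_subset[of D E "W - C"] comps_nonempty[of D E C]
      unfolding odd_comps_def by blast
    then show ?thesis by blast
  qed
  moreover have "finite (odd_comps E C)" "finite (odd_comps E (W - C))"
    using assms closed_in_subset finite_subset finite_odd_comps by (metis, metis finite_Diff)
  ultimately show ?thesis by (simp add: card_Un_disjoint)
qed

lemma comps_self:
  assumes "C \<in> comps E W"
  shows "comps E C = {C}"
proof (rule set_eqI)
  fix D
  show "D \<in> comps E C \<longleftrightarrow> D \<in> {C}"
    using comps_closed_iff[OF comps_closed[OF assms], of D] assms comps_disjoint[OF assms, of D]
      comps_nonempty[of D E W] by auto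
qed

lemma card_eq_sum_comps:
  assumes "finite W"
  shows "card W = (\<Sum>C\<in>comps E W. card C)"
proof -
  have "card (\<Union>(comps E W)) = (\<Sum>C\<in>comps E W. card C)"
  proof (rule card_Union_disjoint)
    show "pairwise disjnt (comps E W)"
      using comps_disjoint by (fastforce simp: pairwise_def disjnt_def)
    show "finite C" if "C \<in> comps E W" for C
      using comps_subset[OF that] assms finite_subset by blast
  qed
  then show ?thesis using Union_comps[OF assms] by metis
qed

lemma even_card_odd_comps:
  assumes "finite W"
  shows "even (card (odd_comps E W)) \<longleftrightarrow> even (card W)"
  unfolding card_eq_sum_comps[OF assms, of E] odd_comps_def
  using even_sum_iff[OF finite_comps[OF assms], of card E] by simp

section \<open>Perfect matchings of induced subgraphs, and Tutte's theorem\<close>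

lemma matchable_empty: "matchable E {}"
  unfolding matchable_def by (rule exI[of _ "{}"]) auto

lemma matchable_edge: "{u, v} \<in> E \<Longrightarrow> matchable E {u, v}"
  unfolding matchable_def by (rule exI[of _ "{{u, v}}"]) auto

lemma matchable_Un:
  assumes "matchable E W" "matchable E W'" "W \<inter> W' = {}"
  shows "matchable E (W \<union> W')"
proof -
  obtain M where M: "M \<subseteq> E" "\<forall>e\<in>M. e \<subseteq> W" "\<forall>v\<in>W. \<exists>!e. e \<in> M \<and> v \<in> e"
    using assms(1) unfolding matchable_def by blast
  obtain M' where M': "M' \<subseteq> E" "\<forall>e\<in>M'. e \<subseteq> W'" "\<forall>v\<in>W'. \<exists>!e. e \<in> M' \<and> v \<in> e"
    using assms(2) unfolding matchable_def by blast
  show ?thesis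
    unfolding matchable_def
  proof (intro exI[of _ "M \<union> M'"] conjI ballI)
    fix v assume "v \<in> W \<union> W'"
    then consider "v \<in> W" "v \<notin> W'" | "v \<in> W'" "v \<notin> W" using assms(3) by blast
    then show "\<exists>!e. e \<in> M \<union> M' \<and> v \<in> e"
    proof cases
      case 1
      then have "(e \<in> M \<union> M' \<and> v \<in> e) \<longleftrightarrow> (e \<in> M \<and> v \<in> e)" for e using M'(2) by blast
      then show ?thesis using M(3) 1 by simp
    next
      case 2
      then have "(e \<in> M \<union> M' \<and> v \<in> e) \<longleftrightarrow> (e \<in> M' \<and> v \<in> e)" for e using M(2) by blast
      then show ?thesis using M'(3) 2 by simp
    qed
  qed (use M M' in auto)
qed

lemma matchable_UN:
  assumes "finite I" "\<And>i. i \<in> I \<Longrightarrow> matchable E (W i)"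
    "\<And>i j. i \<in> I \<Longrightarrow> j \<in> I \<Longrightarrow> i \<noteq> j \<Longrightarrow> W i \<inter> W j = {}"
  shows "matchable E (\<Union>i\<in>I. W i)"
  using assms
proof (induction I rule: finite_induct)
  case empty
  then show ?case by (simp add: matchable_empty)
next
  case (insert i I)
  have "W i \<inter> (\<Union>j\<in>I. W j) = {}" using insert by fastforce
  then show ?case using insert by (simp add: matchable_Un)
qed

text \<open>Anderson's proof: for a maximal set \<open>S\<close> with as many odd components in its complement as it
  has elements, all components are odd, each of them is matchable after the removal of any of its
  vertices, and Hall's theorem matches \<open>S\<close> with the components.\<close>

theorem tutte:
  assumes "finite V" "\<And>e. e \<in> E \<Longrightarrow> card e = 2"
    and "\<And>S. S \<subseteq> V \<Longrightarrow> card (odd_comps E (V - S)) \<le> card S"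
  shows "matchable E V"
  using assms(1,3)
proof (induction "card V" arbitrary: V rule: less_induct)
  case less
  let ?q = "\<lambda>W. card (odd_comps E W)"
  note fin = \<open>finite V\<close>
  have evV: "even (card V)"
    using even_card_odd_comps[OF fin, of E] less.prems(2)[of "{}"] by simp
  let ?P = "\<lambda>S. S \<subseteq> V \<and> ?q (V - S) = card S"
  have "?P {}" using less.prems(2)[of "{}"] by simp
  moreover have "\<forall>S. ?P S \<longrightarrow> card S < Suc (card V)" using fin card_mono le_imp_less_Suc by blast
  ultimately obtain S where S: "S \<subseteq> V" "?q (V - S) = card S"
    and max: "\<And>S'. S' \<subseteq> V \<Longrightarrow> ?q (V - S') = card S' \<Longrightarrow> card S' \<le> card S"
    using ex_has_greatest_nat[of ?P "{}" card "Suc (card V)"] by auto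
  let ?W = "V - S"
  have finW: "finite ?W" and finS: "finite S" using fin S finite_subset by auto
  \<comment> \<open>Maximality of \<open>S\<close> excludes equality for larger sets, so Tutte's
    inequality is strict there.\<close>
  have not_big: "?q (V - S') < card S'" if "S' \<subseteq> V" "card S < card S'" for S'
    using max[of S'] that less.prems(2)[of S'] by linarith
  \<comment> \<open>Moving one vertex of an even component into \<open>S\<close> leaves a rest of
    odd size, which has an odd component; the enlarged set would then violate the strict
    inequality.\<close>
  have all_odd: "odd (card C)" if C: "C \<in> comps E ?W" for C
  proof
    assume ev: "even (card C)"
    obtain c where c: "c \<in> C" using comps_nonempty[OF C] by blast
    have CW: "C \<subseteq> ?W" using comps_subset[OF C] .
    then have fC: "finite C" using finW finite_subset by blast
    have cl: "closed_in E (?W - {c}) (C - {c})"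
      using comps_closed[OF C] unfolding closed_in_def by blast
    have "?q (?W - {c}) = ?q (C - {c}) + ?q (?W - {c} - (C - {c}))"
      using card_odd_comps_split[OF _ cl] finW by simp
    also have "?W - {c} - (C - {c}) = ?W - C" using c by blast
    also have "?q (?W - C) = ?q ?W"
      using card_odd_comps_split[OF finW comps_closed[OF C]] ev
      by (auto simp: odd_comps_def comps_self[OF C])
    finally have 1: "?q (?W - {c}) = ?q (C - {c}) + card S" using S by simp
    have "odd (card (C - {c}))" using ev c fC
      by (metis card_Suc_Diff1 even_Suc)
    then have "odd (?q (C - {c}))" using even_card_odd_comps[of "C - {c}" E] fC by simp
    then have "?q (C - {c}) \<ge> 1" by (simp add: odd_pos Suc_leI)
    moreover have "V - insert c S = ?W - {c}" by blast
    moreover have "card (insert c S) = Suc (card S)" using c CW finS by auto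
    ultimately show False using 1 not_big[of "insert c S"] c CW S(1) by auto
  qed
  have card_comps: "card (comps E ?W) = card S"
  proof -
    have "odd_comps E ?W = comps E ?W" using all_odd unfolding odd_comps_def by blast
    then show ?thesis using S by simp
  qed
  have crit: "matchable E (C - {c})" if C: "C \<in> comps E ?W" and c: "c \<in> C" for C c
  proof (rule less.hyps)
    have CW: "C \<subseteq> ?W" using comps_subset[OF C] .
    then have fC: "finite C" using finW finite_subset by blast
    show "finite (C - {c})" using fC by simp
    have "card (C - {c}) < card C" using c fC by (meson card_Diff1_less)
    also have "card C \<le> card V" using CW fin by (intro card_mono) auto
    finally show "card (C - {c}) < card V" .
    fix T assume T: "T \<subseteq> C - {c}"
    have fT: "finite T" using T fC finite_subset by blast
    show "?q (C - {c} - T) \<le> card T"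
    proof (rule ccontr)
      assume "\<not> ?q (C - {c} - T) \<le> card T"
      then have gt: "card T < ?q (C - {c} - T)" by simp
      have "card C = Suc (card (C - {c}))" using c fC by (metis card_Suc_Diff1)
      moreover have "card (C - {c}) = card (C - {c} - T) + card T"
        using T fC fT by (metis card_Diff_subset card_mono finite_Diff le_add_diff_inverse2)
      ultimately have "even (card (C - {c} - T)) \<longleftrightarrow> even (card T)"
        using all_odd[OF C] by auto
      then have "even (?q (C - {c} - T)) \<longleftrightarrow> even (card T)"
        using even_card_odd_comps[of "C - {c} - T" E] fC by simp
      \<comment> \<open>Parity raises the excess to two. It pays for the additional deleted vertex
        \<open>c\<close> and for the component \<open>C\<close>, which is lost from the
        count.\<close>
      then have ge: "card T + 2 \<le> ?q (C - {c} - T)" using gt by presburger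
      let ?S = "S \<union> insert c T"
      have VS: "V - ?S = (?W - (insert c T))" by blast
      have cl: "closed_in E (?W - insert c T) (C - insert c T)"
        using comps_closed[OF C] unfolding closed_in_def by blast
      have "?q (?W - insert c T) = ?q (C - insert c T) + ?q (?W - insert c T - (C - insert c T))"
        using card_odd_comps_split[OF _ cl] finW by simp
      also have "?W - insert c T - (C - insert c T) = ?W - C" using c T by blast
      also have "C - insert c T = C - {c} - T" by blast
      finally have 1: "?q (V - ?S) = ?q (C - {c} - T) + ?q (?W - C)" using VS by simp
      have "?q ?W = ?q C + ?q (?W - C)"
        using card_odd_comps_split[OF finW comps_closed[OF C]] .
      moreover have "?q C = 1"
        using all_odd[OF C] by (simp add: odd_comps_def comps_self[OF C] Collect_conv_if)
      ultimately have 2: "Suc (?q (?W - C)) = card S" using S by simp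
      have "card ?S = card S + card (insert c T)"
        using c T CW finS fT by (intro card_Un_disjoint) auto
      moreover have "card (insert c T) = Suc (card T)" using T fT by (intro card_insert_disjoint) auto
      ultimately have 3: "card ?S = card S + Suc (card T)" by simp
      have "?S \<subseteq> V" using S c T CW by blast
      then show False using not_big[of ?S] 1 2 3 ge by linarith
    qed
  qed
  let ?nb = "\<lambda>C. {s \<in> S. \<exists>c\<in>C. {s, c} \<in> E}"
  have "\<exists>f. inj_on f (comps E ?W) \<and> (\<forall>C\<in>comps E ?W. f C \<in> ?nb C)"
  proof (rule hall_marriage)
    show "finite (comps E ?W)" by (rule finite_comps[OF finW])
    show "finite (?nb C)" for C using finS by simp
    fix J assume J: "J \<subseteq> comps E ?W"
    let ?N = "\<Union>C\<in>J. ?nb C"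
    have NV: "?N \<subseteq> V" "?N \<subseteq> S" using S by auto
    \<comment> \<open>If only the neighbours \<open>?N\<close> of \<open>J\<close> are deleted
      instead of all of \<open>S\<close>, the members of \<open>J\<close> are still odd components,
      so the hypothesis for \<open>?N\<close> is Hall's condition for \<open>J\<close>.\<close>
    have "J \<subseteq> odd_comps E (V - ?N)"
    proof
      fix C assume CJ: "C \<in> J"
      then have C: "C \<in> comps E ?W" using J by blast
      have "closed_in E (V - ?N) C"
        unfolding closed_in_def
      proof (intro conjI ballI impI)
        show "C \<subseteq> V - ?N" using comps_subset[OF C] NV by blast
        fix e assume e: "e \<in> E" "e \<subseteq> V - ?N"
        show "e \<subseteq> C \<or> e \<inter> C = {}"
        proof (rule ccontr)
          assume n: "\<not> (e \<subseteq> C \<or> e \<inter> C = {})"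
          then obtain x y where xy: "x \<in> e" "y \<in> e" "y \<in> C" "x \<notin> C" by blast
          then have eq: "e = {x, y}" using assms(2)[OF e(1)] by (auto simp: card_2_iff)
          show False
          proof (cases "x \<in> S")
            case True
            then have "x \<in> ?N" using xy eq e CJ by auto
            then show False using e xy by auto
          next
            case False
            then have "e \<subseteq> ?W" using eq xy e comps_subset[OF C] by blast
            then show False using comps_closed[OF C] n e unfolding closed_in_def by blast
          qed
        qed
      qed
      then have "C \<in> comps E (V - ?N)"
        using comps_closed_iff[of E "V - ?N" C C] comps_self[OF C] by blast
      then show "C \<in> odd_comps E (V - ?N)" using all_odd[OF C] unfolding odd_comps_def by blast
    qed
    then have "card J \<le> ?q (V - ?N)" using fin by (intro card_mono finite_odd_comps) auto
    also have "\<dots> \<le> card ?N" using less.prems(2)[OF NV(1)] .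
    finally show "card J \<le> card ?N" .
  qed
  then obtain f where f: "inj_on f (comps E ?W)" "\<And>C. C \<in> comps E ?W \<Longrightarrow> f C \<in> ?nb C" by blast
  have "f ` comps E ?W \<subseteq> S" using f(2) by blast
  then have fS: "f ` comps E ?W = S"
    using card_image[OF f(1)] card_comps finS by (metis card_subset_eq)
  have "\<forall>C. \<exists>c. C \<in> comps E ?W \<longrightarrow> c \<in> C \<and> {f C, c} \<in> E" using f(2) by blast
  then obtain g where g: "\<And>C. C \<in> comps E ?W \<Longrightarrow> g C \<in> C \<and> {f C, g C} \<in> E" by metis
  have "matchable E (\<Union>C\<in>comps E ?W. {f C, g C} \<union> (C - {g C}))"
  proof (rule matchable_UN)
    show "finite (comps E ?W)" by (rule finite_comps[OF finW])
    show "matchable E ({f C, g C} \<union> (C - {g C}))" if C: "C \<in> comps E ?W" for C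
    proof (rule matchable_Un)
      show "{f C, g C} \<inter> (C - {g C}) = {}" using f(2)[OF C] comps_subset[OF C] by blast
    qed (use g[OF C] crit[OF C] matchable_edge in auto)
    fix C D assume CD: "C \<in> comps E ?W" "D \<in> comps E ?W" "C \<noteq> D"
    then have "f C \<noteq> f D" "C \<inter> D = {}" using f(1) comps_disjoint by (meson inj_onD, meson)
    moreover have "f C \<in> S" "f D \<in> S" using f(2) CD by auto
    moreover have "C \<subseteq> ?W" "D \<subseteq> ?W" using CD comps_subset by auto
    moreover have "{f C, g C} \<union> (C - {g C}) = insert (f C) C" "{f D, g D} \<union> (D - {g D}) = insert (f D) D"
      using g CD by auto
    ultimately show "({f C, g C} \<union> (C - {g C})) \<inter> ({f D, g D} \<union> (D - {g D})) = {}" by auto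
  qed
  also have "(\<Union>C\<in>comps E ?W. {f C, g C} \<union> (C - {g C})) = (\<Union>C\<in>comps E ?W. insert (f C) C)"
  proof (rule SUP_cong)
    fix C assume "C \<in> comps E ?W"
    then show "{f C, g C} \<union> (C - {g C}) = insert (f C) C" using g[of C] by auto
  qed simp
  also have "\<dots> = f ` comps E ?W \<union> \<Union>(comps E ?W)" by auto
  also have "\<dots> = V" using fS Union_comps[OF finW] S by blast
  finally show ?case .
qed

section \<open>Expanding graphs have perfect matchings\<close>

text \<open>A walk is recorded by its copies and not by its vertices, because the later union bound
  runs over the copies that have to be present.\<close>

fun chain :: "'v ugraph list \<Rightarrow> 'v \<Rightarrow> 'v \<Rightarrow> bool" where
  "chain [] u v \<longleftrightarrow> u = v"
| "chain (K # Ks) u v \<longleftrightarrow> u \<in> verts K \<and> (\<exists>x\<in>verts K. chain Ks x v)"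

lemma chain_append: "chain (Ks @ Ks') u v \<longleftrightarrow> (\<exists>x. chain Ks u x \<and> chain Ks' x v)"
  by (induction Ks arbitrary: u) auto

text \<open>Between two occurrences of the same copy the walk can be cut out, since a copy may be
  left at any of its vertices. Distinctness makes the number of copies required equal to the length
  of the list, as the probability estimate needs.\<close>

lemma chain_distinct:
  assumes "chain Ks u v"
  shows "\<exists>Ks'. distinct Ks' \<and> set Ks' \<subseteq> set Ks \<and> length Ks' \<le> length Ks \<and> chain Ks' u v"
  using assms
proof (induction "length Ks" arbitrary: Ks rule: less_induct)
  case less
  show ?case
  proof (cases "distinct Ks")
    case False
    then obtain xs ys zs K where Ks: "Ks = xs @ [K] @ ys @ [K] @ zs"
      using not_distinct_decomp by blast
    let ?Ks = "xs @ [K] @ zs"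
    have "chain ?Ks u v"
      using less.prems unfolding Ks by (auto simp: chain_append)
    moreover have "length ?Ks < length Ks" unfolding Ks by simp
    ultimately obtain Ks' where "distinct Ks'" "set Ks' \<subseteq> set ?Ks" "length Ks' \<le> length ?Ks"
      "chain Ks' u v"
      using less.hyps by blast
    moreover have "set ?Ks \<subseteq> set Ks" "length ?Ks \<le> length Ks" unfolding Ks by auto
    ultimately show ?thesis by (meson order_trans)
  qed (use less.prems in blast)
qed

definition hdeg :: "'v ugraph set \<Rightarrow> 'v \<Rightarrow> nat" where
  "hdeg M v = card {K \<in> M. v \<in> verts K}"

definition outer_nbhd :: "'v set set \<Rightarrow> 'v set \<Rightarrow> 'v set" where
  "outer_nbhd E A = {w. w \<notin> A \<and> (\<exists>v\<in>A. {v, w} \<in> E)}"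

lemma ex_neighbour:
  assumes "simple_graph K" "no_isolated_vertices K" "v \<in> verts K"
  shows "\<exists>w\<in>verts K. w \<noteq> v \<and> {v, w} \<in> edges K"
proof -
  have "{e \<in> edges K. v \<in> e} \<noteq> {}"
    using assms unfolding no_isolated_vertices_def degree_def by (metis card.empty)
  then obtain e where e: "e \<in> edges K" "v \<in> e" by blast
  then have "e \<subseteq> verts K" "card e = 2"
    using assms(1) unfolding simple_graph_def nsets_def by auto
  then obtain x y where xy: "e = {x, y}" "x \<noteq> y" by (meson card_2_iff)
  show ?thesis
  proof (cases "v = x")
    case True
    then show ?thesis using e xy \<open>e \<subseteq> verts K\<close> by (intro bexI[of _ y]) simp_all
  next
    case False
    then have "v = y" using e xy by simp
    have "{v, x} \<in> edges K" using e(1) unfolding \<open>v = y\<close> xy(1) by (simp add: insert_commute)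
    moreover have "x \<in> verts K" using \<open>e \<subseteq> verts K\<close> unfolding xy(1) by blast
    ultimately show ?thesis using False by (intro bexI[of _ x]) simp_all
  qed
qed

text \<open>Four copies suffice: each small vertex \<open>s\<close> gets a chosen neighbour \<open>t s\<close>, and if a vertex
  sees one of \<open>s\<close>, \<open>t s\<close> and one of \<open>s'\<close>, \<open>t s'\<close>, then \<open>s\<close> and \<open>s'\<close> are at distance at
  most four.\<close>

lemma expansion_of_small_sets:
  fixes M :: "'v ugraph set" and r :: real
  assumes fin: "finite M\<^sub>1" "finite V" and sub: "M\<^sub>0 \<subseteq> M" "M \<subseteq> M\<^sub>1"
    and copy: "\<And>K. K \<in> M\<^sub>1 \<Longrightarrow> simple_graph K \<and> no_isolated_vertices K \<and> card (verts K) = k \<and> verts K \<subseteq> V"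
    and cover: "\<And>v. v \<in> V \<Longrightarrow> \<exists>K\<in>M. v \<in> verts K"
    and sparse: "\<And>X. X \<subseteq> V \<Longrightarrow> X \<noteq> {} \<Longrightarrow> real (card X) \<le> 5 * r \<Longrightarrow>
                   card {K \<in> M\<^sub>1. 2 \<le> card (verts K \<inter> X)} < 2 * card X"
    and far: "\<And>u v Ks. u \<in> V \<Longrightarrow> v \<in> V \<Longrightarrow> u \<noteq> v \<Longrightarrow> hdeg M\<^sub>0 u < 10 * k \<Longrightarrow> hdeg M\<^sub>0 v < 10 * k \<Longrightarrow>
                distinct Ks \<Longrightarrow> set Ks \<subseteq> M\<^sub>1 \<Longrightarrow> length Ks \<le> 4 \<Longrightarrow> \<not> chain Ks u v"
    and A: "A \<subseteq> V" "real (card A) \<le> r"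
  shows "card A \<le> card (outer_nbhd (\<Union>(edges ` M)) A)"
proof -
  let ?E = "\<Union>(edges ` M)"
  define adj where "adj = (\<lambda>u v. \<exists>K\<in>M\<^sub>1. u \<in> verts K \<and> v \<in> verts K)"
  define small where "small = (\<lambda>v. hdeg M\<^sub>0 v < 10 * k)"
  have finM: "finite M" "finite M\<^sub>0" 
    using finite_subset[OF sub(2) fin(1)] finite_subset[OF sub(1)] by auto
  have finA: "finite A" using finite_subset[OF A(1) fin(2)] .
  have adj_sym: "adj v u" if "adj u v" for u v using that unfolding adj_def by blast
  have edgeV: "adj u v \<and> u \<in> V \<and> v \<in> V \<and> u \<noteq> v" if uv: "{u, v} \<in> ?E" for u v
  proof -
    obtain K where K: "K \<in> M" "{u, v} \<in> edges K" using uv by auto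
    have K1: "K \<in> M\<^sub>1" using sub(2) K(1) by (rule subsetD)
    have "edges K \<subseteq> nsets (verts K) 2" using copy[OF K1] by (simp add: simple_graph_def)
    then have "{u, v} \<in> nsets (verts K) 2" using K(2) by (rule subsetD)
    then have vs: "u \<in> verts K" "v \<in> verts K" "card {u, v} = 2" by (auto simp: nsets_def)
    then have "u \<noteq> v" by auto
    moreover have "u \<in> V" "v \<in> V" using vs(1,2) copy[OF K1] by auto
    moreover have "adj u v" unfolding adj_def using K1 vs by (intro bexI[of _ K]) auto
    ultimately show ?thesis by simp
  qed
  have far_chain: "\<not> chain Ks u v"
    if "u \<in> V" "v \<in> V" "u \<noteq> v" "small u" "small v" "set Ks \<subseteq> M\<^sub>1" "length Ks \<le> 4" for u v Ks
  proof
    assume "chain Ks u v"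
    then obtain Ks' where "distinct Ks'" "set Ks' \<subseteq> set Ks" "length Ks' \<le> length Ks" "chain Ks' u v"
      using chain_distinct[of Ks u v] by blast
    moreover have "set Ks' \<subseteq> M\<^sub>1" "length Ks' \<le> 4"
      using that(6,7) calculation by (blast, linarith)
    ultimately show False using far[of u v Ks'] that(1-5) unfolding small_def by blast
  qed
  \<comment> \<open>Equality is allowed at every step, so that one statement covers all distances up
    to four.\<close>
  have far4: False if uv: "u \<in> V" "v \<in> V" "u \<noteq> v" "small u" "small v"
    "adj u a \<or> u = a" "adj a b \<or> a = b" "adj b c \<or> b = c" "adj c v \<or> c = v" for u v a b c
  proof -
    have step: "\<exists>Ks. set Ks \<subseteq> M\<^sub>1 \<and> length Ks \<le> 1 \<and> chain Ks x y" if xy: "adj x y \<or> x = y" for x y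
    proof (cases "x = y")
      case True
      then show ?thesis by (intro exI[of _ "[]"]) auto
    next
      case False
      then obtain K where "K \<in> M\<^sub>1" "x \<in> verts K" "y \<in> verts K" using xy unfolding adj_def by blast
      then show ?thesis by (intro exI[of _ "[K]"]) auto
    qed
    obtain K1 where 1: "set K1 \<subseteq> M\<^sub>1" "length K1 \<le> 1" "chain K1 u a" using step uv(6) by blast
    obtain K2 where 2: "set K2 \<subseteq> M\<^sub>1" "length K2 \<le> 1" "chain K2 a b" using step uv(7) by blast
    obtain K3 where 3: "set K3 \<subseteq> M\<^sub>1" "length K3 \<le> 1" "chain K3 b c" using step uv(8) by blast
    obtain K4 where 4: "set K4 \<subseteq> M\<^sub>1" "length K4 \<le> 1" "chain K4 c v" using step uv(9) by blast
    have "chain (K1 @ K2 @ K3 @ K4) u v" using 1 2 3 4 by (auto simp: chain_append)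
    moreover have "length (K1 @ K2 @ K3 @ K4) \<le> 4" using 1 2 3 4 by simp
    moreover have "set (K1 @ K2 @ K3 @ K4) \<subseteq> M\<^sub>1" using 1 2 3 4 by simp
    ultimately show False using far_chain[OF uv(1-5)] by blast
  qed
  have "\<exists>w. {v, w} \<in> ?E" if v: "v \<in> V" for v
  proof -
    obtain K where K: "K \<in> M" "v \<in> verts K" using cover[OF v] by blast
    then show ?thesis using ex_neighbour[of K v] copy sub by blast
  qed
  then obtain t where t: "\<And>v. v \<in> V \<Longrightarrow> {v, t v} \<in> ?E" by metis
  define S where "S = {v \<in> A. small v}"
  define L where "L = {v \<in> A. \<not> small v}"
  define R where "R = outer_nbhd ?E L"
  have SL: "A = S \<union> L" "S \<inter> L = {}" unfolding S_def L_def by auto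
  have SV: "S \<subseteq> V" "L \<subseteq> V" "finite S" "finite L"
    using A finA unfolding S_def L_def by auto
  have RV: "R \<subseteq> V" using edgeV by (auto simp: R_def outer_nbhd_def)
  then have finR: "finite R" using fin finite_subset by blast
  have tadj: "adj v (t v)" "t v \<in> V" "t v \<noteq> v" if "v \<in> V" for v using edgeV[OF t[OF that]] by auto
  have t_inj: "inj_on t S"
  proof (rule inj_onI)
    fix u v assume uv: "u \<in> S" "v \<in> S" "t u = t v"
    show "u = v"
    proof (rule ccontr)
      assume "u \<noteq> v"
      then show False
        using far4[of u v "t u" "t u" "t u"] uv tadj[of u] tadj[of v] adj_sym SV unfolding S_def by auto
    qed
  qed
  have t_large: "t u \<notin> S" if "u \<in> S" for u
    using far4[of u "t u" u u u] tadj[of u] that SV unfolding S_def by auto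
  \<comment> \<open>Origin of \<open>10 * k\<close>: each vertex of \<open>L\<close> lies in at
    least \<open>10 * k\<close> copies and a copy has \<open>k\<close> vertices, so at least
    \<open>10 * card L\<close> copies meet \<open>L \<union> R\<close> twice. If
    \<open>L \<union> R\<close> had at most \<open>5 * card L\<close> elements, sparsity would allow
    fewer than \<open>2 * (5 * card L)\<close>.\<close>
  have R_big: "4 * card L < card R" if ne: "L \<noteq> {}"
  proof (rule ccontr)
    assume "\<not> 4 * card L < card R"
    then have le: "card (L \<union> R) \<le> 5 * card L"
      using card_Un_le[of L R] by linarith
    have "card L \<le> card A" using SL finA by (intro card_mono) auto
    then have "5 * real (card L) \<le> 5 * r" using A(2) by linarith
    moreover have "real (card (L \<union> R)) \<le> 5 * real (card L)" using le by linarith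
    ultimately have "real (card (L \<union> R)) \<le> 5 * r" by linarith
    then have lt: "card {K \<in> M\<^sub>1. 2 \<le> card (verts K \<inter> (L \<union> R))} < 2 * card (L \<union> R)"
      using that SV RV by (intro sparse) auto
    let ?B = "\<Union>v\<in>L. {K \<in> M\<^sub>0. v \<in> verts K}"
    have "?B \<subseteq> {K \<in> M\<^sub>1. 2 \<le> card (verts K \<inter> (L \<union> R))}"
    proof
      fix K assume "K \<in> ?B"
      then obtain v where v: "v \<in> L" "K \<in> M\<^sub>0" "v \<in> verts K" by blast
      then have K: "K \<in> M" "K \<in> M\<^sub>1" using sub by blast+
      obtain w where w: "w \<in> verts K" "w \<noteq> v" "{v, w} \<in> edges K"
        using ex_neighbour[of K v] copy[OF K(2)] v by blast
      then have "w \<in> L \<union> R" using v K unfolding R_def outer_nbhd_def by blast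
      then have "{v, w} \<subseteq> verts K \<inter> (L \<union> R)" using v w by blast
      moreover have "finite (verts K \<inter> (L \<union> R))" using SV finR by blast
      ultimately have "card {v, w} \<le> card (verts K \<inter> (L \<union> R))" by (intro card_mono) auto
      then show "K \<in> {K \<in> M\<^sub>1. 2 \<le> card (verts K \<inter> (L \<union> R))}" using w K by auto
    qed
    then have ub: "card ?B \<le> card {K \<in> M\<^sub>1. 2 \<le> card (verts K \<inter> (L \<union> R))}"
      using fin by (intro card_mono) auto
    have "10 * k * card L = (\<Sum>v\<in>L. 10 * k)" by simp
    also have "\<dots> \<le> (\<Sum>v\<in>L. card {K \<in> M\<^sub>0. v \<in> verts K})"
      by (intro sum_mono) (auto simp: L_def small_def hdeg_def)
    also have "\<dots> = (\<Sum>v\<in>L. \<Sum>K\<in>?B. if v \<in> verts K then 1 else 0)"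
    proof (intro sum.cong refl)
      fix v assume v: "v \<in> L"
      have "finite ?B" using finM SV by auto
      then have "(\<Sum>K\<in>?B. if v \<in> verts K then 1 else 0) = card {K \<in> ?B. v \<in> verts K}"
        by (simp add: sum.If_cases Int_def)
      also have "{K \<in> ?B. v \<in> verts K} = {K \<in> M\<^sub>0. v \<in> verts K}" using v by blast
      finally show "card {K \<in> M\<^sub>0. v \<in> verts K} = (\<Sum>K\<in>?B. if v \<in> verts K then 1 else 0)" by simp
    qed
    also have "\<dots> = (\<Sum>K\<in>?B. \<Sum>v\<in>L. if v \<in> verts K then 1 else 0)" by (rule sum.swap)
    also have "\<dots> \<le> (\<Sum>K\<in>?B. k)"
    proof (rule sum_mono)
      fix K assume "K \<in> ?B"
      then have K: "K \<in> M\<^sub>1" using sub by blast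
      have "(\<Sum>v\<in>L. if v \<in> verts K then 1 else 0) = card (L \<inter> verts K)"
        using SV by (simp add: sum.If_cases Int_def)
      also have "\<dots> \<le> card (verts K)"
        using copy[OF K] by (intro card_mono) (auto simp: simple_graph_def)
      finally show "(\<Sum>v\<in>L. if v \<in> verts K then 1 else 0) \<le> k" using copy[OF K] by simp
    qed
    finally have "k * (10 * card L) \<le> k * card ?B" by (simp add: mult_ac)
    moreover have "k > 0"
    proof -
      obtain v where "v \<in> L" using ne by blast
      then obtain K where "K \<in> M" "v \<in> verts K" using cover SV by blast
      then have "K \<in> M\<^sub>1" "v \<in> verts K" using sub by auto
      then show ?thesis using copy[of K] by (metis card_gt_0_iff empty_iff simple_graph_def)
    qed
    ultimately have "10 * card L \<le> card ?B" by simp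
    then show False using ub lt le by linarith
  qed
  have R_few: "card (R \<inter> (S \<union> t ` S)) \<le> 2 * card L"
  proof -
    have "R \<inter> (S \<union> t ` S) \<subseteq> (\<Union>v\<in>L. {w \<in> S \<union> t ` S. adj v w})"
      unfolding R_def outer_nbhd_def using edgeV by blast
    then have "card (R \<inter> (S \<union> t ` S)) \<le> card (\<Union>v\<in>L. {w \<in> S \<union> t ` S. adj v w})"
      using SV by (intro card_mono) auto
    also have "\<dots> \<le> (\<Sum>v\<in>L. card {w \<in> S \<union> t ` S. adj v w})"
      by (rule card_UN_le[OF SV(4)])
    also have "\<dots> \<le> (\<Sum>v\<in>L. 2)"
    proof (rule sum_mono)
      fix v assume v: "v \<in> L"
      have near: "\<exists>b. (adj s b \<or> s = b) \<and> adj b v \<and> (w = s \<or> w = t s)" if "adj v w" "w = s \<or> w = t s" "s \<in> S" for w s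
        using that tadj[of s] adj_sym SV by blast
      show "card {w \<in> S \<union> t ` S. adj v w} \<le> 2"
      proof (cases "{w \<in> S \<union> t ` S. adj v w} = {}")
        case False
        then obtain w where w: "adj v w" "w \<in> S \<union> t ` S" by blast
        then obtain s where s: "s \<in> S" "w = s \<or> w = t s" by blast
        have "{w \<in> S \<union> t ` S. adj v w} \<subseteq> {s, t s}"
        proof
          fix w' assume "w' \<in> {w \<in> S \<union> t ` S. adj v w}"
          then obtain s' where s': "adj v w'" "s' \<in> S" "w' = s' \<or> w' = t s'" by blast
          have "s' = s"
          proof (rule ccontr)
            assume ne: "s' \<noteq> s"
            obtain b where b: "adj s b \<or> s = b" "adj b v" using near[OF w(1) s(2,1)] by blast
            obtain b' where b': "adj s' b' \<or> s' = b'" "adj b' v" using near[OF s'(1,3,2)] by blast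
            show False
              using far4[of s' s b' v b] b b' adj_sym s s' ne SV unfolding S_def by blast
          qed
          then show "w' \<in> {s, t s}" using s' by blast
        qed
        then have "card {w \<in> S \<union> t ` S. adj v w} \<le> card {s, t s}" by (intro card_mono) auto
        also have "\<dots> \<le> 2" by (simp add: card_insert_if)
        finally show ?thesis .
      next
        case True
        show ?thesis unfolding True by simp
      qed
    qed
    finally show ?thesis by simp
  qed
  have "outer_nbhd ?E A \<subseteq> V" using edgeV by (auto simp: outer_nbhd_def)
  then have finN: "finite (outer_nbhd ?E A)" using fin finite_subset by blast
  \<comment> \<open>The two parts are disjoint and have together at least
    \<open>(card S - card L) + (card R - 2 * card L)\<close> elements. Reaching
    \<open>card S + card L\<close> takes exactly the expansion factor four of
    \<open>L\<close>.\<close>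
  have sub: "(t ` S - L) \<union> (R - (S \<union> t ` S)) \<subseteq> outer_nbhd ?E A"
  proof (rule Un_least)
    show "t ` S - L \<subseteq> outer_nbhd ?E A"
    proof
      fix w assume "w \<in> t ` S - L"
      then obtain s where s: "s \<in> S" "w = t s" "w \<notin> L" by auto
      then have "w \<notin> A" using t_large[OF s(1)] SL(1) by simp
      moreover have "s \<in> A" "{s, w} \<in> ?E" using s t[of s] SL(1) SV(1) by auto
      ultimately show "w \<in> outer_nbhd ?E A" unfolding outer_nbhd_def by blast
    qed
    show "R - (S \<union> t ` S) \<subseteq> outer_nbhd ?E A"
      using SL(1) by (auto simp: outer_nbhd_def R_def)
  qed
  have "card (t ` S - L) + card (R - (S \<union> t ` S)) = card ((t ` S - L) \<union> (R - (S \<union> t ` S)))"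
    using SV finR by (intro card_Un_disjoint[symmetric]) auto
  also have "\<dots> \<le> card (outer_nbhd ?E A)" by (rule card_mono[OF finN sub])
  finally have 1: "card (t ` S - L) + card (R - (S \<union> t ` S)) \<le> card (outer_nbhd ?E A)" .
  have 2: "card S \<le> card (t ` S - L) + card L"
    using diff_card_le_card_Diff[OF SV(4), of "t ` S"] card_image[OF t_inj] by linarith
  have 3: "card R \<le> card (R - (S \<union> t ` S)) + 2 * card L"
    using card_Diff_subset_Int[of R "S \<union> t ` S"] R_few finR by auto
  have 4: "card A = card S + card L" using SL SV card_Un_disjoint by metis
  show ?thesis
  proof (cases "L = {}")
    case True
    then show ?thesis using 1 2 4 by simp
  next
    case False
    then show ?thesis using 1 2 3 4 R_big by linarith
  qed
qed

text \<open>Sets are added one at a time; the step that first reaches \<open>b\<close> adds less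
  than \<open>b\<close>, so it stays below \<open>2 * b\<close>.\<close>

lemma greedy_subfamily:
  fixes b :: real
  assumes "finite \<D>" "\<And>D. D \<in> \<D> \<Longrightarrow> real (card D) < b" "b \<le> real (card (\<Union>\<D>))" "b > 0"
  shows "\<exists>\<D>'\<subseteq>\<D>. b \<le> real (card (\<Union>\<D>')) \<and> real (card (\<Union>\<D>')) < 2 * b"
  using assms
proof (induction \<D> rule: finite_induct)
  case (insert D \<D>)
  show ?case
  proof (cases "b \<le> real (card (\<Union>\<D>))")
    case True
    then show ?thesis using insert by (metis insertCI subset_insertI2)
  next
    case False
    have "real (card (\<Union>(insert D \<D>))) \<le> real (card D) + real (card (\<Union>\<D>))"
      using card_Un_le[of D "\<Union>\<D>"] by simp
    moreover have "real (card D) < b" using insert by blast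
    ultimately have "real (card (\<Union>(insert D \<D>))) < 2 * b" using False by linarith
    then show ?thesis using insert.prems by blast
  qed
qed simp

lemma card_le_card_Union:
  assumes "finite \<D>" "\<And>D. D \<in> \<D> \<Longrightarrow> finite D \<and> D \<noteq> {}" "pairwise disjnt \<D>"
  shows "card \<D> \<le> card (\<Union>\<D>)"
proof -
  have "card \<D> = (\<Sum>D\<in>\<D>. 1)" by simp
  also have "\<dots> \<le> (\<Sum>D\<in>\<D>. card D)"
    using assms(2) by (intro sum_mono) (simp add: Suc_leI card_gt_0_iff)
  also have "\<dots> = card (\<Union>\<D>)" using assms by (intro card_Union_disjoint[symmetric]) auto
  finally show ?thesis .
qed

text \<open>If a set \<open>S\<close> violates Tutte's condition, then the union \<open>U\<close> of all components outside \<open>S\<close>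
  except the largest one has more than \<open>card S\<close> elements, so expansion makes \<open>U\<close> large, and
  the components can be split into two large parts without an edge between them.\<close>

lemma matchable_if_expanding:
  fixes r :: real
  assumes fin: "finite V" and ev: "even (card V)"
    and E: "\<And>e. e \<in> E \<Longrightarrow> card e = 2 \<and> e \<subseteq> V"
    and small: "\<And>A. A \<subseteq> V \<Longrightarrow> real (card A) \<le> r \<Longrightarrow> card A \<le> card (outer_nbhd E A)"
    and no_hole: "\<And>A T. A \<subseteq> V \<Longrightarrow> T \<subseteq> V \<Longrightarrow> A \<inter> T = {} \<Longrightarrow> r \<le> real (card A) \<Longrightarrow>
       card T \<le> 8 * card A \<Longrightarrow> 16 * (card A + card T) \<le> 15 * card V \<Longrightarrow>
       \<exists>a\<in>A. \<exists>b\<in>V - A - T. {a, b} \<in> E"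
    and r: "16 * r \<le> real (card V)"
  shows "matchable E V"
proof (rule tutte[OF fin])
  show "\<And>e. e \<in> E \<Longrightarrow> card e = 2" using E by blast
  \<comment> \<open>Above size \<open>r\<close> the outer neighbourhood itself plays the part of
    \<open>T\<close>: were it smaller than \<open>A\<close>, there would be an edge from
    \<open>A\<close> to a vertex that is neither in \<open>A\<close> nor a neighbour of
    \<open>A\<close>.\<close>
  have expand: "card A \<le> card (outer_nbhd E A)" if A: "A \<subseteq> V" "4 * card A \<le> card V" for A
  proof (cases "real (card A) \<le> r")
    case True
    then show ?thesis using small A by blast
  next
    case False
    show ?thesis
    proof (rule ccontr)
      assume "\<not> ?thesis"
      then have lt: "card (outer_nbhd E A) < card A" by simp
      have "\<exists>a\<in>A. \<exists>b\<in>V - A - outer_nbhd E A. {a, b} \<in> E"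
        using False A lt E by (intro no_hole) (auto simp: outer_nbhd_def)
      then show False unfolding outer_nbhd_def by blast
    qed
  qed
  fix S assume S: "S \<subseteq> V"
  show "card (odd_comps E (V - S)) \<le> card S"
  proof (rule ccontr)
    assume "\<not> ?thesis"
    then have gt: "card S < card (odd_comps E (V - S))" by simp
    let ?W = "V - S"
    let ?C = "comps E ?W"
    have finS: "finite S" and finW: "finite ?W" using S fin finite_subset by auto
    have cardV: "card V = card S + card ?W"
      using S fin finS by (simp add: card_Diff_subset card_mono)
    then have "even (card (odd_comps E ?W)) \<longleftrightarrow> even (card S)"
      using ev even_card_odd_comps[OF finW, of E] by simp
    \<comment> \<open>Since \<open>V\<close> has even size, an excess of one is an excess of two; so
      even without the largest component there remain more than \<open>card S\<close>
      components.\<close>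
    then have "card S + 2 \<le> card (odd_comps E ?W)" using gt by presburger
    moreover have "card (odd_comps E ?W) \<le> card ?C"
      using finite_comps[OF finW] by (intro card_mono) (auto simp: odd_comps_def)
    ultimately have cC: "card S + 2 \<le> card ?C" by linarith
    have dis: "pairwise disjnt \<D>" if "\<D> \<subseteq> ?C" for \<D>
      using that comps_disjoint by (fastforce simp: pairwise_def disjnt_def)
    have le_Union: "card \<D> \<le> card (\<Union>\<D>)" if "\<D> \<subseteq> ?C" for \<D>
    proof (rule card_le_card_Union[OF _ _ dis[OF that]])
      show "finite \<D>" using that finite_comps[OF finW] finite_subset by blast
      show "finite D \<and> D \<noteq> {}" if "D \<in> \<D>" for D
        using that \<open>\<D> \<subseteq> ?C\<close> comps_subset comps_nonempty finW finite_subset by (metis subsetD)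
    qed
    have "card ?C \<le> card ?W" using le_Union[of ?C] Union_comps[OF finW, of E] by simp
    then have s_half: "2 * card S + 2 \<le> card V" using cC cardV by linarith
    have "?C \<noteq> {}" using cC by auto
    then have "Max (card ` ?C) \<in> card ` ?C" using finite_comps[OF finW] by (intro Max_in) auto
    then obtain C where C: "C \<in> ?C" "card C = Max (card ` ?C)" by auto
    have Cmax: "card D \<le> card C" if "D \<in> ?C" for D
      using that C(2) finite_comps[OF finW] by simp
    note C = C(1)
    let ?U = "\<Union>(?C - {C})"
    have clU: "closed_in E ?W ?U" using comps_closed by (intro closed_in_Union) auto
    have "card ?C = Suc (card (?C - {C}))" using C finite_comps[OF finW] by (metis card_Suc_Diff1)
    then have U_big: "card S < card ?U" using le_Union[of "?C - {C}"] cC by auto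
    have UW: "?U \<subseteq> ?W" using closed_in_subset[OF clU] .
    have no_edge: "outer_nbhd E D \<subseteq> S" if "closed_in E ?W D" for D
    proof
      fix w assume "w \<in> outer_nbhd E D"
      then obtain v where v: "v \<in> D" "w \<notin> D" "{v, w} \<in> E" unfolding outer_nbhd_def by blast
      show "w \<in> S"
      proof (rule ccontr)
        assume "w \<notin> S"
        moreover have "D \<subseteq> ?W" using closed_in_subset[OF that] .
        ultimately have "{v, w} \<subseteq> ?W" using v E[OF v(3)] by blast
        then show False using closed_in_cases[OF that v(3)] v by blast
      qed
    qed
    \<comment> \<open>\<open>S\<close> itself plays the part of \<open>T\<close>. It has less than
      half of the vertices, hence at most \<open>8 * card A\<close> as soon as \<open>A\<close> has
      a sixteenth of them; this fixes the constants 8 and 16 of \<open>no_hole\<close>.\<close>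
    have split: False if "closed_in E ?W A" "card V \<le> 16 * card A"
      "16 * (card A + card S) \<le> 15 * card V" for A
    proof -
      have AW: "A \<subseteq> ?W" using closed_in_subset[OF that(1)] .
      have "r \<le> real (card A)" using r that(2) by linarith
      then have "\<exists>a\<in>A. \<exists>b\<in>V - A - S. {a, b} \<in> E"
        using AW S that s_half by (intro no_hole) auto
      then have "\<exists>b\<in>outer_nbhd E A. b \<notin> S" unfolding outer_nbhd_def by blast
      then show False using no_edge[OF that(1)] by blast
    qed
    have Ularge: "card V < 4 * card ?U"
    proof (rule ccontr)
      assume "\<not> ?thesis"
      then have "card ?U \<le> card (outer_nbhd E ?U)" using UW by (intro expand) auto
      also have "\<dots> \<le> card S" by (rule card_mono[OF finS no_edge[OF clU]])
      finally show False using U_big by simp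
    qed
    show False
    \<comment> \<open>If the largest component has a sixteenth of the vertices, it is the far side
      of \<open>?U\<close>. Otherwise all components are below that size, and collecting them
      greedily stops between a sixteenth and an eighth.\<close>
    proof (cases "card V \<le> 16 * card C")
      case True
      have "card (C \<union> ?U) = card C + card ?U"
      proof (rule card_Un_disjoint)
        show "finite C" using comps_subset[OF C] finW finite_subset by blast
        show "finite ?U" using UW finW finite_subset by blast
        show "C \<inter> ?U = {}" using comps_disjoint[OF C] by auto
      qed
      moreover have "C \<union> ?U = ?W" using Union_comps[OF finW, of E] C by blast
      ultimately have "card ?W = card C + card ?U" by simp
      then have "16 * (card ?U + card S) \<le> 15 * card V" using True cardV by presburger
      moreover have "card V \<le> 16 * card ?U" using Ularge by linarith
      ultimately show False using split[OF clU] by blast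
    next
      case False
      have "\<exists>\<D>'\<subseteq>?C - {C}. real (card V) / 16 \<le> real (card (\<Union>\<D>')) \<and>
              real (card (\<Union>\<D>')) < 2 * (real (card V) / 16)"
      proof (rule greedy_subfamily)
        show "finite (?C - {C})" using finite_comps[OF finW] by simp
        show "real (card D) < real (card V) / 16" if "D \<in> ?C - {C}" for D
        proof -
          have "16 * card D < card V" using that False Cmax[of D] by auto
          then show ?thesis by linarith
        qed
        show "real (card V) / 16 \<le> real (card ?U)" using Ularge by linarith
        show "0 < real (card V) / 16" using s_half by linarith
      qed
      then obtain \<D> where D: "\<D> \<subseteq> ?C - {C}" "real (card V) / 16 \<le> real (card (\<Union>\<D>))"
        "real (card (\<Union>\<D>)) < 2 * (real (card V) / 16)" by blast
      have cl: "closed_in E ?W (\<Union>\<D>)" using D(1) comps_closed by (intro closed_in_Union) auto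
      have "card V \<le> 16 * card (\<Union>\<D>)" using D(2) by linarith
      moreover have "8 * card (\<Union>\<D>) < card V" using D(3) by simp
      then have "16 * card (\<Union>\<D>) + 16 * card S \<le> 15 * card V" using s_half by linarith
      then have "16 * (card (\<Union>\<D>) + card S) \<le> 15 * card V" by (simp only: add_mult_distrib2)
      ultimately show False using split[OF cl] by blast
    qed
  qed
qed

section \<open>Uniformly random permutations\<close>

abbreviation uniform_perm :: "'a set \<Rightarrow> 'a list pmf" where
  "uniform_perm C \<equiv> pmf_of_set (permutations_of_set C)"

text \<open>All admissible lists of length \<open>i\<close> have the same number of one-step
  extensions, and different lists have disjoint sets of extensions, so uniformity passes from
  \<open>i\<close> to \<open>Suc i\<close>.\<close>

lemma motif_sequence_eq:
  assumes fin: "finite (copies H n)" and "i \<le> card (copies H n)"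
  shows "motif_sequence H n i =
    pmf_of_set {xs. length xs = i \<and> distinct xs \<and> set xs \<subseteq> copies H n}"
  using assms(2)
proof (induction i)
  case 0
  have "{xs. length xs = 0 \<and> distinct xs \<and> set xs \<subseteq> copies H n} = {[]}" by auto
  then show ?case by (simp add: pmf_of_set_singleton)
next
  case (Suc i)
  let ?C = "copies H n"
  let ?S = "\<lambda>i. {xs. length xs = i \<and> distinct xs \<and> set xs \<subseteq> ?C}"
  let ?f = "\<lambda>xs. (\<lambda>x. xs @ [x]) ` (?C - set xs)"
  have left: "finite (?C - set xs)" "card (?C - set xs) = card ?C - i" "?C - set xs \<noteq> {}" if "xs \<in> ?S i" for xs
  proof -
    show *: "card (?C - set xs) = card ?C - i"
      using that by (subst card_Diff_subset) (auto simp: distinct_card)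
    show "finite (?C - set xs)" using fin by simp
    show "?C - set xs \<noteq> {}"
      using * Suc.prems by (metis card.empty diff_is_0_eq not_less_eq_eq)
  qed
  have eq: "?S (Suc i) = (\<Union>xs\<in>?S i. ?f xs)"
  proof (intro set_eqI iffI)
    fix ys assume ys: "ys \<in> ?S (Suc i)"
    then obtain xs x where yx: "ys = xs @ [x]" by (cases ys rule: rev_cases) auto
    then have "xs \<in> ?S i" "x \<in> ?C - set xs" using ys by auto
    then show "ys \<in> (\<Union>xs\<in>?S i. ?f xs)" using yx by blast
  qed auto
  have "finite (?S j)" for j
    by (rule finite_subset[OF _ finite_lists_length_eq[OF fin, of j]]) auto
  have ne: "?S i \<noteq> {}"
  proof -
    obtain cs where "set cs = ?C" "distinct cs" using fin finite_distinct_list by blast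
    then have "take i cs \<in> ?S i" using Suc.prems
      by (auto simp: distinct_card[symmetric] min_def dest: in_set_takeD)
    then show ?thesis by blast
  qed
  have "motif_sequence H n (Suc i) =
      bind_pmf (pmf_of_set (?S i)) (\<lambda>xs. map_pmf (\<lambda>x. xs @ [x]) (pmf_of_set (?C - set xs)))"
    using Suc by simp
  also have "\<dots> = bind_pmf (pmf_of_set (?S i)) (\<lambda>xs. pmf_of_set (?f xs))"
  proof (rule bind_pmf_cong[OF refl])
    fix xs assume "xs \<in> set_pmf (pmf_of_set (?S i))"
    then have "xs \<in> ?S i" using ne \<open>finite (?S i)\<close> by simp
    then show "map_pmf (\<lambda>x. xs @ [x]) (pmf_of_set (?C - set xs)) = pmf_of_set (?f xs)"
      using left by (intro map_pmf_of_set_inj) (auto intro: inj_onI)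
  qed
  also have "\<dots> = pmf_of_set (\<Union>xs\<in>?S i. ?f xs)"
  proof (rule pmf_of_set_UN[symmetric])
    show "finite (\<Union>xs\<in>?S i. ?f xs)" using eq \<open>finite (?S (Suc i))\<close> by simp
    show "?S i \<noteq> {}" by (rule ne)
    show "?f xs \<noteq> {}" if "xs \<in> ?S i" for xs using left(3)[OF that] by simp
    show "card (?f xs) = card ?C - i" if "xs \<in> ?S i" for xs
      using left(2)[OF that] by (subst card_image) (auto intro: inj_onI)
    show "disjoint_family_on ?f (?S i)" by (auto simp: disjoint_family_on_def)
  qed
  finally show ?case using eq by simp
qed

lemma motif_process_eq:
  assumes "finite (copies H n)"
  shows "motif_process H n = uniform_perm (copies H n)"
proof -
  have "{xs. length xs = card (copies H n) \<and> distinct xs \<and> set xs \<subseteq> copies H n}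
      = permutations_of_set (copies H n)"
  proof (intro set_eqI iffI)
    fix xs assume "xs \<in> permutations_of_set (copies H n)"
    then show "xs \<in> {xs. length xs = card (copies H n) \<and> distinct xs \<and> set xs \<subseteq> copies H n}"
      by (auto simp: permutations_of_set_def distinct_card[symmetric])
  next
    fix xs assume "xs \<in> {xs. length xs = card (copies H n) \<and> distinct xs \<and> set xs \<subseteq> copies H n}"
    then show "xs \<in> permutations_of_set (copies H n)"
      using card_subset_eq[OF assms, of "set xs"] by (simp add: permutations_of_set_def distinct_card)
  qed
  then show ?thesis unfolding motif_process_def using motif_sequence_eq[OF assms] by simp
qed

section \<open>Containing and avoiding families of elements, by conditioning on the first
  element\<close>

lemma prob_uniform_perm_step:
  assumes "finite C" "C \<noteq> {}"
  shows "measure_pmf.prob (uniform_perm C) X =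
    (\<Sum>x\<in>C. measure_pmf.prob (uniform_perm (C - {x})) {ys. x # ys \<in> X}) / card C"
proof -
  have prob: "measure_pmf.prob p Y = pmf (map_pmf (\<lambda>y. y \<in> Y) p) True" for p :: "'b pmf" and Y
    by (simp add: pmf_map vimage_def)
  have "map_pmf (\<lambda>y. y \<in> X) (uniform_perm C) =
    bind_pmf (pmf_of_set C) (\<lambda>x. map_pmf (\<lambda>ys. ys \<in> {ys. x # ys \<in> X}) (uniform_perm (C - {x})))"
    unfolding random_permutation_of_set[OF assms]
    by (simp add: map_bind_pmf bind_return_pmf map_pmf_def bind_assoc_pmf)
  then show ?thesis
    unfolding prob by (simp only: pmf_bind_pmf_of_set[OF assms(2,1)])
qed

text \<open>The first two terms of the binomial expansion. This form remains valid for
  \<open>a = 0\<close>, which occurs below when \<open>m = 1\<close>.\<close>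

lemma Bernoulli_homogeneous:
  fixes a b :: real
  assumes "a \<ge> 0" "b \<ge> 0"
  shows "a ^ j + j * a ^ (j - 1) * b \<le> (a + b) ^ j"
proof (induction j)
  case (Suc j)
  have "a ^ Suc j + Suc j * a ^ (Suc j - 1) * b \<le> (a ^ j + j * a ^ (j - 1) * b) * (a + b)"
  proof (cases j)
    case (Suc i)
    have "0 \<le> j * a ^ (j - 1) * b * b" using assms by simp
    then show ?thesis using Suc by (simp add: algebra_simps)
  qed simp
  also have "\<dots> \<le> (a + b) ^ j * (a + b)" using Suc assms by (intro mult_right_mono) auto
  finally show ?case by (simp add: mult.commute)
qed simp

text \<open>With \<open>q = (m - 1) / (N - 1)\<close> one has
  \<open>m / N = q + (1 - q) / N\<close>, so the left-hand side is \<open>N\<close> times the first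
  two binomial terms of \<open>(m / N) ^ j\<close>.\<close>

lemma perm_weight_step:
  assumes "1 \<le> N" "1 \<le> m" "m \<le> N" "j \<le> N"
  shows "j * ((real m - 1) / (real N - 1)) ^ (j - 1) + (real N - j) * ((real m - 1) / (real N - 1)) ^ j
    \<le> N * (real m / N) ^ j"
proof -
  define q where "q = (real m - 1) / (real N - 1)"
  have q: "0 \<le> q" "q \<le> 1" using assms by (auto simp: q_def divide_le_eq_1)
  have mN: "real m / N = q + (1 - q) / N"
  proof (cases "N = 1")
    \<comment> \<open>Here \<open>m = 1\<close> and \<open>q\<close> is 0 / 0, which is 0.\<close>
    case True
    then show ?thesis using assms by (simp add: q_def)
  next
    case False
    then have "real N - 1 \<noteq> 0" "real N \<noteq> 0" using assms by auto
    then have "q * (real N - 1) = real m - 1" unfolding q_def by simp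
    then have "q * real N + (1 - q) = real m" by (simp add: algebra_simps)
    then show ?thesis using \<open>real N \<noteq> 0\<close> by (simp add: field_simps)
  qed
  have pw: "real j * q ^ (j - 1) * q = real j * q ^ j"
    by (cases j) auto
  have "N * (q ^ j + j * q ^ (j - 1) * ((1 - q) / N)) \<le> N * (real m / N) ^ j"
    unfolding mN using q by (intro mult_left_mono Bernoulli_homogeneous) auto
  moreover have "N * (q ^ j + j * q ^ (j - 1) * ((1 - q) / N)) = N * q ^ j + j * q ^ (j - 1) * (1 - q)"
    using assms by (simp add: distrib_left)
  moreover have "\<dots> = j * q ^ (j - 1) + (real N - j) * q ^ j"
  proof -
    have "j * q ^ (j - 1) * (1 - q) = j * q ^ (j - 1) - j * q ^ j"
      unfolding right_diff_distrib pw by simp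
    then show ?thesis unfolding left_diff_distrib by linarith
  qed
  ultimately show ?thesis unfolding q_def by linarith
qed

text \<open>By induction on the first element of the permutation; \<open>perm_weight_step\<close> (Bernoulli's
  inequality) says that the bound is preserved.\<close>

lemma prob_contain_avoid_le:
  assumes "finite C" "J \<subseteq> C" "F \<subseteq> C" "J \<inter> F = {}" "m\<^sub>0 \<le> m\<^sub>1" "m\<^sub>1 \<le> card C"
  shows "measure_pmf.prob (uniform_perm C)
           {xs. J \<subseteq> set (take m\<^sub>1 xs) \<and> set (take m\<^sub>0 xs) \<inter> F = {}}
         \<le> (real m\<^sub>1 / card C) ^ card J * (1 - real (card F) / card C) ^ (m\<^sub>0 - card J)"
  using assms
proof (induction "card C" arbitrary: C J F m\<^sub>0 m\<^sub>1)
  case 0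
  then have "C = {}" "J = {}" by auto
  then show ?case using 0 by simp
next
  case (Suc N')
  let ?N = "real (card C)"
  let ?ev = "\<lambda>J F m\<^sub>0 m\<^sub>1. {xs. J \<subseteq> set (take m\<^sub>1 xs) \<and> set (take m\<^sub>0 xs) \<inter> F = {}}"
  note fin = \<open>finite C\<close>
  have ne: "C \<noteq> {}" using Suc.hyps(2) by auto
  have N: "card C \<ge> 1" "real N' = ?N - 1" using Suc.hyps(2) by auto
  have fJ: "finite J" "finite F" using Suc.prems fin finite_subset by blast+
  have JF: "card J + card F \<le> card C"
    using card_mono[OF fin, of "J \<union> F"] Suc.prems fJ by (simp add: card_Un_disjoint)
  show ?case
  proof (cases "m\<^sub>1 = 0")
    case True
    show ?thesis
    proof (cases "J = {}")
      case J: True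
      then show ?thesis using True Suc.prems by simp
    next
      case False
      then have "?ev J F m\<^sub>0 m\<^sub>1 = {}" using True by auto
      moreover have "0 \<le> 1 - real (card F) / card C" using JF N by (auto simp: divide_le_eq_1)
      ultimately show ?thesis by (simp only: measure_empty) simp
    qed
  next
    case False
    define j where "j = card J"
    define f where "f = card F"
    define q where "q = (real m\<^sub>1 - 1) / (?N - 1)"
    define \<theta> where "\<theta> = 1 - f / ?N"
    have m1: "1 \<le> m\<^sub>1" "m\<^sub>1 \<le> card C" using False Suc.prems by auto
    have q0: "0 \<le> q" using m1 by (simp add: q_def)
    have \<theta>0: "0 \<le> \<theta>" "\<theta> \<le> 1" using JF N by (auto simp: \<theta>_def f_def divide_le_eq_1)
    \<comment> \<open>For \<open>m\<^sub>0 = 0\<close> the avoidance factor has exponent 0, so then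
      \<open>F'\<close> may have any size.\<close>
    have IH: "measure_pmf.prob (uniform_perm (C - {x})) (?ev J' F' (m\<^sub>0 - 1) (m\<^sub>1 - 1))
        \<le> q ^ card J' * \<theta> ^ (m\<^sub>0 - 1 - card J')"
      if x: "x \<in> C" and J': "J' \<subseteq> C - {x}" and F': "F' \<subseteq> C - {x}" "J' \<inter> F' = {}" "card F' = f \<or> m\<^sub>0 = 0" for x J' F'
    proof -
      have cN: "card (C - {x}) = N'" using x Suc.hyps(2) fin by simp
      have "measure_pmf.prob (uniform_perm (C - {x})) (?ev J' F' (m\<^sub>0 - 1) (m\<^sub>1 - 1))
        \<le> (real (m\<^sub>1 - 1) / card (C - {x})) ^ card J' * (1 - real (card F') / card (C - {x})) ^ (m\<^sub>0 - 1 - card J')"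
        by (rule Suc.hyps(1)) (use cN fin that Suc.prems m1 N Suc.hyps(2) in auto)
      also have "\<dots> \<le> q ^ card J' * \<theta> ^ (m\<^sub>0 - 1 - card J')"
      proof (rule mult_mono)
        show "(real (m\<^sub>1 - 1) / card (C - {x})) ^ card J' \<le> q ^ card J'"
          using m1 N cN by (simp add: q_def of_nat_diff)
        have F'N: "card F' \<le> N'" using card_mono[OF _ F'(1)] fin cN by simp
        show "(1 - real (card F') / card (C - {x})) ^ (m\<^sub>0 - 1 - card J') \<le> \<theta> ^ (m\<^sub>0 - 1 - card J')"
        proof (cases "m\<^sub>0 = 0")
          case False
          then have "card F' = f" using F' by blast
          moreover have "f / ?N \<le> f / N'"
          proof (cases "N' = 0")
            case True
            then show ?thesis using F'N \<open>card F' = f\<close> by simp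
          next
            case False
            then show ?thesis using N by (intro divide_left_mono) auto
          qed
          ultimately have "1 - real (card F') / card (C - {x}) \<le> \<theta>"
            unfolding \<theta>_def cN by simp
          moreover have "0 \<le> 1 - real (card F') / card (C - {x})"
            unfolding cN using F'N by (auto simp: divide_le_eq_1)
          ultimately show ?thesis by (intro power_mono)
        qed simp
        show "0 \<le> (1 - real (card F') / card (C - {x})) ^ (m\<^sub>0 - 1 - card J')"
          unfolding cN using F'N by (intro zero_le_power) (auto simp: divide_le_eq_1)
      qed (use q0 in auto)
      finally show ?thesis .
    qed
    define a where "a = q ^ (j - 1) * \<theta> ^ (m\<^sub>0 - j)"
    define b where "b = q ^ j * \<theta> ^ (m\<^sub>0 - 1 - j)"
    define g where "g = (\<lambda>x. measure_pmf.prob (uniform_perm (C - {x})) {ys. x # ys \<in> ?ev J F m\<^sub>0 m\<^sub>1})"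
    have take_Cons1: "take m\<^sub>1 (x # ys) = x # take (m\<^sub>1 - 1) ys" for x ys
      using m1 by (cases m\<^sub>1) auto
    have a0: "0 \<le> a" "0 \<le> b" using q0 \<theta>0 by (auto simp: a_def b_def)
    have in_J: "g x \<le> a" if x: "x \<in> J" for x
    proof -
      have xC: "x \<in> C" using x Suc.prems by blast
      have "{ys. x # ys \<in> ?ev J F m\<^sub>0 m\<^sub>1} \<subseteq> ?ev (J - {x}) F (m\<^sub>0 - 1) (m\<^sub>1 - 1)"
        by (cases m\<^sub>0) (auto simp: take_Cons1)
      then have "g x \<le> measure_pmf.prob (uniform_perm (C - {x})) (?ev (J - {x}) F (m\<^sub>0 - 1) (m\<^sub>1 - 1))"
        unfolding g_def by (intro measure_pmf.finite_measure_mono) auto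
      also have "\<dots> \<le> q ^ card (J - {x}) * \<theta> ^ (m\<^sub>0 - 1 - card (J - {x}))"
        by (rule IH) (use xC x Suc.prems in \<open>auto simp: f_def\<close>)
      also have "card (J - {x}) = j - 1" using x by (simp add: j_def)
      also have "m\<^sub>0 - 1 - (j - 1) = m\<^sub>0 - j"
        using x fJ by (auto simp: j_def card_gt_0_iff Suc_le_eq)
          (metis One_nat_def Suc_pred card_gt_0_iff diff_diff_left empty_iff plus_1_eq_Suc)
      finally show ?thesis by (simp add: a_def)
    qed
    have not_J: "g x \<le> b" if x: "x \<in> C" "x \<notin> J" "m\<^sub>0 = 0 \<or> x \<notin> F" for x
    proof -
      \<comment> \<open>With \<open>m\<^sub>0 = 0\<close> nothing is to be avoided and
        \<open>x\<close> may belong to \<open>F\<close>; the empty set keeps the induction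
        hypothesis applicable to \<open>C - {x}\<close>.\<close>
      define F' where "F' = (if m\<^sub>0 = 0 then {} else F)"
      have "{ys. x # ys \<in> ?ev J F m\<^sub>0 m\<^sub>1} \<subseteq> ?ev J F' (m\<^sub>0 - 1) (m\<^sub>1 - 1)"
        using x by (cases m\<^sub>0) (auto simp: take_Cons1 F'_def)
      then have "g x \<le> measure_pmf.prob (uniform_perm (C - {x})) (?ev J F' (m\<^sub>0 - 1) (m\<^sub>1 - 1))"
        unfolding g_def by (intro measure_pmf.finite_measure_mono) auto
      also have "\<dots> \<le> q ^ card J * \<theta> ^ (m\<^sub>0 - 1 - card J)"
        by (rule IH) (use x Suc.prems in \<open>auto simp: f_def F'_def\<close>)
      finally show ?thesis by (simp add: b_def j_def)
    qed
    have in_F: "g x = 0" if x: "x \<in> F" "m\<^sub>0 \<noteq> 0" for x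
    proof -
      have "{ys. x # ys \<in> ?ev J F m\<^sub>0 m\<^sub>1} = {}" using x by (cases m\<^sub>0) auto
      then show ?thesis unfolding g_def by (simp only: measure_empty)
    qed
    have jN: "j \<le> card C" using JF by (simp add: j_def)
    have sumC: "(\<Sum>x\<in>C. g x) \<le> j * a + (if m\<^sub>0 = 0 then ?N - j else ?N - j - f) * b"
    proof -
      have "(\<Sum>x\<in>C. g x) = (\<Sum>x\<in>J. g x) + (\<Sum>x\<in>C - J. g x)"
        using Suc.prems fin by (metis add.commute sum.subset_diff)
      moreover have "(\<Sum>x\<in>J. g x) \<le> j * a"
        unfolding j_def using in_J by (rule sum_bounded_above)
      moreover have "(\<Sum>x\<in>C - J. g x) \<le> (if m\<^sub>0 = 0 then ?N - j else ?N - j - f) * b"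
      proof (cases "m\<^sub>0 = 0")
        case True
        have "(\<Sum>x\<in>C - J. g x) \<le> card (C - J) * b"
          using not_J True by (intro sum_bounded_above) auto
        also have "real (card (C - J)) = ?N - j"
          using Suc.prems fJ jN by (simp add: card_Diff_subset j_def of_nat_diff)
        finally show ?thesis using True by simp
      next
        case False
        have "(\<Sum>x\<in>C - J. g x) = (\<Sum>x\<in>C - J - F. g x) + (\<Sum>x\<in>F. g x)"
          using Suc.prems fin by (intro sum.subset_diff) auto
        also have "(\<Sum>x\<in>F. g x) = 0" using in_F False by simp
        also have "(\<Sum>x\<in>C - J - F. g x) \<le> card (C - J - F) * b"
          using not_J by (intro sum_bounded_above) auto
        also have "real (card (C - J - F)) = ?N - j - f"
        proof -
          have "card (C - J - F) = card (C - (J \<union> F))" by (simp add: Diff_Diff_Int set_diff_eq conj_assoc Collect_conj_eq Int_assoc)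
          also have "\<dots> = card C - card (J \<union> F)"
            using Suc.prems fJ by (intro card_Diff_subset) auto
          also have "card (J \<union> F) = j + f"
            using Suc.prems fJ by (simp add: card_Un_disjoint j_def f_def)
          finally show ?thesis using JF by (simp add: j_def f_def of_nat_diff)
        qed
        finally show ?thesis using False by simp
      qed
      ultimately show ?thesis by linarith
    qed
    also have "\<dots> \<le> (j * q ^ (j - 1) + (?N - j) * q ^ j) * \<theta> ^ (m\<^sub>0 - j)"
    proof -
      \<comment> \<open>Forbidding \<open>F\<close> at the first position gains a factor \<theta>,
        because \<open>?N - j - f\<close> is at most \<open>(?N - j) * (1 - f / ?N)\<close>. For
        \<open>m\<^sub>0 \<le> j\<close> both exponents are truncated to 0 and no gain is
        claimed.\<close>
      have "(if m\<^sub>0 = 0 then ?N - j else ?N - j - f) * \<theta> ^ (m\<^sub>0 - 1 - j) \<le> (?N - j) * \<theta> ^ (m\<^sub>0 - j)"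
      proof (cases "m\<^sub>0 \<le> j")
        case True
        then show ?thesis using jN by simp
      next
        case False
        have "?N - j - f \<le> (?N - j) * \<theta>"
        proof -
          have "(?N - j) * \<theta> = ?N - j - f + j * f / ?N"
            using N by (simp add: \<theta>_def field_simps)
          then show ?thesis by simp
        qed
        then have "(?N - j - f) * \<theta> ^ (m\<^sub>0 - 1 - j) \<le> (?N - j) * \<theta> * \<theta> ^ (m\<^sub>0 - 1 - j)"
          using \<theta>0 by (intro mult_right_mono) auto
        also have "\<dots> = (?N - j) * \<theta> ^ Suc (m\<^sub>0 - 1 - j)" by simp
        also have "Suc (m\<^sub>0 - 1 - j) = m\<^sub>0 - j" using False by simp
        finally show ?thesis using False by simp
      qed
      then have "(if m\<^sub>0 = 0 then ?N - j else ?N - j - f) * \<theta> ^ (m\<^sub>0 - 1 - j) * q ^ j \<le> (?N - j) * \<theta> ^ (m\<^sub>0 - j) * q ^ j"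
        using q0 by (intro mult_right_mono) auto
      then show ?thesis by (simp add: a_def b_def algebra_simps)
    qed
    also have "\<dots> \<le> (?N * (real m\<^sub>1 / ?N) ^ j) * \<theta> ^ (m\<^sub>0 - j)"
      unfolding q_def using \<theta>0 N(1) m1 jN by (intro mult_right_mono perm_weight_step) auto
    finally have "(\<Sum>x\<in>C. g x) / ?N \<le> (?N * (real m\<^sub>1 / ?N) ^ j) * \<theta> ^ (m\<^sub>0 - j) / ?N"
      by (rule divide_right_mono) simp
    then show ?thesis
      unfolding prob_uniform_perm_step[OF fin ne] g_def[symmetric] using N
      by (simp add: \<theta>_def j_def f_def)
  qed
qed

text \<open>An exact value, because the second moment method needs a lower bound for one vertex and
  a comparison of the probability for two vertices with the square of that value.\<close>

lemma prob_avoid_eq: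
  assumes "finite C" "F \<subseteq> C" "m \<le> card C"
  shows "measure_pmf.prob (uniform_perm C) {xs. set (take m xs) \<inter> F = {}}
    = (\<Prod>i<m. 1 - real (card F) / (real (card C) - real i))"
  using assms
proof (induction m arbitrary: C)
  case (Suc m)
  let ?N = "real (card C)"
  have ne: "C \<noteq> {}" and fF: "finite F" using Suc.prems finite_subset by auto
  have "measure_pmf.prob (uniform_perm (C - {x})) {ys. x # ys \<in> {xs. set (take (Suc m) xs) \<inter> F = {}}}
      = (if x \<in> F then 0 else (\<Prod>i<m. 1 - real (card F) / (?N - 1 - real i)))" if x: "x \<in> C" for x
  proof (cases "x \<in> F")
    case True
    then have "{ys. x # ys \<in> {xs. set (take (Suc m) xs) \<inter> F = {}}} = {}" by auto
    then show ?thesis using True by simp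
  next
    case False
    then have "{ys. x # ys \<in> {xs. set (take (Suc m) xs) \<inter> F = {}}} = {ys. set (take m ys) \<inter> F = {}}" by auto
    moreover have "measure_pmf.prob (uniform_perm (C - {x})) {ys. set (take m ys) \<inter> F = {}}
        = (\<Prod>i<m. 1 - real (card F) / (real (card (C - {x})) - real i))"
      by (rule Suc.IH) (use Suc.prems x False in \<open>auto simp: le_diff_conv2 card_gt_0_iff Suc_le_eq\<close>)
    moreover have "real (card (C - {x})) = ?N - 1"
      using Suc.prems x by (simp add: of_nat_diff Suc_le_eq card_gt_0_iff ne)
    ultimately show ?thesis using False by simp
  qed
  then have "measure_pmf.prob (uniform_perm C) {xs. set (take (Suc m) xs) \<inter> F = {}}
      = (\<Sum>x\<in>C. if x \<in> F then 0 else (\<Prod>i<m. 1 - real (card F) / (?N - 1 - real i))) / ?N"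
    unfolding prob_uniform_perm_step[OF Suc.prems(1) ne] by simp
  also have "(\<Sum>x\<in>C. if x \<in> F then 0 else (\<Prod>i<m. 1 - real (card F) / (?N - 1 - real i)))
      = real (card (C - F)) * (\<Prod>i<m. 1 - real (card F) / (?N - 1 - real i))"
    using Suc.prems by (simp add: sum.If_cases Int_def set_diff_eq conj_commute)
  also have "real (card (C - F)) = ?N - card F"
    using Suc.prems fF by (simp add: card_Diff_subset of_nat_diff card_mono)
  also have "(?N - card F) * (\<Prod>i<m. 1 - real (card F) / (?N - 1 - real i)) / ?N
      = (\<Prod>i<Suc m. 1 - real (card F) / (?N - real i))"
  proof -
    have "?N \<noteq> 0" using ne Suc.prems by simp
    then show ?thesis
      unfolding prod.lessThan_Suc_shift by (simp add: o_def diff_divide_distrib algebra_simps)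
  qed
  finally show ?case .
qed simp

lemma prob_UN_le:
  assumes "finite I"
  shows "measure_pmf.prob p (\<Union>i\<in>I. X i) \<le> (\<Sum>i\<in>I. measure_pmf.prob p (X i))"
  using assms by (intro measure_pmf.finite_measure_subadditive_finite) auto

text \<open>Union bound over the subsets of \<open>F\<close> with \<open>r\<close> elements, each
  contained with probability at most \<open>(t / card C) ^ r\<close>.\<close>

lemma prob_contain_many_le:
  assumes "finite C" "F \<subseteq> C" "t \<le> card C"
  shows "measure_pmf.prob (uniform_perm C) {xs. r \<le> card (set (take t xs) \<inter> F)}
    \<le> real (card F choose r) * (real t / card C) ^ r"
proof -
  have fF: "finite F" using assms finite_subset by blast
  let ?S = "{J. J \<subseteq> F \<and> card J = r}"
  have finS: "finite ?S" using fF by simp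
  have "{xs. r \<le> card (set (take t xs) \<inter> F)} \<subseteq> (\<Union>J\<in>?S. {xs. J \<subseteq> set (take t xs)})"
  proof
    fix xs assume "xs \<in> {xs. r \<le> card (set (take t xs) \<inter> F)}"
    then have "r \<le> card (set (take t xs) \<inter> F)" by simp
    then obtain J where "J \<subseteq> set (take t xs) \<inter> F" "card J = r"
      by (rule obtain_subset_with_card_n)
    then show "xs \<in> (\<Union>J\<in>?S. {xs. J \<subseteq> set (take t xs)})" by (intro UN_I[of J]) simp_all
  qed
  then have "measure_pmf.prob (uniform_perm C) {xs. r \<le> card (set (take t xs) \<inter> F)}
      \<le> measure_pmf.prob (uniform_perm C) (\<Union>J\<in>?S. {xs. J \<subseteq> set (take t xs)})"
    by (intro measure_pmf.finite_measure_mono) auto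
  also have "\<dots> \<le> (\<Sum>J\<in>?S. measure_pmf.prob (uniform_perm C) {xs. J \<subseteq> set (take t xs)})"
    by (rule prob_UN_le[OF finS])
  also have "\<dots> \<le> (\<Sum>J\<in>?S. (real t / card C) ^ r)"
  proof (rule sum_mono)
    fix J assume "J \<in> ?S"
    then show "measure_pmf.prob (uniform_perm C) {xs. J \<subseteq> set (take t xs)} \<le> (real t / card C) ^ r"
      using prob_contain_avoid_le[of C J "{}" 0 t] assms by auto
  qed
  also have "\<dots> = real (card F choose r) * (real t / card C) ^ r"
    using n_subsets[OF fF, of r] by simp
  finally show ?thesis .
qed

text \<open>Union bound over the exact trace \<open>I\<close> of the first \<open>m\<^sub>0\<close>
  elements on \<open>F\<close>: then \<open>I \<union> J\<close> is contained among the first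
  \<open>m\<^sub>1\<close> elements and \<open>F - I\<close> is avoided by the first
  \<open>m\<^sub>0\<close>. The three factors come from containing \<open>J\<close>, from the
  choices of \<open>I\<close>, and from avoiding at least \<open>card F - D\<close>
  elements.\<close>

lemma prob_contain_few_le:
  assumes C: "finite C" "J \<subseteq> C" "F \<subseteq> C" "J \<inter> F = {}" "m\<^sub>0 \<le> m\<^sub>1" "m\<^sub>1 \<le> card C" "C \<noteq> {}"
    and D: "D \<le> card F" "D + card J \<le> m\<^sub>0"
  shows "measure_pmf.prob (uniform_perm C)
      {xs. J \<subseteq> set (take m\<^sub>1 xs) \<and> card (set (take m\<^sub>0 xs) \<inter> F) \<le> D}
    \<le> (real m\<^sub>1 / card C) ^ card J * (real (D + 1) * (1 + real (card F) * (real m\<^sub>1 / card C)) ^ D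
        * exp (- ((real (card F) - D) / card C * (real m\<^sub>0 - D - card J))))"
proof -
  let ?N = "real (card C)"
  let ?P = "measure_pmf.prob (uniform_perm C)"
  define q where "q = real m\<^sub>1 / ?N"
  define f where "f = card F"
  define j where "j = card J"
  define \<epsilon> where "\<epsilon> = exp (- ((real f - D) / ?N * (real m\<^sub>0 - D - j)))"
  have N: "?N > 0" using C by (simp add: card_gt_0_iff)
  have q0: "q \<ge> 0" by (simp add: q_def)
  have fF: "finite F" "finite J" using finite_subset[OF C(3,1)] finite_subset[OF C(2,1)] by auto
  let ?S = "\<lambda>i. {I. I \<subseteq> F \<and> card I = i}"
  let ?I = "SIGMA i:{..D}. ?S i"
  have finI: "finite ?I" using fF by auto
  let ?ev = "\<lambda>I. {xs. I \<union> J \<subseteq> set (take m\<^sub>1 xs) \<and> set (take m\<^sub>0 xs) \<inter> (F - I) = {}}"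
  have "{xs. J \<subseteq> set (take m\<^sub>1 xs) \<and> card (set (take m\<^sub>0 xs) \<inter> F) \<le> D} \<subseteq> (\<Union>p\<in>?I. ?ev (snd p))"
  proof
    fix xs assume xs: "xs \<in> {xs. J \<subseteq> set (take m\<^sub>1 xs) \<and> card (set (take m\<^sub>0 xs) \<inter> F) \<le> D}"
    let ?X = "set (take m\<^sub>0 xs) \<inter> F"
    have "set (take m\<^sub>0 xs) \<subseteq> set (take m\<^sub>1 xs)" using C(5) by (rule set_take_subset_set_take)
    then have "xs \<in> ?ev ?X" using xs by auto
    then have "xs \<in> ?ev (snd (card ?X, ?X))" by simp
    moreover have "(card ?X, ?X) \<in> ?I" using xs by simp
    ultimately show "xs \<in> (\<Union>p\<in>?I. ?ev (snd p))" by (rule UN_I[rotated])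
  qed
  then have "?P {xs. J \<subseteq> set (take m\<^sub>1 xs) \<and> card (set (take m\<^sub>0 xs) \<inter> F) \<le> D} \<le> ?P (\<Union>p\<in>?I. ?ev (snd p))"
    by (intro measure_pmf.finite_measure_mono) auto
  also have "\<dots> \<le> (\<Sum>p\<in>?I. ?P (?ev (snd p)))" by (rule prob_UN_le[OF finI])
  also have "\<dots> \<le> (\<Sum>p\<in>?I. q ^ (fst p + j) * \<epsilon>)"
  proof (rule sum_mono)
    fix p assume "p \<in> ?I"
    then obtain i I where p: "p = (i, I)" "i \<le> D" "I \<subseteq> F" "card I = i" by auto
    have fI: "finite I" using p fF finite_subset by blast
    have IJ: "card (I \<union> J) = i + j"
      using p C fI fF by (subst card_Un_disjoint) (auto simp: j_def)
    have FI: "card (F - I) = f - i" using p fI by (simp add: card_Diff_subset f_def)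
    have "?P (?ev I) \<le> (real m\<^sub>1 / ?N) ^ card (I \<union> J) * (1 - real (card (F - I)) / ?N) ^ (m\<^sub>0 - card (I \<union> J))"
      by (rule prob_contain_avoid_le) (use C p in auto)
    also have "\<dots> = q ^ (i + j) * (1 - real (f - i) / ?N) ^ (m\<^sub>0 - (i + j))"
      unfolding IJ FI q_def ..
    also have "\<dots> \<le> q ^ (i + j) * \<epsilon>"
    proof (rule mult_left_mono)
      define z where "z = real (f - i) / ?N"
      have "f \<le> card C" unfolding f_def using C by (intro card_mono) auto
      then have z1: "z \<le> 1" using N by (simp add: z_def divide_le_eq_1)
      have iF: "i \<le> f" using p D by (simp add: f_def)
      have zD: "(real f - D) / ?N \<le> z"
        unfolding z_def using p N iF by (intro divide_right_mono) auto
      have z0: "0 \<le> (real f - D) / ?N" using D N by (simp add: f_def)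
      have "(1 - z) ^ (m\<^sub>0 - (i + j)) \<le> exp (- z) ^ (m\<^sub>0 - (i + j))"
        using z1 exp_ge_add_one_self[of "- z"] by (intro power_mono) auto
      also have "\<dots> = exp (- (z * real (m\<^sub>0 - (i + j))))"
        by (simp add: exp_of_nat_mult[symmetric] mult.commute)
      also have "\<dots> \<le> \<epsilon>"
      proof -
        have "real m\<^sub>0 - D - j \<le> real (m\<^sub>0 - (i + j))" using p(2) D by (simp add: j_def of_nat_diff)
        moreover have "0 \<le> real m\<^sub>0 - D - j" using D(2) unfolding j_def by linarith
        ultimately have "(real f - D) / ?N * (real m\<^sub>0 - D - j) \<le> z * real (m\<^sub>0 - (i + j))"
          using zD z0 by (intro mult_mono) auto
        then show ?thesis by (simp add: \<epsilon>_def)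
      qed
      finally show "(1 - real (f - i) / ?N) ^ (m\<^sub>0 - (i + j)) \<le> \<epsilon>" by (simp add: z_def)
    qed (use q0 in simp)
    finally show "?P (?ev (snd p)) \<le> q ^ (fst p + j) * \<epsilon>" using p by simp
  qed
  also have "\<dots> = (\<Sum>i\<le>D. \<Sum>I\<in>?S i. q ^ (i + j) * \<epsilon>)"
    using fF by (subst sum.Sigma) (auto simp: case_prod_unfold)
  also have "\<dots> = (\<Sum>i\<le>D. real (f choose i) * q ^ i) * (q ^ j * \<epsilon>)"
    using n_subsets[OF fF(1)] by (simp add: sum_distrib_left sum_distrib_right f_def power_add mult_ac)
  \<comment> \<open>A crude bound, uniform in \<open>i\<close>: the binomial coefficient is at most
    \<open>f ^ i\<close>. In the application \<open>f * q\<close> is of logarithmic size, so only a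
    power of the logarithm is lost.\<close>
  also have "(\<Sum>i\<le>D. real (f choose i) * q ^ i) \<le> (\<Sum>i\<le>D. (1 + f * q) ^ D)"
  proof (rule sum_mono)
    fix i assume "i \<in> {..D}"
    have "real (f choose i) * 1 \<le> real (f choose i) * fact i" by (intro mult_left_mono) (auto simp: fact_ge_1)
    also have "\<dots> = real ((f choose i) * fact i)" by simp
    also have "\<dots> \<le> real (f ^ i)" using binomial_fact_pow[of f i] by (intro of_nat_mono)
    finally have "real (f choose i) * q ^ i \<le> real f ^ i * q ^ i" using q0 by (intro mult_right_mono) auto
    also have "\<dots> = (f * q) ^ i" by (simp add: power_mult_distrib)
    also have "\<dots> \<le> (1 + f * q) ^ i" using q0 by (intro power_mono) auto
    also have "\<dots> \<le> (1 + f * q) ^ D" using q0 \<open>i \<in> {..D}\<close> by (intro power_increasing) auto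
    finally show "real (f choose i) * q ^ i \<le> (1 + f * q) ^ D" .
  qed
  also have "\<dots> = real (D + 1) * (1 + f * q) ^ D" by simp
  finally show ?thesis
    using q0 by (simp add: \<epsilon>_def f_def j_def q_def mult_ac mult_right_mono)
qed

lemma power_le_fact_exp:
  fixes x :: real
  assumes "x \<ge> 0"
  shows "x ^ n \<le> fact n * exp x"
proof -
  have "(\<Sum>i\<in>{n}. x ^ i /\<^sub>R fact i) \<le> (\<Sum>i. x ^ i /\<^sub>R fact i)"
    using assms summable_exp_generic[of x] by (intro sum_le_suminf) auto
  then show ?thesis by (simp add: exp_def field_simps)
qed

text \<open>Since \<open>r ^ r / fact r\<close> is a single term of the series for
  \<open>exp r\<close>, the bound \<open>n ^ r / fact r\<close> is at most
  \<open>(exp 1 * n / r) ^ r\<close>.\<close>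

lemma choose_le_exp:
  assumes "r > 0"
  shows "real (n choose r) \<le> (exp 1 * n / r) ^ r"
proof -
  have "real r ^ r \<le> fact r * exp 1 ^ r"
    using power_le_fact_exp[of "real r" r] by (simp add: exp_of_nat_mult[symmetric])
  moreover have "real (n choose r) * fact r \<le> real n ^ r"
    using binomial_fact_pow[of n r] by (metis of_nat_fact of_nat_le_iff of_nat_mult of_nat_power)
  ultimately have "real (n choose r) * fact r * real r ^ r \<le> real n ^ r * (fact r * exp 1 ^ r)"
    by (intro mult_mono) auto
  then have "real (n choose r) * real r ^ r \<le> real n ^ r * exp 1 ^ r"
    using fact_gt_zero[of r, where ?'a = real] by (simp add: mult_ac)
  then show ?thesis using assms by (simp add: power_divide power_mult_distrib field_simps)
qed

text \<open>The end vertex is part of the data, since one list of copies may lead to many vertices;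
  counting these pairs absorbs the sum over the second endpoint.\<close>

definition paths :: "'v ugraph set \<Rightarrow> 'v \<Rightarrow> nat \<Rightarrow> ('v ugraph list \<times> 'v) set" where
  "paths C u j = {(Ks, v). length Ks = j \<and> set Ks \<subseteq> C \<and> chain Ks u v}"

text \<open>Each step chooses a copy through the current vertex, in at most \<open>a\<close> ways,
  and then the vertex at which the copy is left, in at most \<open>d\<close> ways.\<close>

lemma card_paths_le:
  assumes "finite C" "\<And>K. K \<in> C \<Longrightarrow> finite (verts K) \<and> card (verts K) \<le> d \<and> verts K \<subseteq> V"
    and "\<And>v. v \<in> V \<Longrightarrow> card {K \<in> C. v \<in> verts K} \<le> a" "u \<in> V"
  shows "finite (paths C u j) \<and> card (paths C u j) \<le> (a * d) ^ j"
  using assms(4)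
proof (induction j arbitrary: u)
  case 0
  have "paths C u 0 = {([], u)}" by (auto simp: paths_def)
  then show ?case by simp
next
  case (Suc j)
  let ?K = "{K \<in> C. u \<in> verts K}"
  let ?f = "\<lambda>K x. (\<lambda>(Ks, v). (K # Ks, v)) ` paths C x j"
  have eq: "paths C u (Suc j) = (\<Union>K\<in>?K. \<Union>x\<in>verts K. ?f K x)"
  proof (intro set_eqI iffI)
    fix p assume "p \<in> paths C u (Suc j)"
    then obtain Ks' v where "p = (Ks', v)" "length Ks' = Suc j" "set Ks' \<subseteq> C" "chain Ks' u v"
      unfolding paths_def by auto
    moreover from this(2) obtain K Ks where "Ks' = K # Ks" "length Ks = j" by (auto simp: length_Suc_conv)
    ultimately have p: "p = (K # Ks, v)" "length Ks = j" "K \<in> C" "set Ks \<subseteq> C" "chain (K # Ks) u v"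
      by simp_all
    then obtain x where x: "u \<in> verts K" "x \<in> verts K" "chain Ks x v" by auto
    then have "(Ks, v) \<in> paths C x j" using p by (simp add: paths_def)
    then have "p \<in> ?f K x" unfolding p(1) by (rule rev_image_eqI) simp
    moreover have "K \<in> ?K" using p x by simp
    ultimately show "p \<in> (\<Union>K\<in>?K. \<Union>x\<in>verts K. ?f K x)" using x(2) by (intro UN_I)
  qed (auto simp: paths_def)
  have IH: "finite (paths C x j)" "card (paths C x j) \<le> (a * d) ^ j" if "K \<in> C" "x \<in> verts K" for K x
    using Suc.IH[of x] assms(2)[OF that(1)] that(2) by auto
  have finK: "finite ?K" using assms(1) by simp
  have inner: "card (\<Union>x\<in>verts K. ?f K x) \<le> d * (a * d) ^ j" if K: "K \<in> ?K" for K
  proof -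
    have K': "finite (verts K)" "card (verts K) \<le> d" "K \<in> C"
      using assms(2)[of K] K by simp_all
    have "card (\<Union>x\<in>verts K. ?f K x) \<le> (\<Sum>x\<in>verts K. card (?f K x))"
      by (rule card_UN_le[OF K'(1)])
    also have "\<dots> \<le> (\<Sum>x\<in>verts K. (a * d) ^ j)"
    proof (rule sum_mono)
      fix x assume "x \<in> verts K"
      note ih = IH[OF K'(3) this]
      show "card (?f K x) \<le> (a * d) ^ j"
        using card_image_le[OF ih(1), of "\<lambda>(Ks, v). (K # Ks, v)"] ih(2) by linarith
    qed
    also have "\<dots> = card (verts K) * (a * d) ^ j" by simp
    also have "\<dots> \<le> d * (a * d) ^ j" using K'(2) by (rule mult_right_mono) simp
    finally show ?thesis .
  qed
  have "card (paths C u (Suc j)) \<le> (\<Sum>K\<in>?K. card (\<Union>x\<in>verts K. ?f K x))"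
    unfolding eq by (rule card_UN_le[OF finK])
  also have "\<dots> \<le> (\<Sum>K\<in>?K. d * (a * d) ^ j)" using inner by (rule sum_mono)
  also have "\<dots> = card ?K * (d * (a * d) ^ j)" by simp
  also have "\<dots> \<le> a * (d * (a * d) ^ j)" using assms(3)[OF Suc.prems] by (rule mult_right_mono) simp
  finally have "card (paths C u (Suc j)) \<le> (a * d) ^ Suc j" by (simp add: mult_ac)
  moreover have "finite (paths C u (Suc j))"
    unfolding eq
  proof (intro finite_UN_I finK finite_imageI)
    fix K assume "K \<in> ?K"
    then have K: "K \<in> C" by simp
    show "finite (verts K)" using assms(2)[OF K] by simp
    show "finite (paths C x j)" if "x \<in> verts K" for x using IH[OF K that] by simp
  qed
  ultimately show ?case by simp
qed

lemma sum_Pow_power: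
  fixes x :: real
  assumes "finite V"
  shows "(\<Sum>A\<in>Pow V. x ^ card A) = (1 + x) ^ card V"
proof -
  have "(1 + x) ^ card V = (\<Prod>i\<in>V. x + 1)" by (simp add: add.commute)
  also have "\<dots> = (\<Sum>A\<in>Pow V. (\<Prod>i\<in>A. x) * (\<Prod>i\<in>V - A. 1))" by (rule prod_add[OF assms])
  finally show ?thesis by simp
qed

section \<open>The second moment method\<close>

lemma prob_mono_on_support:
  assumes "\<And>x. x \<in> set_pmf p \<Longrightarrow> x \<in> A \<Longrightarrow> x \<in> B"
  shows "measure_pmf.prob p A \<le> measure_pmf.prob p B"
proof -
  have "measure_pmf.prob p A = measure_pmf.prob p (A \<inter> set_pmf p)"
    by (simp add: measure_Int_set_pmf)
  also have "\<dots> \<le> measure_pmf.prob p B"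
    using assms by (intro measure_pmf.finite_measure_mono) auto
  finally show ?thesis .
qed

lemma geometric_sum_le:
  fixes y :: real
  assumes "0 \<le> y" "y \<le> 1 / 2"
  shows "(\<Sum>i\<in>{1..n}. y ^ i) \<le> 2 * y"
proof -
  \<comment> \<open>The subtracted tail makes the induction close for every \<open>y\<close> up to
    1/2.\<close>
  have "(\<Sum>i\<in>{1..n}. y ^ i) \<le> 2 * y - 2 * y ^ (n + 1)"
  proof (induction n)
    case (Suc n)
    have "2 * (y ^ (n + 1) * y) \<le> y ^ (n + 1)"
      using assms mult_left_mono[of y "1/2" "y ^ (n + 1)"] by simp
    then show ?case using Suc by (simp add: mult_ac)
  qed simp
  moreover have "0 \<le> y ^ (n + 1)" using assms by simp
  ultimately show ?thesis by linarith
qed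

text \<open>Chebyshev's inequality: where the counting variable \<open>X\<close> vanishes,
  \<open>\<mu>\<^sup>2\<close> equals \<open>(X - \<mu>)\<^sup>2\<close>, so the left-hand side is
  at most the variance. The product form avoids dividing by \<mu>.\<close>

lemma second_moment_bound:
  fixes I :: "'i \<Rightarrow> 'b set"
  assumes "finite V" "finite (set_pmf p)"
  defines "\<mu> \<equiv> (\<Sum>v\<in>V. measure_pmf.prob p (I v))"
  shows "measure_pmf.prob p {x. \<forall>v\<in>V. x \<notin> I v} * \<mu>\<^sup>2
    \<le> (\<Sum>u\<in>V. \<Sum>v\<in>V. measure_pmf.prob p (I u \<inter> I v)) - \<mu>\<^sup>2"
proof -
  define X :: "'b \<Rightarrow> real" where "X = (\<lambda>x. \<Sum>v\<in>V. indicator (I v) x)"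
  let ?E = "measure_pmf.expectation p"
  have int: "integrable (measure_pmf p) f" for f :: "'b \<Rightarrow> real"
    using assms(2) by (rule integrable_measure_pmf_finite)
  have EX: "?E X = \<mu>"
    unfolding X_def \<mu>_def by (subst Bochner_Integration.integral_sum) (auto intro: int)
  have "X x * X x = (\<Sum>u\<in>V. \<Sum>v\<in>V. indicator (I u \<inter> I v) x)" for x
    unfolding X_def sum_product by (simp add: indicator_inter_arith)
  then have EX2: "?E (\<lambda>x. X x * X x) = (\<Sum>u\<in>V. \<Sum>v\<in>V. measure_pmf.prob p (I u \<inter> I v))"
    by (simp add: Bochner_Integration.integral_sum int)
  let ?Z = "{x. \<forall>v\<in>V. x \<notin> I v}"
  have "measure_pmf.prob p ?Z * \<mu>\<^sup>2 = ?E (\<lambda>x. indicator ?Z x * \<mu>\<^sup>2)" by simp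
  also have "\<dots> \<le> ?E (\<lambda>x. X x * X x - 2 * \<mu> * X x + \<mu>\<^sup>2)"
  proof (rule integral_mono[OF int int])
    fix x
    have "X x * X x - 2 * \<mu> * X x + \<mu>\<^sup>2 = (X x - \<mu>)\<^sup>2" by (simp add: power2_eq_square algebra_simps)
    moreover have "X x = 0" if "x \<in> ?Z" using that by (simp add: X_def)
    ultimately show "indicator ?Z x * \<mu>\<^sup>2 \<le> X x * X x - 2 * \<mu> * X x + \<mu>\<^sup>2"
      by (cases "x \<in> ?Z") auto
  qed
  also have "\<dots> = ?E (\<lambda>x. X x * X x) - 2 * \<mu> * ?E X + \<mu>\<^sup>2"
    by (simp add: Bochner_Integration.integral_add Bochner_Integration.integral_diff int)
  finally show ?thesis unfolding EX EX2 by (simp add: power2_eq_square)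
qed

text \<open>Second moment for the number of sets \<open>F v\<close> that are missed. The term
  \<open>1 / (card V * q)\<close> comes from the diagonal; the exponential term measures how far two
  misses are from independent, which is governed by the overlap \<open>c\<close>.\<close>

lemma prob_all_hit_le:
  fixes F :: "'i \<Rightarrow> 'c set"
  assumes fin: "finite C" "finite V" and F: "\<And>v. v \<in> V \<Longrightarrow> F v \<subseteq> C \<and> card (F v) = a"
    and int: "\<And>u v. u \<in> V \<Longrightarrow> v \<in> V \<Longrightarrow> u \<noteq> v \<Longrightarrow> real (card (F u \<inter> F v)) \<le> c"
    and c: "0 \<le> c" and t: "2 * t \<le> card C" and a: "4 * a \<le> card C" and ne: "V \<noteq> {}" "C \<noteq> {}"
  defines "q \<equiv> (\<Prod>i<t. 1 - real a / (real (card C) - real i))"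
  shows "measure_pmf.prob (uniform_perm C) {xs. \<forall>v\<in>V. set (take t xs) \<inter> F v \<noteq> {}}
    \<le> 1 / (real (card V) * q) + (exp (8 * c * t / card C) - 1)"
proof -
  let ?N = "real (card C)" and ?n = "real (card V)"
  let ?P = "measure_pmf.prob (uniform_perm C)"
  let ?I = "\<lambda>v. {xs. set (take t xs) \<inter> F v = {}}"
  have N: "?N > 0" using ne fin by (simp add: card_gt_0_iff)
  have n: "?n > 0" using ne fin by (simp add: card_gt_0_iff)
  have tN: "t \<le> card C" using t by simp
  have M: "?N / 2 \<le> ?N - real i" "0 < ?N - real i" "2 * real a \<le> ?N - real i" if "i < t" for i
    using that t a N by linarith+
  have q: "q > 0"
    unfolding q_def using M N by (intro prod_pos) (fastforce simp: divide_less_eq)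
  have single: "?P (?I v) = q" if "v \<in> V" for v
    using prob_avoid_eq[of C "F v" t] F[OF that] fin tN by (simp add: q_def)
  have pair: "?P (?I u \<inter> ?I v) \<le> q\<^sup>2 * exp (8 * c * t / ?N)" if uv: "u \<in> V" "v \<in> V" "u \<noteq> v" for u v
  proof -
    define b where "b = card (F u \<union> F v)"
    have fF: "finite (F u)" "finite (F v)" using F uv fin finite_subset by metis+
    have "card (F u) + card (F v) = b + card (F u \<inter> F v)"
      unfolding b_def using fF by (rule card_Un_Int)
    then have b: "2 * real a - c \<le> real b" "real b \<le> 2 * real a"
      using int[OF uv] F uv by auto
    have "?I u \<inter> ?I v = {xs. set (take t xs) \<inter> (F u \<union> F v) = {}}" by auto
    then have "?P (?I u \<inter> ?I v) = (\<Prod>i<t. 1 - real b / (?N - real i))"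
      using prob_avoid_eq[of C "F u \<union> F v" t] F uv fin tN by (simp add: b_def)
    also have "\<dots> \<le> (\<Prod>i<t. (1 - real a / (?N - real i))\<^sup>2 * exp (8 * c / ?N))"
    proof (rule prod_mono)
      fix i assume i: "i \<in> {..<t}"
      define M' where "M' = ?N - real i"
      have M': "?N / 2 \<le> M'" "0 < M'" "2 * real a \<le> M'" using M i by (auto simp: M'_def)
      \<comment> \<open>As the factor \<open>1 - a / M'\<close> stays above 1/2, the additive error
        \<open>c / M'\<close> turns into a relative error \<open>4 * c / M'\<close>; together with
        \<open>M' \<ge> ?N / 2\<close> this explains the 8 in the exponent.\<close>
      have half: "1 / 2 \<le> 1 - real a / M'" using M' by (simp add: field_simps)
      then have "(1 / 2)\<^sup>2 \<le> (1 - real a / M')\<^sup>2" by (intro power_mono) auto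
      then have quarter: "1 \<le> 4 * (1 - real a / M')\<^sup>2" by (simp add: power_divide)
      have "1 - real b / M' \<le> 1 - (2 * real a - c) / M'"
        using b M' by (simp add: divide_right_mono)
      also have "\<dots> = 1 - 2 * (real a / M') + c / M'" by (simp add: diff_divide_distrib)
      also have "\<dots> \<le> (1 - real a / M')\<^sup>2 + c / M'" by (simp add: power2_eq_square algebra_simps)
      also have "\<dots> \<le> (1 - real a / M')\<^sup>2 + c / M' * (4 * (1 - real a / M')\<^sup>2)"
        using mult_left_mono[OF quarter, of "c / M'"] c M' by simp
      also have "(1 - real a / M')\<^sup>2 + c / M' * (4 * (1 - real a / M')\<^sup>2) = (1 - real a / M')\<^sup>2 * (1 + 4 * c / M')"
        by (simp add: algebra_simps)
      also have "\<dots> \<le> (1 - real a / M')\<^sup>2 * exp (8 * c / ?N)"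
      proof (rule mult_left_mono)
        have "4 * c / M' \<le> 4 * c / (?N / 2)" using M' c N by (intro divide_left_mono) auto
        then have "1 + 4 * c / M' \<le> 1 + 8 * c / ?N" by simp
        also have "\<dots> \<le> exp (8 * c / ?N)" by (rule exp_ge_add_one_self)
        finally show "1 + 4 * c / M' \<le> exp (8 * c / ?N)" .
      qed simp
      finally have "1 - real b / M' \<le> (1 - real a / M')\<^sup>2 * exp (8 * c / ?N)" .
      moreover have "0 \<le> 1 - real b / M'" using b M' by (simp add: field_simps)
      ultimately show "0 \<le> 1 - real b / (?N - real i) \<and>
          1 - real b / (?N - real i) \<le> (1 - real a / (?N - real i))\<^sup>2 * exp (8 * c / ?N)"
        by (simp add: M'_def)
    qed
    also have "\<dots> = q\<^sup>2 * exp (8 * c / ?N) ^ t"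
      by (simp add: q_def prod.distrib prod_power_distrib)
    also have "exp (8 * c / ?N) ^ t = exp (8 * c * t / ?N)"
      by (simp add: exp_of_nat_mult[symmetric] mult_ac)
    finally show ?thesis .
  qed
  have \<mu>: "(\<Sum>v\<in>V. ?P (?I v)) = ?n * q" using single by simp
  have supp: "finite (set_pmf (uniform_perm C))" using fin by (simp add: permutations_of_set_empty_iff)
  have "?P {xs. \<forall>v\<in>V. xs \<notin> ?I v} * (?n * q)\<^sup>2
      \<le> (\<Sum>u\<in>V. \<Sum>v\<in>V. ?P (?I u \<inter> ?I v)) - (?n * q)\<^sup>2"
    using second_moment_bound[OF fin(2) supp, of ?I] unfolding \<mu> .
  also have "(\<Sum>u\<in>V. \<Sum>v\<in>V. ?P (?I u \<inter> ?I v)) \<le> (\<Sum>u\<in>V. q + ?n * (q\<^sup>2 * exp (8 * c * t / ?N)))"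
  proof (rule sum_mono)
    fix u assume u: "u \<in> V"
    have "(\<Sum>v\<in>V. ?P (?I u \<inter> ?I v)) = ?P (?I u \<inter> ?I u) + (\<Sum>v\<in>V - {u}. ?P (?I u \<inter> ?I v))"
      using fin(2) u by (rule sum.remove)
    also have "\<dots> \<le> q + real (card (V - {u})) * (q\<^sup>2 * exp (8 * c * t / ?N))"
      using single[OF u] pair[OF u] by (intro add_mono sum_bounded_above) auto
    also have "\<dots> \<le> q + ?n * (q\<^sup>2 * exp (8 * c * t / ?N))"
      using fin(2) by (intro add_left_mono mult_right_mono) (auto simp: card_Diff1_le)
    finally show "(\<Sum>v\<in>V. ?P (?I u \<inter> ?I v)) \<le> q + ?n * (q\<^sup>2 * exp (8 * c * t / ?N))" .
  qed
  also have "\<dots> = ?n * q + (?n * q)\<^sup>2 * exp (8 * c * t / ?N)"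
    by (simp add: power2_eq_square algebra_simps)
  finally have "?P {xs. \<forall>v\<in>V. xs \<notin> ?I v} * (?n * q)\<^sup>2
      \<le> (?n * q)\<^sup>2 * (1 / (?n * q) + (exp (8 * c * t / ?N) - 1))"
    using n q by (simp add: power2_eq_square algebra_simps)
  then have "?P {xs. \<forall>v\<in>V. xs \<notin> ?I v} \<le> 1 / (?n * q) + (exp (8 * c * t / ?N) - 1)"
    using n q by (simp add: mult.commute[of _ "(?n * q)\<^sup>2"])
  then show ?thesis by simp
qed

text \<open>Every factor is at least \<open>1 - y\<close>, and
  \<open>1 / (1 - y) = 1 + y / (1 - y)\<close> is at most \<open>exp (y / (1 - y))\<close>.\<close>

lemma prod_one_minus_ge_exp:
  fixes N a y :: real
  assumes "real t < N" "0 \<le> a" "y < 1" "a \<le> y * (N - t)"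
  shows "exp (- (t * (y / (1 - y)))) \<le> (\<Prod>i<t. 1 - a / (N - real i))"
proof -
  have y0: "0 \<le> y" using assms by (metis diff_gt_0_iff_gt dual_order.trans zero_le_mult_iff not_less less_imp_le order.asym)
  have "exp (- (y / (1 - y))) \<le> 1 - y"
  proof -
    have "1 / (1 - y) = 1 + y / (1 - y)" using assms(3) by (simp add: field_simps)
    also have "\<dots> \<le> exp (y / (1 - y))" by (rule exp_ge_add_one_self)
    finally have "1 \<le> exp (y / (1 - y)) * (1 - y)" using assms(3) by (simp add: divide_le_eq)
    then have "exp (- (y / (1 - y))) * 1 \<le> exp (- (y / (1 - y))) * (exp (y / (1 - y)) * (1 - y))"
      by (intro mult_left_mono) auto
    also have "\<dots> = 1 - y" by (simp add: exp_minus field_simps)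
    finally show ?thesis by simp
  qed
  then have "exp (- (y / (1 - y))) ^ t \<le> (\<Prod>i<t. 1 - y)" by (simp add: power_mono)
  also have "\<dots> \<le> (\<Prod>i<t. 1 - a / (N - real i))"
  proof (rule prod_mono)
    fix i assume i: "i \<in> {..<t}"
    have "a \<le> y * (N - real i)"
      using assms(4) mult_left_mono[OF _ y0, of "N - t" "N - real i"] i by force
    moreover have "0 < N - real i" using i assms(1) by simp
    ultimately show "0 \<le> 1 - y \<and> 1 - y \<le> 1 - a / (N - real i)"
      using assms(3) by (simp add: divide_le_eq)
  qed
  finally show ?thesis by (simp add: exp_of_nat_mult[symmetric])
qed

section \<open>Counting the copies\<close>

text \<open>Used in two ways: an injection of the vertices of \<open>H\<close> into
  \<open>{1..n}\<close> produces a copy, and permutations of \<open>{1..n}\<close> act on the set of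
  copies.\<close>

definition relabel :: "('v \<Rightarrow> 'w) \<Rightarrow> 'v ugraph \<Rightarrow> 'w ugraph" where
  "relabel \<pi> K = (\<pi> ` verts K, (\<lambda>e. \<pi> ` e) ` edges K)"

lemma inj_relabel: "inj \<pi> \<Longrightarrow> inj (relabel \<pi>)"
  by (rule injI) (auto simp: relabel_def prod_eq_iff inj_image_eq_iff inj_on_image)

lemma finite_copies [simp]: "finite (copies H n)"
proof (rule finite_subset)
  show "copies H n \<subseteq> Pow {1..n} \<times> Pow (Pow {1..n})"
    by (auto simp: copies_def subgraph_def complete_graph_def nsets_def)
qed simp

locale motif =
  fixes H :: "'a ugraph"
  assumes simple: "simple_graph H"
    and nonempty: "verts H \<noteq> {}"
    and no_isolated: "no_isolated_vertices H"
begin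

definition k :: nat where "k = card (verts H)"

definition m :: nat where "m = card (edges H)"

lemma finite_H: "finite (verts H)" "finite (edges H)"
proof -
  show *: "finite (verts H)" using simple by (simp add: simple_graph_def)
  have "edges H \<subseteq> Pow (verts H)" using simple by (auto simp: simple_graph_def nsets_def)
  then show "finite (edges H)" using * by (meson finite_Pow_iff finite_subset)
qed

lemma k_ge_2: "2 \<le> k" and m_pos: "0 < m"
proof -
  obtain v where v: "v \<in> verts H" using nonempty by blast
  then obtain w where w: "w \<in> verts H" "w \<noteq> v" "{v, w} \<in> edges H"
    using ex_neighbour[OF simple no_isolated] by blast
  have "card {v, w} \<le> k" unfolding k_def using v w finite_H by (intro card_mono) auto
  then show "2 \<le> k" using w by simp
  show "0 < m" unfolding m_def using w finite_H by (auto simp: card_gt_0_iff)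
qed

lemma copy_props:
  assumes "K \<in> copies H n"
  shows copy_simple: "simple_graph K" and copy_verts: "verts K \<subseteq> {1..n}"
    and copy_no_isolated: "no_isolated_vertices K" and copy_card: "card (verts K) = k"
    and copy_card_edges: "card (edges K) = m"
proof -
  show s: "simple_graph K" and "verts K \<subseteq> {1..n}"
    using assms by (auto simp: copies_def subgraph_def complete_graph_def)
  obtain f where f: "bij_betw f (verts H) (verts K)" "edges K = (\<lambda>e. f ` e) ` edges H"
    using assms unfolding copies_def isomorphic_def by blast
  show "card (verts K) = k" unfolding k_def using bij_betw_same_card[OF f(1)] by simp
  have inj: "inj_on f (verts H)" using f by (simp add: bij_betw_def)
  have sub: "edges H \<subseteq> Pow (verts H)" using simple by (auto simp: simple_graph_def nsets_def)
  then have "inj_on (\<lambda>e. f ` e) (edges H)"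
    using inj by (meson inj_on_image_Pow inj_on_subset)
  then show "card (edges K) = m" unfolding m_def f(2) by (rule card_image)
  have finE: "finite (edges K)" using f(2) finite_H by simp
  show "no_isolated_vertices K"
    unfolding no_isolated_vertices_def
  proof
    fix x assume "x \<in> verts K"
    then obtain v where v: "v \<in> verts H" "x = f v" using f(1) by (auto simp: bij_betw_def)
    obtain w where "{v, w} \<in> edges H" using ex_neighbour[OF simple no_isolated v(1)] by blast
    then have "f ` {v, w} \<in> {e \<in> edges K. x \<in> e}" unfolding f(2) using v by blast
    then show "degree K x \<noteq> 0" unfolding degree_def using finE by (auto simp: card_eq_0_iff)
  qed
qed

lemma copies_nonempty:
  assumes "k \<le> n"
  shows "copies H n \<noteq> {}"
proof -
  obtain f where f: "inj_on f (verts H)" "f ` verts H \<subseteq> {1..n}"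
    using assms card_le_inj[OF finite_H(1), of "{1..n}"] by (auto simp: k_def)
  have sub: "edges H \<subseteq> nsets (verts H) 2" using simple by (simp add: simple_graph_def)
  have ns: "f ` e \<in> nsets (f ` verts H) 2" if "e \<in> edges H" for e
  proof -
    have "e \<subseteq> verts H" "finite e" "card e = 2" using sub that by (auto simp: nsets_def)
    then show ?thesis using f by (auto simp: nsets_def card_image inj_on_subset)
  qed
  have "relabel f H \<in> copies H n"
    unfolding copies_def subgraph_def isomorphic_def complete_graph_def
  proof (intro CollectI conjI)
    show "simple_graph (relabel f H)"
      using finite_H ns by (auto simp: simple_graph_def relabel_def)
    show "verts (relabel f H) \<subseteq> verts ({1..n}, nsets {1..n} 2)" using f by (simp add: relabel_def)
    show "edges (relabel f H) \<subseteq> edges ({1..n}, nsets {1..n} 2)"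
      using ns f(2) by (fastforce simp: relabel_def nsets_def)
    show "\<exists>g. bij_betw g (verts H) (verts (relabel f H)) \<and>
        edges (relabel f H) = (\<lambda>e. g ` e) ` edges H"
      using f by (intro exI[of _ f]) (auto simp: relabel_def bij_betw_def)
  qed
  then show ?thesis by blast
qed

lemma relabel_copies:
  assumes K: "K \<in> copies H n" and p: "\<pi> permutes {1..n}"
  shows "relabel \<pi> K \<in> copies H n"
proof -
  have inj: "inj \<pi>" using p permutes_inj by blast
  have im: "\<pi> ` {1..n} = {1..n}" using p permutes_image by blast
  obtain f where f: "bij_betw f (verts H) (verts K)" "edges K = (\<lambda>e. f ` e) ` edges H"
    using K unfolding copies_def isomorphic_def by blast
  have ns: "\<pi> ` e \<in> nsets (\<pi> ` verts K) 2" if "e \<in> edges K" for e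
  proof -
    have "e \<subseteq> verts K" "finite e" "card e = 2"
      using copy_simple[OF K] that by (auto simp: simple_graph_def nsets_def)
    then show ?thesis using inj by (auto simp: nsets_def card_image inj_on_subset)
  qed
  have sub: "\<pi> ` verts K \<subseteq> {1..n}" using copy_verts[OF K] im by blast
  show ?thesis
    unfolding copies_def subgraph_def isomorphic_def complete_graph_def
  proof (intro CollectI conjI)
    show "simple_graph (relabel \<pi> K)"
      using copy_simple[OF K] ns by (auto simp: simple_graph_def relabel_def)
    show "verts (relabel \<pi> K) \<subseteq> verts ({1..n}, nsets {1..n} 2)" using sub by (simp add: relabel_def)
    show "edges (relabel \<pi> K) \<subseteq> edges ({1..n}, nsets {1..n} 2)"
      using ns sub by (fastforce simp: relabel_def nsets_def)
    have "bij_betw \<pi> (verts K) (\<pi> ` verts K)" using inj by (meson inj_on_imp_bij_betw inj_on_subset subset_UNIV)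
    then show "\<exists>g. bij_betw g (verts H) (verts (relabel \<pi> K)) \<and>
        edges (relabel \<pi> K) = (\<lambda>e. g ` e) ` edges H"
      using f by (intro exI[of _ "\<pi> \<circ> f"]) (auto simp: relabel_def image_comp intro: bij_betw_trans)
  qed
qed

lemma card_copies_relabel_le:
  assumes p: "\<pi> permutes {1..n}"
    and PQ: "\<And>K. K \<in> copies H n \<Longrightarrow> P K \<Longrightarrow> Q (relabel \<pi> K)"
  shows "card {K \<in> copies H n. P K} \<le> card {K \<in> copies H n. Q K}"
proof (rule card_inj_on_le)
  show "inj_on (relabel \<pi>) {K \<in> copies H n. P K}"
    using inj_relabel[OF permutes_inj[OF p]] by (meson inj_on_subset subset_UNIV)
  show "relabel \<pi> ` {K \<in> copies H n. P K} \<subseteq> {K \<in> copies H n. Q K}"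
    using PQ relabel_copies[OF _ p] by auto
  show "finite {K \<in> copies H n. Q K}" by simp
qed

section \<open>Proportions of copies, from symmetry and double counting\<close>

lemma ex_permutes_pair:
  fixes u v u' v' :: 'b
  assumes "u \<in> S" "v \<in> S" "u' \<in> S" "v' \<in> S" "u \<noteq> v" "u' \<noteq> v'"
  shows "\<exists>\<pi>. \<pi> permutes S \<and> \<pi> u = u' \<and> \<pi> v = v'"
proof -
  \<comment> \<open>The place of \<open>v\<close> after the first transposition. Both
    \<open>w\<close> and \<open>v'\<close> differ from \<open>u'\<close>, so the second
    transposition does not disturb the image of \<open>u\<close>.\<close>
  define w where "w = Transposition.transpose u u' v"
  have w: "w \<in> S" "w \<noteq> u'" using assms by (auto simp: w_def Transposition.transpose_def)
  have "(Transposition.transpose w v' \<circ> Transposition.transpose u u') permutes S"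
    using assms w by (intro permutes_compose permutes_swap_id) auto
  moreover have "(Transposition.transpose w v' \<circ> Transposition.transpose u u') u = u'"
    using assms w by (simp add: transpose_apply_other)
  moreover have "(Transposition.transpose w v' \<circ> Transposition.transpose u u') v = v'"
    by (simp add: w_def[symmetric])
  ultimately show ?thesis by blast
qed

text \<open>The assumed inequality applies in both directions, so all elements of \<open>P\<close>
  have equally many incidences, and summing over \<open>P\<close> or over \<open>C\<close> counts
  the same pairs. With vertices, ordered pairs or edges as \<open>P\<close> this gives the
  proportion of copies through each of them.\<close>

lemma double_count:
  assumes "finite P" "finite C" "\<And>p q. p \<in> P \<Longrightarrow> q \<in> P \<Longrightarrow> card {K \<in> C. R p K} \<le> card {K \<in> C. R q K}"
    and "\<And>K. K \<in> C \<Longrightarrow> card {p \<in> P. R p K} = d" "p \<in> P"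
  shows "card P * card {K \<in> C. R p K} = d * card C"
proof -
  have "(\<Sum>q\<in>P. card {K \<in> C. R q K}) = d * card C"
    using assms by (intro sum_multicount) auto
  moreover have "(\<Sum>q\<in>P. card {K \<in> C. R q K}) = (\<Sum>q\<in>P. card {K \<in> C. R p K})"
    using assms(3,5) by (intro sum.cong refl) (simp add: eq_iff)
  ultimately show ?thesis by simp
qed

lemma degree_count:
  assumes v: "v \<in> {1..n}"
  shows "n * card {K \<in> copies H n. v \<in> verts K} = k * card (copies H n)"
proof -
  have "card {1..n} * card {K \<in> copies H n. v \<in> verts K} = k * card (copies H n)"
  proof (rule double_count)
    fix p q assume pq: "p \<in> {1..n}" "q \<in> {1..n}"
    show "card {K \<in> copies H n. p \<in> verts K} \<le> card {K \<in> copies H n. q \<in> verts K}"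
      by (rule card_copies_relabel_le[OF permutes_swap_id[OF pq]]) (force simp: relabel_def)
  next
    fix K assume K: "K \<in> copies H n"
    have "{p \<in> {1..n}. p \<in> verts K} = verts K" using copy_verts[OF K] by auto
    then show "card {p \<in> {1..n}. p \<in> verts K} = k" using copy_card[OF K] by simp
  qed (use v in auto)
  then show ?thesis by simp
qed

lemma card_offdiag:
  assumes "finite S"
  shows "card {(u, v). u \<in> S \<and> v \<in> S \<and> u \<noteq> v} = card S * (card S - 1)"
proof -
  have "{(u, v). u \<in> S \<and> v \<in> S \<and> u \<noteq> v} = (SIGMA u:S. S - {u})" by auto
  then show ?thesis using assms by simp
qed

lemma codegree_count:
  assumes uv: "u \<in> {1..n}" "v \<in> {1..n}" "u \<noteq> v"
  shows "n * (n - 1) * card {K \<in> copies H n. u \<in> verts K \<and> v \<in> verts K} = k * (k - 1) * card (copies H n)"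
proof -
  let ?P = "{(u, v). u \<in> {1..n} \<and> v \<in> {1..n} \<and> u \<noteq> v}"
  have cP: "card ?P = n * (n - 1)" using card_offdiag[of "{1..n}"] by simp
  have finP: "finite ?P" by (rule finite_subset[of _ "{1..n} \<times> {1..n}"]) auto
  have "card ?P * card {K \<in> copies H n. fst (u, v) \<in> verts K \<and> snd (u, v) \<in> verts K}
      = k * (k - 1) * card (copies H n)"
  proof (rule double_count[OF finP])
    fix p q assume "p \<in> ?P" "q \<in> ?P"
    then obtain \<pi> where \<pi>: "\<pi> permutes {1..n}" "\<pi> (fst p) = fst q" "\<pi> (snd p) = snd q"
      using ex_permutes_pair[of "fst p" "{1..n}" "snd p" "fst q" "snd q"] by auto
    show "card {K \<in> copies H n. fst p \<in> verts K \<and> snd p \<in> verts K}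
        \<le> card {K \<in> copies H n. fst q \<in> verts K \<and> snd q \<in> verts K}"
      by (rule card_copies_relabel_le[OF \<pi>(1)]) (use \<pi> in \<open>force simp: relabel_def\<close>)
  next
    fix K assume K: "K \<in> copies H n"
    have "{p \<in> ?P. fst p \<in> verts K \<and> snd p \<in> verts K} = {(u, v). u \<in> verts K \<and> v \<in> verts K \<and> u \<noteq> v}"
      using copy_verts[OF K] by auto
    then show "card {p \<in> ?P. fst p \<in> verts K \<and> snd p \<in> verts K} = k * (k - 1)"
      using card_offdiag[of "verts K"] copy_card[OF K] copy_simple[OF K] by (simp add: simple_graph_def)
  qed (use uv in auto)
  then show ?thesis using cP by simp
qed

lemma edge_count:
  assumes uv: "u \<in> {1..n}" "v \<in> {1..n}" "u \<noteq> v"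
  shows "n * (n - 1) * card {K \<in> copies H n. {u, v} \<in> edges K} = 2 * m * card (copies H n)"
proof -
  let ?P = "nsets {1..n} 2"
  have 1: "card ?P * card {K \<in> copies H n. {u, v} \<in> edges K} = m * card (copies H n)"
  proof (rule double_count)
    show "finite ?P" by (simp add: finite_imp_finite_nsets)
    show "{u, v} \<in> ?P" using uv by (auto simp: nsets_def)
    fix p q assume "p \<in> ?P" "q \<in> ?P"
    then obtain a b c d where ab: "p = {a, b}" "a \<noteq> b" "q = {c, d}" "c \<noteq> d" "{a, b, c, d} \<subseteq> {1..n}"
      by (auto simp: nsets_def card_2_iff)
    then obtain \<pi> where \<pi>: "\<pi> permutes {1..n}" "\<pi> a = c" "\<pi> b = d"
      using ex_permutes_pair[of a "{1..n}" b c d] by auto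
    then have "\<pi> ` p = q" using ab by auto
    then show "card {K \<in> copies H n. p \<in> edges K} \<le> card {K \<in> copies H n. q \<in> edges K}"
      by (intro card_copies_relabel_le[OF \<pi>(1)]) (force simp: relabel_def)
  next
    fix K assume K: "K \<in> copies H n"
    have "edges K \<subseteq> ?P" using K by (simp add: copies_def subgraph_def complete_graph_def)
    then have "{p \<in> ?P. p \<in> edges K} = edges K" by auto
    then show "card {p \<in> ?P. p \<in> edges K} = m" using copy_card_edges[OF K] by simp
  qed (rule finite_copies)
  have 2: "card ?P * 2 = n * (n - 1)"
  proof -
    have "even (n * (n - 1))" by (cases n) auto
    then show ?thesis using choose_two[of n] by (simp add: card_nsets)
  qed
  have "card ?P * 2 * card {K \<in> copies H n. {u, v} \<in> edges K}
      = 2 * (card ?P * card {K \<in> copies H n. {u, v} \<in> edges K})" by simp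
  then show ?thesis unfolding 1 2 by simp
qed

text \<open>By \<open>edge_count\<close> the number of copies through an edge is positive, hence at
  least one. The resulting quadratic growth makes \<open>m\<^sub>1\<close>, of order n ln n,
  negligible against the number of copies.\<close>

lemma card_copies_ge:
  assumes "k \<le> n"
  shows "n * (n - 1) \<le> 2 * m * card (copies H n)"
proof -
  have n: "2 \<le> n" using assms k_ge_2 by simp
  have eq: "n * (n - 1) * card {K \<in> copies H n. {1, 2} \<in> edges K} = 2 * m * card (copies H n)"
    using n by (intro edge_count) auto
  have "0 < 2 * m * card (copies H n)"
    using m_pos copies_nonempty[OF assms] by (simp add: card_gt_0_iff)
  then have "1 \<le> card {K \<in> copies H n. {1, 2} \<in> edges K}"
    unfolding eq[symmetric] by simp
  then have "n * (n - 1) * 1 \<le> n * (n - 1) * card {K \<in> copies H n. {1, 2} \<in> edges K}"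
    by (rule mult_left_mono) simp
  then show ?thesis unfolding eq by simp
qed

text \<open>Summing \<open>edge_count\<close> over the pairs in \<open>A \<times> B\<close> counts
  each crossing copy at most \<open>m\<close> times; disjointness of \<open>A\<close> and
  \<open>B\<close> ensures that different pairs are different edges.\<close>

lemma crossing_count:
  assumes AB: "A \<subseteq> {1..n}" "B \<subseteq> {1..n}" "A \<inter> B = {}"
  shows "2 * card A * card B * card (copies H n)
    \<le> n * (n - 1) * card {K \<in> copies H n. \<exists>a\<in>A. \<exists>b\<in>B. {a, b} \<in> edges K}"
proof -
  let ?C = "copies H n"
  let ?F = "{K \<in> ?C. \<exists>a\<in>A. \<exists>b\<in>B. {a, b} \<in> edges K}"
  have fin: "finite A" "finite B" using finite_subset[OF AB(1)] finite_subset[OF AB(2)] by auto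
  have "card A * card B * (2 * m * card ?C) = (\<Sum>p\<in>A \<times> B. 2 * m * card ?C)"
    by (simp add: card_cartesian_product)
  also have "\<dots> = (\<Sum>p\<in>A \<times> B. n * (n - 1) * card {K \<in> ?C. {fst p, snd p} \<in> edges K})"
    using AB by (intro sum.cong refl edge_count[symmetric]) auto
  also have "\<dots> = n * (n - 1) * (\<Sum>p\<in>A \<times> B. card {K \<in> ?F. {fst p, snd p} \<in> edges K})"
    unfolding sum_distrib_left
  proof (rule sum.cong[OF refl])
    fix p assume "p \<in> A \<times> B"
    then have "fst p \<in> A" "snd p \<in> B" by auto
    then have "{K \<in> ?C. {fst p, snd p} \<in> edges K} = {K \<in> ?F. {fst p, snd p} \<in> edges K}" by blast
    then show "n * (n - 1) * card {K \<in> ?C. {fst p, snd p} \<in> edges K}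
      = n * (n - 1) * card {K \<in> ?F. {fst p, snd p} \<in> edges K}" by (rule arg_cong)
  qed
  also have "(\<Sum>p\<in>A \<times> B. card {K \<in> ?F. {fst p, snd p} \<in> edges K})
      = (\<Sum>K\<in>?F. card {p \<in> A \<times> B. {fst p, snd p} \<in> edges K})"
    using fin by (intro sum_multicount_gen) auto
  also have "\<dots> \<le> (\<Sum>K\<in>?F. m)"
  proof (rule sum_mono)
    fix K assume "K \<in> ?F"
    then have K: "K \<in> ?C" by simp
    have "finite (edges K)" using copy_card_edges[OF K] m_pos card_gt_0_iff by metis
    moreover have "inj_on (\<lambda>p. {fst p, snd p}) {p \<in> A \<times> B. {fst p, snd p} \<in> edges K}"
      using AB(3) by (auto simp: inj_on_def doubleton_eq_iff)
    ultimately have "card {p \<in> A \<times> B. {fst p, snd p} \<in> edges K} \<le> card (edges K)"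
      by (intro card_inj_on_le) auto
    then show "card {p \<in> A \<times> B. {fst p, snd p} \<in> edges K} \<le> m" using copy_card_edges[OF K] by simp
  qed
  finally have "m * (2 * card A * card B * card ?C) \<le> m * (n * (n - 1) * card ?F)"
    by (simp add: mult_ac)
  then show ?thesis using m_pos by simp
qed

section \<open>Bad events\<close>

lemma copies_pos: "k \<le> n \<Longrightarrow> 0 < real (card (copies H n))"
  using copies_nonempty by (simp add: card_gt_0_iff)

lemma set_uniform_perm_copies: "set_pmf (uniform_perm (copies H n)) = permutations_of_set (copies H n)"
  by (rule set_pmf_of_set) simp_all

lemma set_take_copies:
  assumes "xs \<in> set_pmf (uniform_perm (copies H n))"
  shows "set (take t xs) \<subseteq> copies H n"
  using assms set_take_subset[of t xs] unfolding set_uniform_perm_copies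
  by (simp add: permutations_of_set_def)

lemma degree_real:
  assumes "v \<in> {1..n}"
  shows "real (card {K \<in> copies H n. v \<in> verts K}) = real k * card (copies H n) / n"
proof -
  have "real n * real (card {K \<in> copies H n. v \<in> verts K}) = real k * real (card (copies H n))"
    using degree_count[OF assms] by (simp only: of_nat_mult[symmetric])
  moreover have "real n > 0" using assms by simp
  ultimately show ?thesis by (simp add: field_simps)
qed

lemma codegree_real:
  assumes "u \<in> {1..n}" "v \<in> {1..n}" "u \<noteq> v"
  shows "real (card {K \<in> copies H n. u \<in> verts K \<and> v \<in> verts K})
    \<le> (real k)\<^sup>2 * card (copies H n) / (real n * (real n - 1))"
proof -
  have n: "n \<ge> 2" using assms by auto
  have "real (n * (n - 1) * card {K \<in> copies H n. u \<in> verts K \<and> v \<in> verts K})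
      = real (k * (k - 1) * card (copies H n))"
    using codegree_count[OF assms] by simp
  also have "\<dots> \<le> real (k * k * card (copies H n))"
    by (intro of_nat_mono mult_mono) auto
  finally have "real n * (real n - 1) * card {K \<in> copies H n. u \<in> verts K \<and> v \<in> verts K}
      \<le> (real k)\<^sup>2 * card (copies H n)"
    using n by (simp add: of_nat_diff power2_eq_square)
  moreover have "0 < real n * (real n - 1)" using n by simp
  ultimately show ?thesis by (simp add: pos_le_divide_eq mult.commute)
qed

lemma inverse_card_copies_le:
  assumes "k \<le> n"
  shows "1 / real (card (copies H n)) \<le> 2 * m / (real n * (real n - 1))"
proof -
  have n: "2 \<le> n" using assms k_ge_2 by simp
  have "real (n * (n - 1)) \<le> real (2 * m * card (copies H n))"
    using card_copies_ge[OF assms] by (rule of_nat_mono)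
  then have "real n * (real n - 1) \<le> 2 * m * card (copies H n)" using n by (simp add: of_nat_diff)
  moreover have "0 < real n * (real n - 1)" using n by simp
  ultimately show ?thesis using copies_pos[OF assms] by (simp add: divide_simps mult_ac)
qed

text \<open>First moment: a vertex lies in the proportion \<open>k / n\<close> of the copies, so it
  is missed with probability at most \<open>(1 - k / n) ^ t\<close>.\<close>

lemma prob_isolated_le:
  assumes "k \<le> n" "t \<le> card (copies H n)"
  shows "measure_pmf.prob (uniform_perm (copies H n))
      {xs. \<exists>v\<in>{1..n}. \<forall>K\<in>set (take t xs). v \<notin> verts K} \<le> n * exp (- (real k * t / n))"
proof -
  let ?P = "measure_pmf.prob (uniform_perm (copies H n))"
  let ?F = "\<lambda>v. {K \<in> copies H n. v \<in> verts K}"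
  have n: "n > 0" using assms k_ge_2 by simp
  have "?P {xs. \<exists>v\<in>{1..n}. \<forall>K\<in>set (take t xs). v \<notin> verts K}
      \<le> ?P (\<Union>v\<in>{1..n}. {xs. set (take t xs) \<inter> ?F v = {}})"
    by (intro measure_pmf.finite_measure_mono) auto
  also have "\<dots> \<le> (\<Sum>v\<in>{1..n}. ?P {xs. set (take t xs) \<inter> ?F v = {}})"
    by (rule prob_UN_le) simp
  also have "\<dots> \<le> (\<Sum>v\<in>{1..n}. exp (- (real k * t / n)))"
  proof (rule sum_mono)
    fix v assume v: "v \<in> {1..n}"
    have "?P {xs. set (take t xs) \<inter> ?F v = {}} \<le> (1 - real (card (?F v)) / card (copies H n)) ^ t"
      using prob_contain_avoid_le[of "copies H n" "{}" "?F v" t t] assms by simp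
    also have "real (card (?F v)) / card (copies H n) = real k / n"
    proof -
      have "x * N / y / N = x / y" if "N > 0" for x y N :: real using that by simp
      then show ?thesis unfolding degree_real[OF v] using copies_pos[OF assms(1)] by blast
    qed
    also have "(1 - real k / n) ^ t \<le> exp (- (real k / n)) ^ t"
      using exp_ge_add_one_self[of "- (real k / n)"] assms n by (intro power_mono) auto
    also have "\<dots> = exp (- (real k * t / n))" by (simp add: exp_of_nat_mult[symmetric] mult.commute)
    finally show "?P {xs. set (take t xs) \<inter> ?F v = {}} \<le> exp (- (real k * t / n))" .
  qed
  finally show ?thesis by simp
qed

text \<open>The pairs \<open>(A, T)\<close> are counted with the weight \<open>x ^ card T * x ^ card A\<close>, which sums to
  \<open>(1 + x) ^ (2 * n)\<close>.\<close>

lemma prob_hole_le: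
  fixes r x :: real
  assumes kn: "k \<le> n" and t: "t \<le> card (copies H n)" and x: "0 < x" "x \<le> 1" and r: "0 \<le> r"
  defines "z \<equiv> exp (- (t / (8 * n))) / x ^ 9"
  assumes z: "z \<le> 1"
  shows "measure_pmf.prob (uniform_perm (copies H n))
      {xs. \<exists>A T. A \<subseteq> {1..n} \<and> T \<subseteq> {1..n} \<and> A \<inter> T = {} \<and> r \<le> real (card A) \<and> card T \<le> 8 * card A
        \<and> 16 * (card A + card T) \<le> 15 * n
        \<and> \<not> (\<exists>a\<in>A. \<exists>b\<in>{1..n} - A - T. {a, b} \<in> \<Union>(edges ` set (take t xs)))}
    \<le> exp (2 * x * n) * z powr r" (is "measure_pmf.prob _ ?B \<le> _")
proof -
  let ?P = "measure_pmf.prob (uniform_perm (copies H n))"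
  let ?V = "{1..n}"
  let ?N = "real (card (copies H n))"
  let ?ok = "\<lambda>A T. A \<subseteq> ?V \<and> T \<subseteq> ?V \<and> A \<inter> T = {} \<and> r \<le> real (card A) \<and> card T \<le> 8 * card A
      \<and> 16 * (card A + card T) \<le> 15 * n"
  let ?I = "{(A, T). ?ok A T}"
  let ?F = "\<lambda>A T. {K \<in> copies H n. \<exists>a\<in>A. \<exists>b\<in>?V - A - T. {a, b} \<in> edges K}"
  have n: "n \<ge> 2" using kn k_ge_2 by simp
  have N: "?N > 0" by (rule copies_pos[OF kn])
  have z0: "0 < z" using x by (simp add: z_def)
  have IPow: "?I \<subseteq> Pow ?V \<times> Pow ?V" by auto
  then have finI: "finite ?I" by (rule finite_subset) simp
  have single: "?P {xs. set (take t xs) \<inter> ?F A T = {}} \<le> x ^ card A * x ^ card T * z powr r" if ok: "?ok A T" for A T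
  proof -
    have fAT: "finite A" "finite T" using ok finite_subset[of _ ?V] by auto
    have "card (?V - A - T) = card (?V - (A \<union> T))" by (rule arg_cong[where f = card]) auto
    also have "\<dots> = n - card (A \<union> T)" using ok fAT by (subst card_Diff_subset) auto
    also have "card (A \<union> T) = card A + card T" using ok fAT by (intro card_Un_disjoint) auto
    finally have cB: "card (?V - A - T) = n - (card A + card T)" .
    have "n \<le> 16 * (n - s)" if "16 * s \<le> 15 * n" for s using that by simp
    then have B: "n \<le> 16 * card (?V - A - T)" unfolding cB using ok by blast
    have "2 * card A * card (?V - A - T) * card (copies H n) \<le> n * (n - 1) * card (?F A T)"
      by (rule crossing_count[of A n "?V - A - T"]) (use ok in blast)+
    then have "16 * (2 * card A * card (?V - A - T) * card (copies H n)) \<le> 16 * (n * (n - 1) * card (?F A T))"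
      by (rule mult_left_mono) simp
    moreover have "(2 * card A * card (copies H n)) * n \<le> (2 * card A * card (copies H n)) * (16 * card (?V - A - T))"
      using B by (rule mult_left_mono) simp
    moreover have "2 * n * (a * N) \<le> 2 * n * (8 * (n - 1) * f)"
      if "16 * (2 * a * b * N) \<le> 16 * (n * (n - 1) * f)" "(2 * a * N) * n \<le> (2 * a * N) * (16 * b)" for a b N f :: nat
      using order_trans[OF that(2), of "16 * (n * (n - 1) * f)"] that(1) by (simp add: mult_ac)
    ultimately have "2 * n * (card A * card (copies H n)) \<le> 2 * n * (8 * (n - 1) * card (?F A T))"
      by blast
    then have "card A * card (copies H n) \<le> 8 * (n - 1) * card (?F A T)"
      using n by simp
    also have "\<dots> \<le> 8 * n * card (?F A T)" by (intro mult_mono) simp_all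
    finally have "real (card A * card (copies H n)) \<le> real (8 * n * card (?F A T))" by (rule of_nat_mono)
    then have "real (card A) * ?N \<le> 8 * real n * real (card (?F A T))" by simp
    \<comment> \<open>The crossing copies have proportion at least 2 |A| |B| / (n (n - 1)), where B
      is the rest of the vertices; since B has at least n / 16 elements, this is at least |A| / (8
      n).\<close>
    then have ratio: "real (card A) / (8 * n) \<le> real (card (?F A T)) / ?N"
      using n N by (simp add: field_simps)
    have "card (?F A T) \<le> card (copies H n)" by (intro card_mono) auto
    then have le1: "real (card (?F A T)) / ?N \<le> 1" using N by (simp add: divide_le_eq_1)
    have "?P {xs. set (take t xs) \<inter> ?F A T = {}} \<le> (1 - real (card (?F A T)) / ?N) ^ t"
      using prob_contain_avoid_le[of "copies H n" "{}" "?F A T" t t] t by simp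
    also have "\<dots> \<le> (1 - real (card A) / (8 * n)) ^ t"
      using ratio le1 by (intro power_mono) auto
    also have "\<dots> \<le> exp (- (real (card A) / (8 * n))) ^ t"
      using exp_ge_add_one_self[of "- (real (card A) / (8 * n))"] ratio le1
      by (intro power_mono) linarith+
    also have "\<dots> = exp (- (t / (8 * n))) ^ card A"
      by (simp add: exp_of_nat_mult[symmetric] mult.commute)
    \<comment> \<open>Nine factors \<open>x\<close> per element of \<open>A\<close> are set aside as
      weight: one for \<open>A\<close> itself and eight for \<open>T\<close>, whose size is at most
      \<open>8 * card A\<close>.\<close>
    also have "exp (- (t / (8 * n))) = x ^ 9 * z" using x by (simp add: z_def)
    also have "(x ^ 9 * z) ^ card A = x ^ card A * x ^ (8 * card A) * z ^ card A"
      by (simp add: power_mult_distrib power_add[symmetric] power_mult[symmetric])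
    also have "\<dots> \<le> x ^ card A * x ^ card T * z powr r"
    proof (intro mult_mono)
      show "x ^ (8 * card A) \<le> x ^ card T" using ok x by (intro power_decreasing) auto
      have "z ^ card A = z powr real (card A)" using z0 by (simp add: powr_realpow)
      also have "\<dots> \<le> z powr r" using ok z z0 by (intro powr_mono') auto
      finally show "z ^ card A \<le> z powr r" .
    qed (use x z0 in auto)
    finally show ?thesis .
  qed
  have "?P ?B
      \<le> ?P (\<Union>p\<in>?I. {xs. set (take t xs) \<inter> ?F (fst p) (snd p) = {}})"
  proof (intro measure_pmf.finite_measure_mono subsetI)
    fix xs
    assume "xs \<in> ?B"
    then obtain A T where AT: "?ok A T"
      "\<not> (\<exists>a\<in>A. \<exists>b\<in>?V - A - T. {a, b} \<in> \<Union>(edges ` set (take t xs)))" by blast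
    then have "set (take t xs) \<inter> ?F A T = {}" by blast
    then have "xs \<in> {xs. set (take t xs) \<inter> ?F (fst (A, T)) (snd (A, T)) = {}}" by simp
    moreover have "(A, T) \<in> ?I" using AT(1) by simp
    ultimately show "xs \<in> (\<Union>p\<in>?I. {xs. set (take t xs) \<inter> ?F (fst p) (snd p) = {}})"
      by (rule UN_I[rotated])
  qed simp
  also have "\<dots> \<le> (\<Sum>p\<in>?I. ?P {xs. set (take t xs) \<inter> ?F (fst p) (snd p) = {}})"
    by (rule prob_UN_le[OF finI])
  also have "\<dots> \<le> (\<Sum>p\<in>?I. x ^ card (fst p) * x ^ card (snd p) * z powr r)"
    using single by (intro sum_mono) auto
  also have "\<dots> \<le> (\<Sum>p\<in>Pow ?V \<times> Pow ?V. x ^ card (fst p) * x ^ card (snd p) * z powr r)"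
    using IPow x by (intro sum_mono2) auto
  also have "\<dots> = (\<Sum>A\<in>Pow ?V. x ^ card A) * (\<Sum>T\<in>Pow ?V. x ^ card T) * z powr r"
  proof -
    have "(\<Sum>p\<in>Pow ?V \<times> Pow ?V. x ^ card (fst p) * x ^ card (snd p) * z powr r)
        = (\<Sum>A\<in>Pow ?V. \<Sum>T\<in>Pow ?V. x ^ card A * x ^ card T * z powr r)"
      unfolding sum.cartesian_product by (simp only: case_prod_unfold)
    then show ?thesis unfolding sum_product by (simp only: sum_distrib_right)
  qed
  also have "\<dots> = ((1 + x) ^ n * (1 + x) ^ n) * z powr r"
    using sum_Pow_power[of ?V x] by simp
  also have "\<dots> \<le> (exp x ^ n * exp x ^ n) * z powr r"
    using x exp_ge_add_one_self[of x] by (intro mult_right_mono mult_mono power_mono) auto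
  also have "exp x ^ n * exp x ^ n = exp (2 * x * n)"
    by (simp add: exp_of_nat_mult[symmetric] exp_add[symmetric])
  finally show ?thesis .
qed

text \<open>For \<open>card X = s\<close>, at most the proportion s^2 k^2 / n^2 of the copies meets
  \<open>X\<close> twice, so \<open>2 * s\<close> of them occur with probability at most (e s k^2 t
  / n^2)^(2 s). Multiplied by the (e n / s)^s choices of \<open>X\<close> this is at most
  \<open>y ^ s\<close>. Demanding two copies per vertex is what makes the power of n
  negative.\<close>

lemma prob_dense_set_le:
  fixes R :: real
  assumes kn: "k \<le> n" and t: "t \<le> card (copies H n)" and R: "0 \<le> R"
  defines "y \<equiv> exp 3 * real k ^ 4 * R * real t ^ 2 / real n ^ 3"
  assumes y: "y \<le> 1 / 2"
  shows "measure_pmf.prob (uniform_perm (copies H n))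
      {xs. \<exists>X. X \<subseteq> {1..n} \<and> X \<noteq> {} \<and> real (card X) \<le> R
        \<and> 2 * card X \<le> card {K \<in> set (take t xs). 2 \<le> card (verts K \<inter> X)}}
    \<le> 2 * y" (is "measure_pmf.prob _ ?B \<le> _")
proof -
  let ?p = "uniform_perm (copies H n)"
  let ?P = "measure_pmf.prob ?p"
  let ?V = "{1..n}"
  let ?N = "real (card (copies H n))"
  let ?F = "\<lambda>X. {K \<in> copies H n. 2 \<le> card (verts K \<inter> X)}"
  have n: "n \<ge> 2" using kn k_ge_2 by simp
  have N: "?N > 0" by (rule copies_pos[OF kn])
  have y0: "0 \<le> y" using R by (simp add: y_def)
  have cardF: "real (card (?F X)) \<le> (real (card X))\<^sup>2 * (real k)\<^sup>2 * ?N / (real n)\<^sup>2"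
    if X: "X \<subseteq> ?V" "X \<noteq> {}" for X
  proof -
    let ?O = "{(u, v). u \<in> X \<and> v \<in> X \<and> u \<noteq> v}"
    let ?c = "(real k)\<^sup>2 * ?N / (real n * (real n - 1))"
    have fX: "finite X" using X finite_subset by blast
    have finO: "finite ?O" by (rule finite_subset[of _ "X \<times> X"]) (use fX in auto)
    have "?F X \<subseteq> (\<Union>p\<in>?O. {K \<in> copies H n. fst p \<in> verts K \<and> snd p \<in> verts K})"
    proof
      fix K assume K: "K \<in> ?F X"
      then have "\<not> card (verts K \<inter> X) \<le> Suc 0" by simp
      then obtain u v where "u \<in> verts K \<inter> X" "v \<in> verts K \<inter> X" "u \<noteq> v"
        using card_le_Suc0_iff_eq[of "verts K \<inter> X"] fX by auto
      then have "(u, v) \<in> ?O" "K \<in> {K \<in> copies H n. fst (u, v) \<in> verts K \<and> snd (u, v) \<in> verts K}"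
        using K by simp_all
      then show "K \<in> (\<Union>p\<in>?O. {K \<in> copies H n. fst p \<in> verts K \<and> snd p \<in> verts K})"
        by (rule UN_I)
    qed
    then have "card (?F X) \<le> card (\<Union>p\<in>?O. {K \<in> copies H n. fst p \<in> verts K \<and> snd p \<in> verts K})"
      using finO by (intro card_mono finite_UN_I) simp_all
    also have "\<dots> \<le> (\<Sum>p\<in>?O. card {K \<in> copies H n. fst p \<in> verts K \<and> snd p \<in> verts K})"
      by (rule card_UN_le[OF finO])
    finally have "real (card (?F X)) \<le> (\<Sum>p\<in>?O. real (card {K \<in> copies H n. fst p \<in> verts K \<and> snd p \<in> verts K}))"
      by (simp only: of_nat_sum[symmetric] of_nat_le_iff)
    also have "\<dots> \<le> (\<Sum>p\<in>?O. ?c)"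
    proof (rule sum_mono)
      fix p assume "p \<in> ?O"
      then have "fst p \<in> {1..n}" "snd p \<in> {1..n}" "fst p \<noteq> snd p" using X(1) by auto
      then show "real (card {K \<in> copies H n. fst p \<in> verts K \<and> snd p \<in> verts K}) \<le> ?c"
        by (rule codegree_real)
    qed
    also have "\<dots> = real (card X * (card X - 1)) * ?c"
      using card_offdiag[OF fX] by simp
    \<comment> \<open>Because \<open>X\<close> has at most \<open>n\<close> elements, s (s - 1) is
      at most s^2 (n - 1) / n; this cancels the \<open>n - 1\<close> of the codegree.\<close>
    also have "\<dots> \<le> (real (card X))\<^sup>2 * (real n - 1) / n * ?c"
    proof (rule mult_right_mono)
      have "card X \<le> n" using card_mono[OF _ X(1)] by simp
      moreover have "1 \<le> card X" using X(2) fX by (simp add: Suc_le_eq card_gt_0_iff)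
      ultimately have "real (card X) * ((real (card X) - 1) * n) \<le> real (card X) * (real (card X) * (real n - 1))"
        by (intro mult_left_mono) (auto simp: algebra_simps)
      then show "real (card X * (card X - 1)) \<le> (real (card X))\<^sup>2 * (real n - 1) / n"
        using n \<open>1 \<le> card X\<close> by (simp add: of_nat_diff power2_eq_square pos_le_divide_eq mult_ac)
      show "0 \<le> ?c" using n by simp
    qed
    also have "\<dots> = (real (card X))\<^sup>2 * (real k)\<^sup>2 * ?N / (real n)\<^sup>2"
      using n by (simp add: power2_eq_square field_simps)
    finally show ?thesis .
  qed
  have single: "real (n choose s) * ?P {xs. 2 * card X \<le> card (set (take t xs) \<inter> ?F X)} \<le> y ^ s"
    if X: "X \<subseteq> ?V" "card X = s" "0 < s" "real s \<le> R" for X s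
  proof -
    have "X \<noteq> {}" using X by auto
    note cF = cardF[OF X(1) this]
    have "?P {xs. 2 * card X \<le> card (set (take t xs) \<inter> ?F X)}
        \<le> real (card (?F X) choose (2 * s)) * (real t / ?N) ^ (2 * s)"
      using prob_contain_many_le[of "copies H n" "?F X" t "2 * s"] t X by simp
    also have "\<dots> \<le> (exp 1 * card (?F X) / real (2 * s)) ^ (2 * s) * (real t / ?N) ^ (2 * s)"
      using X by (intro mult_right_mono choose_le_exp) auto
    also have "\<dots> = (exp 1 * card (?F X) / real (2 * s) * (real t / ?N)) ^ (2 * s)"
      by (rule power_mult_distrib[symmetric])
    also have "\<dots> \<le> (exp 1 * real k ^ 2 * real s * t / (real n)\<^sup>2) ^ (2 * s)"
    proof (rule power_mono)
      have "exp 1 * card (?F X) / real (2 * s) * (real t / ?N)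
          \<le> exp 1 * ((real s)\<^sup>2 * (real k)\<^sup>2 * ?N / (real n)\<^sup>2) / real (2 * s) * (real t / ?N)"
        using cF X by (intro mult_right_mono divide_right_mono mult_left_mono) auto
      also have "\<dots> = exp 1 * real k ^ 2 * real s * t / (real n)\<^sup>2 / 2"
      proof -
        have "e * (s\<^sup>2 * k\<^sup>2 * N / n\<^sup>2) / (2 * s) * (t / N) = e * k\<^sup>2 * s * t / n\<^sup>2 / 2"
          if "N > 0" "s > 0" for e s k N n t :: real
          using that by (simp add: power2_eq_square mult_ac)
        from this[OF N, of "real s" "exp 1" "real k" "real n" "real t"] X(3) show ?thesis by simp
      qed
      also have "\<dots> \<le> exp 1 * real k ^ 2 * real s * t / (real n)\<^sup>2" 
      proof -
        have "w / 2 \<le> w" if "0 \<le> w" for w :: real using that by simp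
        moreover have "0 \<le> exp 1 * real k ^ 2 * real s * t / (real n)\<^sup>2" by simp
        ultimately show ?thesis by blast
      qed
      finally show "exp 1 * card (?F X) / real (2 * s) * (real t / ?N)
          \<le> exp 1 * real k ^ 2 * real s * t / (real n)\<^sup>2" .
    qed simp
    finally have "?P {xs. 2 * card X \<le> card (set (take t xs) \<inter> ?F X)}
        \<le> (exp 1 * real k ^ 2 * real s * t / (real n)\<^sup>2) ^ (2 * s)" .
    moreover have "real (n choose s) \<le> (exp 1 * n / s) ^ s" using X by (intro choose_le_exp)
    ultimately have "real (n choose s) * ?P {xs. 2 * card X \<le> card (set (take t xs) \<inter> ?F X)}
        \<le> (exp 1 * n / s) ^ s * (exp 1 * real k ^ 2 * real s * t / (real n)\<^sup>2) ^ (2 * s)"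
      by (intro mult_mono) auto
    also have "\<dots> = (exp 1 * n / s * (exp 1 * real k ^ 2 * real s * t / (real n)\<^sup>2)\<^sup>2) ^ s"
      by (simp only: power_mult power_mult_distrib[symmetric])
    also have "\<dots> \<le> y ^ s"
    proof (rule power_mono)
      have "exp (3::real) = exp 1 * exp 1 * exp 1" by (simp add: exp_add[symmetric])
      then have "exp 1 * n / s * (exp 1 * real k ^ 2 * real s * t / (real n)\<^sup>2)\<^sup>2
          = exp 3 * real k ^ 4 * real s * real t ^ 2 / real n ^ 3"
        using n X(3) by (simp add: power2_eq_square power4_eq_xxxx power3_eq_cube field_simps)
      also have "\<dots> \<le> y" unfolding y_def using X(4)
        by (intro divide_right_mono mult_right_mono mult_left_mono) auto
      finally show "exp 1 * n / s * (exp 1 * real k ^ 2 * real s * t / (real n)\<^sup>2)\<^sup>2 \<le> y" .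
    qed simp
    finally show ?thesis .
  qed
  let ?S = "\<lambda>s. {X. X \<subseteq> ?V \<and> card X = s}"
  let ?J = "{s \<in> {1..n}. real s \<le> R}"
  have "?P ?B
      \<le> ?P (\<Union>s\<in>?J. \<Union>X\<in>?S s. {xs. 2 * card X \<le> card (set (take t xs) \<inter> ?F X)})"
  proof (rule prob_mono_on_support)
    fix xs assume xs: "xs \<in> set_pmf ?p"
      "xs \<in> ?B"
    then obtain X where X: "X \<subseteq> ?V" "X \<noteq> {}" "real (card X) \<le> R"
      "2 * card X \<le> card {K \<in> set (take t xs). 2 \<le> card (verts K \<inter> X)}" by blast
    have "finite X" using X finite_subset by blast
    then have "card X \<in> ?J" using X card_mono[OF _ X(1)] by (simp add: Suc_le_eq card_gt_0_iff)
    moreover have "X \<in> ?S (card X)" using X by simp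
    moreover have "{K \<in> set (take t xs). 2 \<le> card (verts K \<inter> X)} = set (take t xs) \<inter> ?F X"
      using set_take_copies[OF xs(1)] by blast
    then have "xs \<in> {xs. 2 * card X \<le> card (set (take t xs) \<inter> ?F X)}" using X(4) by simp
    ultimately show "xs \<in> (\<Union>s\<in>?J. \<Union>X\<in>?S s. {xs. 2 * card X \<le> card (set (take t xs) \<inter> ?F X)})"
      by (intro UN_I)
  qed
  also have "\<dots> \<le> (\<Sum>s\<in>?J. ?P (\<Union>X\<in>?S s. {xs. 2 * card X \<le> card (set (take t xs) \<inter> ?F X)}))"
    by (rule prob_UN_le) simp
  also have "\<dots> \<le> (\<Sum>s\<in>?J. y ^ s)"
  proof (rule sum_mono)
    fix s assume s: "s \<in> ?J"
    have finS: "finite (?S s)" by simp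
    have cS: "card (?S s) = n choose s" using n_subsets[of ?V s] by simp
    then have pos: "0 < real (n choose s)" using s by simp
    have "?P (\<Union>X\<in>?S s. {xs. 2 * card X \<le> card (set (take t xs) \<inter> ?F X)})
        \<le> (\<Sum>X\<in>?S s. ?P {xs. 2 * card X \<le> card (set (take t xs) \<inter> ?F X)})"
      by (rule prob_UN_le[OF finS])
    also have "\<dots> \<le> real (card (?S s)) * (y ^ s / real (n choose s))"
    proof (rule sum_bounded_above)
      fix X assume "X \<in> ?S s"
      then show "?P {xs. 2 * card X \<le> card (set (take t xs) \<inter> ?F X)} \<le> y ^ s / real (n choose s)"
        using single[of X s] s pos by (simp add: pos_le_divide_eq mult.commute)
    qed
    also have "\<dots> = y ^ s" using pos cS by simp
    finally show "?P (\<Union>X\<in>?S s. {xs. 2 * card X \<le> card (set (take t xs) \<inter> ?F X)}) \<le> y ^ s" .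
  qed
  also have "\<dots> \<le> (\<Sum>s\<in>{1..n}. y ^ s)" using y0 by (intro sum_mono2) auto
  also have "\<dots> \<le> 2 * y" by (rule geometric_sum_le[OF y0 y])
  finally show ?thesis .
qed

text \<open>The second moment bound for the families of copies through each vertex; the codegree
  bounds their overlaps. The loss factor 5/4 in the exponent is harmless because 5/4 times 2/3 is
  still below 1.\<close>

lemma prob_all_covered_le:
  assumes n: "40 * k \<le> n" and t: "20 * t \<le> card (copies H n)"
  shows "measure_pmf.prob (uniform_perm (copies H n))
      {xs. \<forall>v\<in>{1..n}. \<exists>K\<in>set (take t xs). v \<in> verts K}
    \<le> exp (5 / 4 * k * t / n) / n + (exp (8 * real k ^ 2 * t / (real n * (real n - 1))) - 1)"
proof -
  let ?C = "copies H n"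
  let ?N = "real (card ?C)"
  let ?F = "\<lambda>v. {K \<in> ?C. v \<in> verts K}"
  define a where "a = card (?F 1)"
  define c where "c = (real k)\<^sup>2 * ?N / (real n * (real n - 1))"
  have kn: "k \<le> n" and n2: "n \<ge> 2" using n k_ge_2 by linarith+
  have N: "0 < ?N" by (rule copies_pos[OF kn])
  have a: "real a = real k * ?N / n" unfolding a_def using n2 by (intro degree_real) simp
  have card_F: "card (?F v) = a" if "v \<in> {1..n}" for v
    using degree_real[OF that] a by simp
  have a_le: "real a \<le> ?N / 40"
  proof -
    have "40 * real k \<le> real n" using n by linarith
    then have "40 * real k * ?N \<le> real n * ?N" using N by (intro mult_right_mono) auto
    then show ?thesis unfolding a using n2 by (simp add: field_simps)
  qed
  define q where "q = (\<Prod>i<t. 1 - real a / (?N - real i))"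
  \<comment> \<open>At most a twentieth of the copies is drawn, so the proportion of copies through
    a vertex among those not yet drawn never exceeds \<open>k / n\<close> by more than the factor
    20/19.\<close>
  define y where "y = 20 / 19 * (real k / n)"
  have y: "0 \<le> y" "y \<le> 1 / 38"
  proof -
    have "40 * real k \<le> real n" using n by linarith
    then have "real k / n \<le> 1 / 40" using n2 by (simp add: field_simps)
    then show "y \<le> 1 / 38" unfolding y_def by linarith
    show "0 \<le> y" by (simp add: y_def)
  qed
  have tN: "20 * real t \<le> ?N" using t by linarith
  have "exp (- (t * (y / (1 - y)))) \<le> q"
    unfolding q_def
  proof (rule prod_one_minus_ge_exp)
    show "real t < ?N" using tN N by linarith
    have "real a = y * (19 / 20 * ?N)" unfolding a y_def by simp
    also have "\<dots> \<le> y * (?N - t)" using y tN by (intro mult_left_mono) auto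
    finally show "real a \<le> y * (?N - t)" .
  qed (use y in auto)
  moreover have "t * (y / (1 - y)) \<le> 5 / 4 * k * t / n"
  proof -
    have "y / (1 - y) \<le> y / (37 / 38)" using y by (intro divide_left_mono) auto
    also have "\<dots> \<le> 5 / 4 * (real k / n)" 
    proof -
      have "20 / 19 * w / (37 / 38) \<le> 5 / 4 * w" if "0 \<le> w" for w :: real using that by simp
      moreover have "0 \<le> real k / real n" by simp
      ultimately show ?thesis unfolding y_def by blast
    qed
    finally have "t * (y / (1 - y)) \<le> t * (5 / 4 * (real k / n))" by (rule mult_left_mono) simp
    then show ?thesis by (simp add: mult_ac)
  qed
  ultimately have q: "exp (- (5 / 4 * k * t / n)) \<le> q"
    by (meson exp_le_cancel_iff neg_le_iff_le order_trans)
  have "measure_pmf.prob (uniform_perm ?C) {xs. \<forall>v\<in>{1..n}. \<exists>K\<in>set (take t xs). v \<in> verts K}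
      \<le> measure_pmf.prob (uniform_perm ?C) {xs. \<forall>v\<in>{1..n}. set (take t xs) \<inter> ?F v \<noteq> {}}"
  proof (rule prob_mono_on_support)
    fix xs assume "xs \<in> set_pmf (uniform_perm ?C)"
    note set_take_copies[OF this, of t]
    moreover assume "xs \<in> {xs. \<forall>v\<in>{1..n}. \<exists>K\<in>set (take t xs). v \<in> verts K}"
    ultimately show "xs \<in> {xs. \<forall>v\<in>{1..n}. set (take t xs) \<inter> ?F v \<noteq> {}}" by blast
  qed
  also have "\<dots> \<le> 1 / (real (card {1..n}) * q) + (exp (8 * c * t / card ?C) - 1)"
    unfolding q_def
  proof (rule prob_all_hit_le)
    show "?F v \<subseteq> ?C \<and> card (?F v) = a" if "v \<in> {1..n}" for v using card_F[OF that] by blast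
    show "real (card (?F u \<inter> ?F v)) \<le> c" if "u \<in> {1..n}" "v \<in> {1..n}" "u \<noteq> v" for u v
    proof -
      have "?F u \<inter> ?F v = {K \<in> ?C. u \<in> verts K \<and> v \<in> verts K}" by blast
      then show ?thesis using codegree_real[OF that] by (simp add: c_def)
    qed
    show "0 \<le> c" using n2 by (simp add: c_def)
    show "2 * t \<le> card ?C" using t by simp
    have "4 * real a \<le> ?N" using a_le N by linarith
    then show "4 * a \<le> card ?C" by linarith
    show "?C \<noteq> {}" by (rule copies_nonempty[OF kn])
  qed (use n2 in simp_all)
  also have "1 / (real (card {1..n}) * q) \<le> 1 / (n * exp (- (5 / 4 * k * t / n)))"
    using q n2 by (intro divide_left_mono mult_pos_pos less_le_trans[OF exp_gt_zero q]) (auto intro: mult_left_mono)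
  also have "\<dots> = exp (5 / 4 * k * t / n) / n" by (simp add: exp_minus field_simps)
  also have "8 * c * t / card ?C = 8 * real k ^ 2 * t / (real n * (real n - 1))"
  proof -
    have "8 * (K * M / d) * s / M = 8 * K * s / d" if "M > 0" for K M d s :: real
      using that by simp
    then show ?thesis unfolding c_def using N by blast
  qed
  finally show ?thesis by simp
qed

text \<open>Union bound over the first vertex and the chains starting there. For a fixed chain, its
  copies must appear by time \<open>m\<^sub>1\<close>, while by time \<open>m\<^sub>0\<close> at
  most \<open>20 * k\<close> further copies contain an end of it. The rate \<beta> is about
  \<open>2 * k / n\<close>, as two vertices have to be avoided almost entirely.\<close>

lemma prob_close_pair_le:
  assumes kn: "k \<le> n" and m: "m\<^sub>0 \<le> m\<^sub>1" "m\<^sub>1 \<le> card (copies H n)" "20 * k + 4 \<le> m\<^sub>0"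
  defines "\<beta> \<equiv> 2 * real k / n - real k ^ 2 / (real n * (real n - 1)) - (20 * real k + 4) / card (copies H n)"
  assumes \<beta>: "0 \<le> \<beta>"
  shows "measure_pmf.prob (uniform_perm (copies H n))
      {xs. \<exists>u\<in>{1..n}. \<exists>v\<in>{1..n}. u \<noteq> v \<and> hdeg (set (take m\<^sub>0 xs)) u < 10 * k \<and> hdeg (set (take m\<^sub>0 xs)) v < 10 * k
        \<and> (\<exists>Ks. distinct Ks \<and> set Ks \<subseteq> set (take m\<^sub>1 xs) \<and> length Ks \<le> 4 \<and> chain Ks u v)}
    \<le> n * (5 * (1 + real k ^ 2 * m\<^sub>1 / n) ^ 4)
      * ((20 * real k + 1) * (1 + 2 * real k * m\<^sub>1 / n) ^ (20 * k) * exp (- (\<beta> * (real m\<^sub>0 - 20 * real k - 4))))" (is "measure_pmf.prob _ ?B \<le> _")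
proof -
  let ?C = "copies H n"
  let ?N = "real (card ?C)"
  let ?V = "{1..n}"
  let ?p = "uniform_perm ?C"
  let ?P = "measure_pmf.prob ?p"
  let ?F = "\<lambda>v. {K \<in> ?C. v \<in> verts K}"
  let ?D = "20 * k"
  define Q where "Q = (20 * real k + 1) * (1 + 2 * real k * m\<^sub>1 / n) ^ (20 * k) * exp (- (\<beta> * (real m\<^sub>0 - 20 * real k - 4)))"
  define a where "a = card (?F 1)"
  have n2: "n \<ge> 2" using kn k_ge_2 by linarith
  have N: "0 < ?N" by (rule copies_pos[OF kn])
  have a: "real a = real k * ?N / n" unfolding a_def using n2 by (intro degree_real) simp
  have card_F: "card (?F v) = a" if "v \<in> ?V" for v using degree_real[OF that] a by simp
  have Q0: "0 \<le> Q" by (simp add: Q_def)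
  let ?ev = "\<lambda>Ks u v. {xs. set Ks \<subseteq> set (take m\<^sub>1 xs) \<and> card (set (take m\<^sub>0 xs) \<inter> (?F u \<union> ?F v - set Ks)) \<le> ?D}"
  have single: "?P (?ev Ks u v) \<le> (real m\<^sub>1 / ?N) ^ length Ks * Q"
    if uv: "u \<in> ?V" "v \<in> ?V" "u \<noteq> v" and Ks: "distinct Ks" "set Ks \<subseteq> ?C" "length Ks \<le> 4" for Ks u v
  proof -
    define f where "f = card (?F u \<union> ?F v - set Ks)"
    define j where "j = card (set Ks)"
    have j: "j = length Ks" "j \<le> 4" using Ks by (auto simp: j_def distinct_card)
    have "card (?F u) + card (?F v) = card (?F u \<union> ?F v) + card (?F u \<inter> ?F v)"
      by (rule card_Un_Int) simp_all
    moreover have "?F u \<inter> ?F v = {K \<in> ?C. u \<in> verts K \<and> v \<in> verts K}" by blast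
    ultimately have 1: "2 * a = card (?F u \<union> ?F v) + card {K \<in> ?C. u \<in> verts K \<and> v \<in> verts K}"
      using card_F uv by simp
    have 2: "card (?F u \<union> ?F v) \<le> f + j"
      unfolding f_def j_def using diff_card_le_card_Diff[of "set Ks" "?F u \<union> ?F v"] by simp
    have 3: "f \<le> card (?F u \<union> ?F v)" unfolding f_def by (intro card_mono) auto
    have f_le: "real f \<le> 2 * real a" using 1 3 by linarith
    \<comment> \<open>The families of the two ends have \<open>a\<close> elements each; the codegree
      bounds their overlap, and the chain takes away at most four copies. Subtracting the
      \<open>20 * k\<close> tolerated copies and dividing by \<open>?N\<close> yields
      \<beta>.\<close>
    have "2 * real a - real k ^ 2 * ?N / (real n * (real n - 1)) - 4 \<le> real f"
      using 1 2 j(2) codegree_real[OF uv] by linarith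
    then have "2 * (real k * ?N / n) - real k ^ 2 * ?N / (real n * (real n - 1)) - 4 - ?D \<le> real f - ?D"
      unfolding a by simp
    moreover have "2 * (real k * ?N / n) - real k ^ 2 * ?N / (real n * (real n - 1)) - 4 - ?D = \<beta> * ?N"
    proof -
      have "2 * (K * M / d) - K ^ 2 * M / e - 4 - D = (2 * K / d - K ^ 2 / e - (D + 4) / M) * M"
        if "M > 0" for K M d e D :: real
        using that by (simp add: left_diff_distrib)
      from this[OF N] show ?thesis unfolding \<beta>_def by simp
    qed
    ultimately have fD: "\<beta> * ?N \<le> real f - ?D" by simp
    then have "0 \<le> real f - ?D" using \<beta> N by (meson mult_nonneg_nonneg order_trans less_imp_le)
    then have "?D \<le> f" by linarith
    then have "?P (?ev Ks u v) \<le> (real m\<^sub>1 / ?N) ^ j * (real (?D + 1) * (1 + real f * (real m\<^sub>1 / ?N)) ^ ?D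
        * exp (- ((real f - ?D) / ?N * (real m\<^sub>0 - ?D - j))))"
      unfolding f_def j_def using Ks m copies_nonempty[OF kn] j(2)[unfolded j_def]
      by (intro prob_contain_few_le) auto
    also have "\<dots> \<le> (real m\<^sub>1 / ?N) ^ j * Q"
      unfolding Q_def
    proof (intro mult_left_mono mult_mono)
      have "real f * (real m\<^sub>1 / ?N) \<le> 2 * real a * (real m\<^sub>1 / ?N)"
        using f_le by (rule mult_right_mono) simp
      also have "\<dots> = 2 * real k * m\<^sub>1 / n"
      proof -
        have "2 * (K * M / d) * (s / M) = 2 * K * s / d" if "M > 0" for K M d s :: real
          using that by simp
        from this[OF N] show ?thesis unfolding a by blast
      qed
      finally show "(1 + real f * (real m\<^sub>1 / ?N)) ^ ?D \<le> (1 + 2 * real k * m\<^sub>1 / n) ^ ?D"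
        by (intro power_mono) auto
      have "\<beta> \<le> (real f - ?D) / ?N" using fD N by (simp add: pos_le_divide_eq)
      moreover have "0 \<le> real m\<^sub>0 - 20 * real k - 4" using m(3) by linarith
      moreover have "real m\<^sub>0 - 20 * real k - 4 \<le> real m\<^sub>0 - ?D - j" using j(2) by simp
      ultimately have "\<beta> * (real m\<^sub>0 - 20 * real k - 4) \<le> (real f - ?D) / ?N * (real m\<^sub>0 - ?D - j)"
        using \<beta> by (intro mult_mono) auto
      then show "exp (- ((real f - ?D) / ?N * (real m\<^sub>0 - ?D - j))) \<le> exp (- (\<beta> * (real m\<^sub>0 - 20 * real k - 4)))"
        by simp
    qed auto
    finally show ?thesis using j(1) by simp
  qed
  have paths: "finite (paths ?C u j)" "card (paths ?C u j) \<le> (a * k) ^ j" if "u \<in> ?V" for u j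
  proof -
    have "finite (paths ?C u j) \<and> card (paths ?C u j) \<le> (a * k) ^ j"
    proof (rule card_paths_le[where V = ?V])
      show "finite (verts K) \<and> card (verts K) \<le> k \<and> verts K \<subseteq> ?V" if "K \<in> ?C" for K
        using copy_verts[OF that] copy_card[OF that] copy_simple[OF that] by (simp add: simple_graph_def)
    qed (use card_F \<open>u \<in> ?V\<close> in simp_all)
    then show "finite (paths ?C u j)" "card (paths ?C u j) \<le> (a * k) ^ j" by auto
  qed
  let ?S = "\<lambda>u j. {p \<in> paths ?C u j. distinct (fst p) \<and> snd p \<in> ?V \<and> snd p \<noteq> u}"
  have finS: "finite (?S u j)" if "u \<in> ?V" for u j using paths(1)[OF that] by simp
  have "?P ?B
      \<le> ?P (\<Union>u\<in>?V. \<Union>j\<in>{..4}. \<Union>p\<in>?S u j. ?ev (fst p) u (snd p))"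
  proof (rule prob_mono_on_support)
    fix xs assume xs: "xs \<in> set_pmf ?p"
      "xs \<in> ?B"
    then obtain u v Ks where uv: "u \<in> ?V" "v \<in> ?V" "u \<noteq> v"
      and deg: "hdeg (set (take m\<^sub>0 xs)) u < 10 * k" "hdeg (set (take m\<^sub>0 xs)) v < 10 * k"
      and Ks: "distinct Ks" "set Ks \<subseteq> set (take m\<^sub>1 xs)" "length Ks \<le> 4" "chain Ks u v"
      by blast
    have "set Ks \<subseteq> ?C" using Ks(2) set_take_copies[OF xs(1)] by (rule order_trans)
    then have p: "(Ks, v) \<in> ?S u (length Ks)" using Ks uv by (simp add: paths_def)
    have "card (set (take m\<^sub>0 xs) \<inter> (?F u \<union> ?F v - set Ks))
        \<le> card ({K \<in> set (take m\<^sub>0 xs). u \<in> verts K} \<union> {K \<in> set (take m\<^sub>0 xs). v \<in> verts K})"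
      by (intro card_mono) auto
    also have "\<dots> \<le> hdeg (set (take m\<^sub>0 xs)) u + hdeg (set (take m\<^sub>0 xs)) v"
      unfolding hdeg_def by (rule card_Un_le)
    also have "\<dots> \<le> ?D" using deg by simp
    finally have "xs \<in> ?ev (fst (Ks, v)) u (snd (Ks, v))" using Ks(2) by simp
    then show "xs \<in> (\<Union>u\<in>?V. \<Union>j\<in>{..4}. \<Union>p\<in>?S u j. ?ev (fst p) u (snd p))"
      using Ks(3) by (intro UN_I[OF uv(1)] UN_I[of "length Ks"] UN_I[OF p]) simp_all
  qed
  also have "\<dots> \<le> (\<Sum>u\<in>?V. ?P (\<Union>j\<in>{..4}. \<Union>p\<in>?S u j. ?ev (fst p) u (snd p)))"
    by (rule prob_UN_le) simp
  also have "\<dots> \<le> (\<Sum>u\<in>?V. 5 * (1 + real k ^ 2 * m\<^sub>1 / n) ^ 4 * Q)"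
  proof (rule sum_mono)
    fix u assume u: "u \<in> ?V"
    have "?P (\<Union>j\<in>{..4}. \<Union>p\<in>?S u j. ?ev (fst p) u (snd p))
        \<le> (\<Sum>j\<in>{..4}. ?P (\<Union>p\<in>?S u j. ?ev (fst p) u (snd p)))"
      by (rule prob_UN_le) simp
    also have "\<dots> \<le> real (card {..4::nat}) * ((1 + real k ^ 2 * m\<^sub>1 / n) ^ 4 * Q)"
    proof (rule sum_bounded_above)
      fix j :: nat assume j: "j \<in> {..4}"
      have "?P (\<Union>p\<in>?S u j. ?ev (fst p) u (snd p)) \<le> (\<Sum>p\<in>?S u j. ?P (?ev (fst p) u (snd p)))"
        by (rule prob_UN_le[OF finS[OF u]])
      also have "\<dots> \<le> real (card (?S u j)) * ((real m\<^sub>1 / ?N) ^ j * Q)"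
      proof (rule sum_bounded_above)
        fix p assume p: "p \<in> ?S u j"
        then have "length (fst p) = j" "set (fst p) \<subseteq> ?C" unfolding paths_def by auto
        moreover have "u \<noteq> snd p" "snd p \<in> ?V" "distinct (fst p)" using p by auto
        ultimately show "?P (?ev (fst p) u (snd p)) \<le> (real m\<^sub>1 / ?N) ^ j * Q"
          using single[OF u, of "snd p" "fst p"] j by simp
      qed
      also have "\<dots> \<le> real ((a * k) ^ j) * ((real m\<^sub>1 / ?N) ^ j * Q)"
      proof (rule mult_right_mono)
        have "card (?S u j) \<le> card (paths ?C u j)" using paths(1)[OF u] by (intro card_mono) auto
        then show "real (card (?S u j)) \<le> real ((a * k) ^ j)"
          using paths(2)[OF u, of j] by (intro of_nat_mono) linarith
      qed (use Q0 in simp)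
      also have "\<dots> = (real a * k * (real m\<^sub>1 / ?N)) ^ j * Q"
        by (simp only: power_mult_distrib of_nat_power of_nat_mult mult.assoc)
      \<comment> \<open>The number of copies cancels between the count of chains and the probability
        of their presence; what remains per step is of logarithmic size.\<close>
      also have "real a * k * (real m\<^sub>1 / ?N) = real k ^ 2 * m\<^sub>1 / n"
      proof -
        have "K * M / d * K * (s / M) = K ^ 2 * s / d" if "M > 0" for K M d s :: real
          using that by (simp add: power2_eq_square)
        from this[OF N] show ?thesis unfolding a by blast
      qed
      also have "(real k ^ 2 * m\<^sub>1 / n) ^ j * Q \<le> (1 + real k ^ 2 * m\<^sub>1 / n) ^ 4 * Q"
      proof (rule mult_right_mono[OF _ Q0])
        have "(real k ^ 2 * m\<^sub>1 / n) ^ j \<le> (1 + real k ^ 2 * m\<^sub>1 / n) ^ j" by (intro power_mono) auto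
        also have "\<dots> \<le> (1 + real k ^ 2 * m\<^sub>1 / n) ^ 4" using j by (intro power_increasing) auto
        finally show "(real k ^ 2 * m\<^sub>1 / n) ^ j \<le> (1 + real k ^ 2 * m\<^sub>1 / n) ^ 4" .
      qed
      finally show "?P (\<Union>p\<in>?S u j. ?ev (fst p) u (snd p)) \<le> (1 + real k ^ 2 * m\<^sub>1 / n) ^ 4 * Q" .
    qed
    finally show "?P (\<Union>j\<in>{..4}. \<Union>p\<in>?S u j. ?ev (fst p) u (snd p)) \<le> 5 * (1 + real k ^ 2 * m\<^sub>1 / n) ^ 4 * Q"
      by (simp add: mult.assoc)
  qed
  also have "\<dots> = n * (5 * (1 + real k ^ 2 * m\<^sub>1 / n) ^ 4) * Q" by (simp add: mult.assoc)
  finally show ?thesis unfolding Q_def .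
qed

section \<open>The hitting times\<close>

text \<open>No copy has an isolated vertex, so lying on an edge and lying in a copy are the same;
  the hitting time can thus be read off the covering by copies.\<close>

lemma min_degree_motif_graph:
  assumes n: "n \<ge> 1" and sub: "set (take i xs) \<subseteq> copies H n"
  shows "1 \<le> min_degree (motif_graph n xs i) \<longleftrightarrow> (\<forall>v\<in>{1..n}. \<exists>K\<in>set (take i xs). v \<in> verts K)"
proof -
  let ?E = "\<Union>(edges ` set (take i xs))"
  have edge_sub: "e \<subseteq> verts K" if "K \<in> copies H n" "e \<in> edges K" for K e
    using copy_simple[OF that(1)] that(2) by (auto simp: simple_graph_def nsets_def)
  have "?E \<subseteq> Pow {1..n}"
  proof
    fix e assume "e \<in> ?E"
    then obtain K where K: "K \<in> set (take i xs)" "e \<in> edges K" by blast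
    then have "K \<in> copies H n" using sub by blast
    then show "e \<in> Pow {1..n}" using edge_sub[OF _ K(2)] copy_verts by blast
  qed
  then have finE: "finite ?E" by (rule finite_subset) simp
  have "1 \<le> min_degree (motif_graph n xs i) \<longleftrightarrow> (\<forall>v\<in>{1..n}. 1 \<le> degree (motif_graph n xs i) v)"
    using n by (simp add: min_degree_def motif_graph_def)
  also have "\<dots> \<longleftrightarrow> (\<forall>v\<in>{1..n}. \<exists>e\<in>?E. v \<in> e)"
  proof (rule ball_cong[OF refl])
    fix v
    define S where "S = {e \<in> ?E. v \<in> e}"
    have "finite S" unfolding S_def using finE by (rule rev_finite_subset) blast
    then have "1 \<le> card S \<longleftrightarrow> S \<noteq> {}" by (simp add: Suc_le_eq card_gt_0_iff)
    then show "1 \<le> degree (motif_graph n xs i) v \<longleftrightarrow> (\<exists>e\<in>?E. v \<in> e)"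
      unfolding degree_def motif_graph_def S_def snd_conv by blast
  qed
  also have "\<dots> \<longleftrightarrow> (\<forall>v\<in>{1..n}. \<exists>K\<in>set (take i xs). v \<in> verts K)"
  proof (intro ball_cong refl iffI)
    fix v assume "\<exists>e\<in>?E. v \<in> e"
    then obtain e K where eK: "K \<in> set (take i xs)" "e \<in> edges K" "v \<in> e" by blast
    then have "v \<in> verts K" using edge_sub[of K e] sub by blast
    then show "\<exists>K\<in>set (take i xs). v \<in> verts K" using eK(1) by blast
  next
    fix v assume "\<exists>K\<in>set (take i xs). v \<in> verts K"
    then obtain K where K: "K \<in> set (take i xs)" "v \<in> verts K" by blast
    then have "K \<in> copies H n" using sub by blast
    then obtain w where "{v, w} \<in> edges K"
      using ex_neighbour[OF copy_simple copy_no_isolated K(2)] by blast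
    then have "{v, w} \<in> ?E" using K(1) by blast
    then show "\<exists>e\<in>?E. v \<in> e" by blast
  qed
  finally show ?thesis .
qed

text \<open>The deterministic core. Being uncovered at \<open>m\<^sub>0\<close> and covered at
  \<open>m\<^sub>1\<close> places \<open>\<tau>\<^sub>1\<close> between the two, so lower bounds at
  \<open>m\<^sub>0\<close> and upper bounds at \<open>m\<^sub>1\<close> both apply to the graph at
  \<open>\<tau>\<^sub>1\<close>.\<close>

lemma hitting_times_eq:
  fixes r :: real
  assumes xs: "xs \<in> permutations_of_set (copies H n)" and n: "n \<ge> 1" "even n"
    and m: "m\<^sub>0 \<le> m\<^sub>1" "m\<^sub>1 \<le> card (copies H n)" and r: "16 * r \<le> real n"
    and uncovered: "\<not> (\<forall>v\<in>{1..n}. \<exists>K\<in>set (take m\<^sub>0 xs). v \<in> verts K)"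
    and covered: "\<forall>v\<in>{1..n}. \<exists>K\<in>set (take m\<^sub>1 xs). v \<in> verts K"
    and sparse: "\<And>X. X \<subseteq> {1..n} \<Longrightarrow> X \<noteq> {} \<Longrightarrow> real (card X) \<le> 5 * r \<Longrightarrow>
        card {K \<in> set (take m\<^sub>1 xs). 2 \<le> card (verts K \<inter> X)} < 2 * card X"
    and far: "\<And>u v Ks. u \<in> {1..n} \<Longrightarrow> v \<in> {1..n} \<Longrightarrow> u \<noteq> v \<Longrightarrow> hdeg (set (take m\<^sub>0 xs)) u < 10 * k \<Longrightarrow>
        hdeg (set (take m\<^sub>0 xs)) v < 10 * k \<Longrightarrow> distinct Ks \<Longrightarrow> set Ks \<subseteq> set (take m\<^sub>1 xs) \<Longrightarrow>
        length Ks \<le> 4 \<Longrightarrow> \<not> chain Ks u v"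
    and no_hole: "\<And>A T. A \<subseteq> {1..n} \<Longrightarrow> T \<subseteq> {1..n} \<Longrightarrow> A \<inter> T = {} \<Longrightarrow> r \<le> real (card A) \<Longrightarrow>
        card T \<le> 8 * card A \<Longrightarrow> 16 * (card A + card T) \<le> 15 * n \<Longrightarrow>
        \<exists>a\<in>A. \<exists>b\<in>{1..n} - A - T. {a, b} \<in> \<Union>(edges ` set (take m\<^sub>0 xs))"
  shows "\<tau>\<^sub>M n xs = \<tau>\<^sub>1 n xs"
proof -
  define cov where "cov = (\<lambda>i. \<forall>v\<in>{1..n}. \<exists>K\<in>set (take i xs). v \<in> verts K)"
  have len: "length xs = card (copies H n)"
    using length_finite_permutations_of_set[OF xs] .
  have setxs: "set xs = copies H n" using xs by (simp add: permutations_of_set_def)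
  have sub: "set (take i xs) \<subseteq> copies H n" for i
    using set_take_subset[of i xs] setxs by simp
  have cov: "1 \<le> min_degree (motif_graph n xs i) \<longleftrightarrow> cov i" for i
    unfolding cov_def by (rule min_degree_motif_graph[OF n(1) sub])
  define i where "i = \<tau>\<^sub>1 n xs"
  have i_eq: "i = (LEAST i. i \<le> length xs \<and> cov i)" unfolding i_def \<tau>\<^sub>1_def cov ..
  have m1: "m\<^sub>1 \<le> length xs \<and> cov m\<^sub>1" using m len covered by (simp add: cov_def)
  have i: "i \<le> length xs" "cov i" using LeastI[of "\<lambda>i. i \<le> length xs \<and> cov i", OF m1] by (simp_all add: i_eq)
  have i_least: "i \<le> j" if "j \<le> length xs" "cov j" for j
    unfolding i_eq using that by (intro Least_le) simp
  have im1: "i \<le> m\<^sub>1" using i_least m1 by blast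
  have im0: "m\<^sub>0 \<le> i"
  proof (rule ccontr)
    assume "\<not> m\<^sub>0 \<le> i"
    then have "set (take i xs) \<subseteq> set (take m\<^sub>0 xs)" by (intro set_take_subset_set_take) simp
    then have "cov m\<^sub>0" using i(2) unfolding cov_def by blast
    then show False using uncovered by (simp add: cov_def)
  qed
  let ?M = "set (take i xs)"
  let ?E = "\<Union>(edges ` ?M)"
  note M = set_take_subset_set_take[OF im0, of xs] set_take_subset_set_take[OF im1, of xs]
  have "matchable ?E {1..n}"
  proof (rule matchable_if_expanding[where r = r])
    show "even (card {1..n})" using n by simp
    show "card e = 2 \<and> e \<subseteq> {1..n}" if e: "e \<in> ?E" for e
    proof -
      obtain K where K: "K \<in> ?M" "e \<in> edges K" using e by blast
      then have "K \<in> copies H n" using sub by blast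
      note this = copy_simple[OF this] copy_verts[OF this]
      then show ?thesis using K(2) by (auto simp: simple_graph_def nsets_def)
    qed
    show "card A \<le> card (outer_nbhd ?E A)" if A: "A \<subseteq> {1..n}" "real (card A) \<le> r" for A
    proof (rule expansion_of_small_sets[where V = "{1..n}" and k = k and r = r, OF _ _ M])
      show "simple_graph K \<and> no_isolated_vertices K \<and> card (verts K) = k \<and> verts K \<subseteq> {1..n}"
        if "K \<in> set (take m\<^sub>1 xs)" for K
      proof -
        have "K \<in> copies H n" using sub that by blast
        then show ?thesis using copy_props by blast
      qed
      show "\<exists>K\<in>?M. v \<in> verts K" if "v \<in> {1..n}" for v using i(2) that unfolding cov_def by blast
    qed (fact finite_set finite_atLeastAtMost sparse far A)+
    show "\<exists>a\<in>A. \<exists>b\<in>{1..n} - A - T. {a, b} \<in> ?E"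
      if "A \<subseteq> {1..n}" "T \<subseteq> {1..n}" "A \<inter> T = {}" "r \<le> real (card A)" "card T \<le> 8 * card A"
        "16 * (card A + card T) \<le> 15 * card {1..n}" for A T
    proof -
      have "\<exists>a\<in>A. \<exists>b\<in>{1..n} - A - T. {a, b} \<in> \<Union>(edges ` set (take m\<^sub>0 xs))"
        using that by (intro no_hole) simp_all
      then show ?thesis using M(1) by blast
    qed
    show "16 * r \<le> real (card {1..n})" using r by simp
  qed simp
  then have pm: "has_perfect_matching (motif_graph n xs i)"
    unfolding matchable_def has_perfect_matching_def motif_graph_def by auto
  \<comment> \<open>The trivial inequality between the hitting times: a perfect matching covers
    every vertex.\<close>
  have cov_pm: "cov j" if j: "has_perfect_matching (motif_graph n xs j)" for j
  proof -
    obtain F where F: "F \<subseteq> \<Union>(edges ` set (take j xs))" "\<forall>v\<in>{1..n}. \<exists>!e. e \<in> F \<and> v \<in> e"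
      using j unfolding has_perfect_matching_def motif_graph_def by auto
    show ?thesis
      unfolding cov_def
    proof
      fix v assume "v \<in> {1..n}"
      then obtain e where "e \<in> F" "v \<in> e" using F(2) by blast
      then obtain K where K: "K \<in> set (take j xs)" "e \<in> edges K" using F(1) by blast
      then have "K \<in> copies H n" using sub by blast
      then have "e \<subseteq> verts K" using copy_simple[of K n] K(2) by (auto simp: simple_graph_def nsets_def)
      then show "\<exists>K\<in>set (take j xs). v \<in> verts K" using K(1) \<open>v \<in> e\<close> by blast
    qed
  qed
  have "\<tau>\<^sub>M n xs = i"
    unfolding \<tau>\<^sub>M_def
  proof (rule Least_equality)
    show "i \<le> length xs \<and> has_perfect_matching (motif_graph n xs i)" using i pm by simp
    show "i \<le> j" if "j \<le> length xs \<and> has_perfect_matching (motif_graph n xs j)" for j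
      using that i_least cov_pm by blast
  qed
  then show ?thesis by (simp add: i_def)
qed

lemma prob_hitting_times_eq_ge:
  fixes r :: real
  assumes n: "n \<ge> 1" "even n" and m: "m\<^sub>0 \<le> m\<^sub>1" "m\<^sub>1 \<le> card (copies H n)" and r: "16 * r \<le> real n"
  defines "P \<equiv> measure_pmf.prob (uniform_perm (copies H n))"
  assumes e1: "P {xs. \<forall>v\<in>{1..n}. \<exists>K\<in>set (take m\<^sub>0 xs). v \<in> verts K} \<le> e\<^sub>1" (is "P ?B1 \<le> _")
    and e2: "P {xs. \<exists>v\<in>{1..n}. \<forall>K\<in>set (take m\<^sub>1 xs). v \<notin> verts K} \<le> e\<^sub>2" (is "P ?B2 \<le> _")
    and e3: "P {xs. \<exists>X. X \<subseteq> {1..n} \<and> X \<noteq> {} \<and> real (card X) \<le> 5 * r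
        \<and> 2 * card X \<le> card {K \<in> set (take m\<^sub>1 xs). 2 \<le> card (verts K \<inter> X)}} \<le> e\<^sub>3" (is "P ?B3 \<le> _")
    and e4: "P {xs. \<exists>A T. A \<subseteq> {1..n} \<and> T \<subseteq> {1..n} \<and> A \<inter> T = {} \<and> r \<le> real (card A) \<and> card T \<le> 8 * card A
        \<and> 16 * (card A + card T) \<le> 15 * n
        \<and> \<not> (\<exists>a\<in>A. \<exists>b\<in>{1..n} - A - T. {a, b} \<in> \<Union>(edges ` set (take m\<^sub>0 xs)))} \<le> e\<^sub>4" (is "P ?B4 \<le> _")
    and e5: "P {xs. \<exists>u\<in>{1..n}. \<exists>v\<in>{1..n}. u \<noteq> v \<and> hdeg (set (take m\<^sub>0 xs)) u < 10 * k \<and> hdeg (set (take m\<^sub>0 xs)) v < 10 * k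
        \<and> (\<exists>Ks. distinct Ks \<and> set Ks \<subseteq> set (take m\<^sub>1 xs) \<and> length Ks \<le> 4 \<and> chain Ks u v)} \<le> e\<^sub>5" (is "P ?B5 \<le> _")
  shows "1 - (e\<^sub>1 + e\<^sub>2 + e\<^sub>3 + e\<^sub>4 + e\<^sub>5) \<le> measure_pmf.prob (motif_process H n) {xs. \<tau>\<^sub>M n xs = \<tau>\<^sub>1 n xs}"
proof -
  have proc: "motif_process H n = uniform_perm (copies H n)"
    by (rule motif_process_eq) simp
  let ?G = "{xs. \<tau>\<^sub>M n xs = \<tau>\<^sub>1 n xs}"
  define B1 where "B1 = ?B1"
  define B2 where "B2 = ?B2"
  define B3 where "B3 = ?B3"
  define B4 where "B4 = ?B4"
  define B5 where "B5 = ?B5"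
  have "1 = P UNIV" by (simp add: P_def)
  also have "\<dots> \<le> P (?G \<union> (B1 \<union> (B2 \<union> (B3 \<union> (B4 \<union> B5)))))"
    unfolding P_def
  proof (rule prob_mono_on_support)
    fix xs assume "xs \<in> set_pmf (uniform_perm (copies H n))"
    then have xs: "xs \<in> permutations_of_set (copies H n)" by (simp only: set_uniform_perm_copies)
    show "xs \<in> ?G \<union> (B1 \<union> (B2 \<union> (B3 \<union> (B4 \<union> B5))))"
    proof (cases "xs \<in> B1 \<or> xs \<in> B2 \<or> xs \<in> B3 \<or> xs \<in> B4 \<or> xs \<in> B5")
      case False
      then have "xs \<notin> B1" "xs \<notin> B2" "xs \<notin> B3" "xs \<notin> B4" "xs \<notin> B5" by simp_all
      have "\<tau>\<^sub>M n xs = \<tau>\<^sub>1 n xs"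
      proof (rule hitting_times_eq[OF xs n m r])
        show "\<not> (\<forall>v\<in>{1..n}. \<exists>K\<in>set (take m\<^sub>0 xs). v \<in> verts K)" using \<open>xs \<notin> B1\<close> by (simp add: B1_def)
        show "\<forall>v\<in>{1..n}. \<exists>K\<in>set (take m\<^sub>1 xs). v \<in> verts K" using \<open>xs \<notin> B2\<close> unfolding B2_def by blast
        show "card {K \<in> set (take m\<^sub>1 xs). 2 \<le> card (verts K \<inter> X)} < 2 * card X"
          if "X \<subseteq> {1..n}" "X \<noteq> {}" "real (card X) \<le> 5 * r" for X
          using \<open>xs \<notin> B3\<close> that unfolding B3_def mem_Collect_eq not_ex not_less[symmetric] by blast
        show "\<not> chain Ks u v" if "u \<in> {1..n}" "v \<in> {1..n}" "u \<noteq> v" "hdeg (set (take m\<^sub>0 xs)) u < 10 * k"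
          "hdeg (set (take m\<^sub>0 xs)) v < 10 * k" "distinct Ks" "set Ks \<subseteq> set (take m\<^sub>1 xs)" "length Ks \<le> 4" for u v Ks
          using \<open>xs \<notin> B5\<close> that unfolding B5_def by blast
        show "\<exists>a\<in>A. \<exists>b\<in>{1..n} - A - T. {a, b} \<in> \<Union>(edges ` set (take m\<^sub>0 xs))"
          if "A \<subseteq> {1..n}" "T \<subseteq> {1..n}" "A \<inter> T = {}" "r \<le> real (card A)" "card T \<le> 8 * card A"
            "16 * (card A + card T) \<le> 15 * n" for A T
          using \<open>xs \<notin> B4\<close> that unfolding B4_def mem_Collect_eq by blast
      qed
      then show ?thesis by simp
    qed auto
  qed
  also have "\<dots> \<le> P ?G + (P B1 + (P B2 + (P B3 + (P B4 + P B5))))"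
  proof -
    have Un: "P (X \<union> Y) \<le> P X + P Y" for X Y
      unfolding P_def by (rule measure_Un_le) simp_all
    show ?thesis by (intro order_trans[OF Un] add_left_mono order_refl)
  qed
  also have "\<dots> \<le> P ?G + (e\<^sub>1 + (e\<^sub>2 + (e\<^sub>3 + (e\<^sub>4 + e\<^sub>5))))"
    using e1 e2 e3 e4 e5 unfolding B1_def B2_def B3_def B4_def B5_def by (intro add_mono order_refl)
  finally show ?thesis unfolding proc P_def by linarith
qed

text \<open>Inserts the parameters. The five error terms belong, in order, to no isolated vertex at
  \<open>m\<^sub>0\<close>, an isolated vertex at \<open>m\<^sub>1\<close>, a dense set, a hole, and
  two small vertices close together. The side conditions \<open>f1\<close> to \<open>f9\<close> hold
  for all large \<open>n\<close>.\<close>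

lemma prob_hitting_times_eq_ge_explicit:
  fixes n :: nat and L K c d :: real
  defines "L \<equiv> ln (real n)" and "K \<equiv> real k"
  defines "c \<equiv> 2 * K ^ 2 + (20 * K + 4) * (4 * real m)" and "d \<equiv> 20 * K + 5"
  assumes ev: "even n" and f1: "40 * k \<le> n" and f2: "3 \<le> L" and f3: "1 \<le> n * L / K"
    and f4: "3 * real n * L / K \<le> real n * (real n - 1) / (40 * real m)"
    and f5: "n * L / (2 * K) \<le> 2 / 3 * real n * L / K - 1"
    and f6: "0 \<le> 2 / 3 * real n * L / K - d" and f7: "0 \<le> 2 * K / n - c / real n ^ 2"
    and f8: "45 * exp 3 * K ^ 2 / L \<le> 1 / 2" and f9: "exp (- (L / (16 * K))) * L ^ 27 \<le> 1"
  shows "1 - ((exp (5 / 6 * L) / n + (exp (16 / 3 * K * L / (real n - 1)) - 1)) + 1 / n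
      + 2 * (45 * exp 3 * K ^ 2 / L) + exp (2 * real n / L ^ 3 + (n / L ^ 3) * (27 * ln L - L / (16 * K)))
      + real n * (5 * (1 + 3 * K * L) ^ 4) * ((20 * K + 1) * (1 + 6 * L) powr (20 * K)
          * exp (- ((2 * K / n - c / real n ^ 2) * (2 / 3 * real n * L / K - d)))))
    \<le> measure_pmf.prob (motif_process H n) {xs. \<tau>\<^sub>M n xs = \<tau>\<^sub>1 n xs}"
proof -
  let ?N = "real (card (copies H n))"
  define m\<^sub>0 where "m\<^sub>0 = nat \<lfloor>2 / 3 * real n * L / K\<rfloor>"
  define m\<^sub>1 where "m\<^sub>1 = nat \<lceil>2 * real n * L / K\<rceil>"
  have K: "2 \<le> K" using k_ge_2 by (simp add: K_def)
  have kn: "k \<le> n" and n80: "80 \<le> n" using f1 k_ge_2 by linarith+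
  have n: "0 < real n" "1 < real n" using n80 by simp_all
  have N: "0 < ?N" by (rule copies_pos[OF kn])
  define w where "w = n * L / K"
  have w: "0 \<le> w" "1 \<le> w" using f3 by (simp_all add: w_def)
  have w_mult: "2 / 3 * real n * L / K = 2 / 3 * w" "2 * real n * L / K = 2 * w" "3 * real n * L / K = 3 * w"
    "n * L / (2 * K) = w / 2" by (simp_all add: w_def)
  have m0: "real m\<^sub>0 \<le> 2 / 3 * w" "2 / 3 * w - 1 \<le> real m\<^sub>0"
  proof -
    have "real m\<^sub>0 = of_int \<lfloor>2 / 3 * w\<rfloor>" using w unfolding m\<^sub>0_def w_mult by simp
    then show "real m\<^sub>0 \<le> 2 / 3 * w" "2 / 3 * w - 1 \<le> real m\<^sub>0"
      using floor_correct[of "2 / 3 * w"] by linarith+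
  qed
  \<comment> \<open>Rounding up costs less than 1, which \<open>w\<close> dominates by
    \<open>f3\<close>.\<close>
  have m1: "2 * w \<le> real m\<^sub>1" "real m\<^sub>1 \<le> 3 * w"
  proof -
    have "real m\<^sub>1 = of_int \<lceil>2 * w\<rceil>" using w unfolding m\<^sub>1_def w_mult by simp
    then show "2 * w \<le> real m\<^sub>1" "real m\<^sub>1 \<le> 3 * w"
      using ceiling_correct[of "2 * w"] w by linarith+
  qed
  have N_ge: "real n * (real n - 1) / (2 * real m) \<le> ?N"
  proof -
    have "real (n * (n - 1)) \<le> real (2 * m * card (copies H n))"
      using card_copies_ge[OF kn] by (rule of_nat_mono)
    then show ?thesis using m_pos n by (simp add: of_nat_diff field_simps)
  qed
  have "20 * (3 * w) \<le> ?N"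
  proof -
    have "20 * (3 * w) \<le> 20 * (real n * (real n - 1) / (40 * real m))" using f4 unfolding w_mult by simp
    also have "\<dots> = real n * (real n - 1) / (2 * real m)" by simp
    finally show ?thesis using N_ge by linarith
  qed
  then have m1N: "20 * m\<^sub>1 \<le> card (copies H n)" using m1(2) by linarith
  have m01: "m\<^sub>0 \<le> m\<^sub>1" using m0 m1 w by linarith
  have m0N: "20 * m\<^sub>0 \<le> card (copies H n)" and m1N': "m\<^sub>1 \<le> card (copies H n)"
    and m0N': "m\<^sub>0 \<le> card (copies H n)" using m1N m01 by linarith+
  have Kw: "K * w / n = L" using K n by (simp add: w_def)
  have L3: "27 \<le> L ^ 3" using power_mono[OF f2, of 3] by simp
  \<comment> \<open>Sparsity needs r (ln n)^2 / n to vanish, whereas the absence of holes favours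
    large \<open>r\<close>. With the cube of the logarithm the first quantity is of order 1 /
    \<open>L\<close>.\<close>
  define r where "r = n / L ^ 3"
  have r: "0 \<le> r" "16 * r \<le> real n"
  proof -
    have L3': "0 < L ^ 3" using L3 by linarith
    then show "0 \<le> r" unfolding r_def by simp
    have "16 * real n \<le> real n * L ^ 3"
      using mult_left_mono[OF L3, of "real n"] n by linarith
    then show "16 * r \<le> real n" unfolding r_def using L3' by (simp add: pos_divide_le_eq)
  qed
  show ?thesis
  proof (rule prob_hitting_times_eq_ge[OF _ ev m01 m1N' r(2)])
    show "1 \<le> n" using n80 by simp
    let ?P = "measure_pmf.prob (uniform_perm (copies H n))"
    show "?P {xs. \<forall>v\<in>{1..n}. \<exists>K\<in>set (take m\<^sub>0 xs). v \<in> verts K}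
        \<le> exp (5 / 6 * L) / n + (exp (16 / 3 * K * L / (real n - 1)) - 1)"
    proof (rule order_trans[OF prob_all_covered_le[OF f1 m0N]])
      have "5 / 4 * K * m\<^sub>0 / n \<le> 5 / 4 * K * (2 / 3 * w) / n"
        using m0 K n by (intro divide_right_mono mult_left_mono) auto
      also have "\<dots> = 5 / 6 * (K * w / n)" by simp
      finally have 1: "5 / 4 * K * m\<^sub>0 / n \<le> 5 / 6 * L" unfolding Kw .
      have "8 * K ^ 2 * m\<^sub>0 / (real n * (real n - 1)) \<le> 8 * K ^ 2 * (2 / 3 * w) / (real n * (real n - 1))"
        using m0 n by (intro divide_right_mono mult_left_mono) auto
      also have "\<dots> = 16 / 3 * K * (K * w / n) / (real n - 1)" by (simp add: power2_eq_square)
      finally have 2: "8 * K ^ 2 * m\<^sub>0 / (real n * (real n - 1)) \<le> 16 / 3 * K * L / (real n - 1)" unfolding Kw .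
      show "exp (5 / 4 * k * m\<^sub>0 / n) / n + (exp (8 * real k ^ 2 * m\<^sub>0 / (real n * (real n - 1))) - 1)
          \<le> exp (5 / 6 * L) / n + (exp (16 / 3 * K * L / (real n - 1)) - 1)"
        using 1 2 unfolding K_def
        by (intro add_mono divide_right_mono diff_right_mono) (simp_all only: exp_le_cancel_iff of_nat_0_le_iff)
    qed
    show "?P {xs. \<exists>v\<in>{1..n}. \<forall>K\<in>set (take m\<^sub>1 xs). v \<notin> verts K} \<le> 1 / n"
    proof (rule order_trans[OF prob_isolated_le[OF kn m1N']])
      have "2 * (K * w / n) = K * (2 * w) / n" by simp
      also have "\<dots> \<le> K * m\<^sub>1 / n" using m1 K n by (intro divide_right_mono mult_left_mono) auto
      finally have "2 * L \<le> K * m\<^sub>1 / n" unfolding Kw .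
      then have "n * exp (- (real k * m\<^sub>1 / n)) \<le> n * exp (- (2 * L))"
        unfolding K_def by (intro mult_left_mono) simp_all
      also have "exp (- (2 * L)) = 1 / (real n * real n)"
      proof -
        have "exp (2 * L) = exp L * exp L" by (simp add: exp_add[symmetric])
        then show ?thesis using n by (simp add: L_def exp_minus divide_inverse)
      qed
      also have "n * (1 / (real n * real n)) = 1 / n" using n by simp
      finally show "n * exp (- (real k * m\<^sub>1 / n)) \<le> 1 / n" .
    qed
    have y_le: "exp 3 * real k ^ 4 * (5 * r) * real m\<^sub>1 ^ 2 / real n ^ 3 \<le> 45 * exp 3 * K ^ 2 / L"
    proof -
      have "exp 3 * real k ^ 4 * (5 * r) * real m\<^sub>1 ^ 2 / real n ^ 3
          \<le> exp 3 * real k ^ 4 * (5 * r) * (3 * w) ^ 2 / real n ^ 3"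
        using m1 r by (intro divide_right_mono mult_left_mono power_mono) auto
      also have "\<dots> = 45 * exp 3 * K ^ 2 / L"
      proof -
        have "e * K ^ 4 * (5 * (n / L ^ 3)) * (3 * (n * L / K)) ^ 2 / n ^ 3 = 45 * e * K ^ 2 / L"
          if "n > 0" "L > 0" "K > 0" for e K n L :: real
          using that by (simp add: power2_eq_square power3_eq_cube power4_eq_xxxx field_simps)
        from this[of "real n" L K "exp 3"] n f2 K show ?thesis by (simp add: r_def w_def K_def)
      qed
      finally show ?thesis .
    qed
    show "?P {xs. \<exists>X. X \<subseteq> {1..n} \<and> X \<noteq> {} \<and> real (card X) \<le> 5 * r
        \<and> 2 * card X \<le> card {K \<in> set (take m\<^sub>1 xs). 2 \<le> card (verts K \<inter> X)}}
        \<le> 2 * (45 * exp 3 * K ^ 2 / L)"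
      using prob_dense_set_le[OF kn m1N', of "5 * r"] y_le f8 r(1) by linarith
    show "?P {xs. \<exists>A T. A \<subseteq> {1..n} \<and> T \<subseteq> {1..n} \<and> A \<inter> T = {} \<and> r \<le> real (card A) \<and> card T \<le> 8 * card A
        \<and> 16 * (card A + card T) \<le> 15 * n
        \<and> \<not> (\<exists>a\<in>A. \<exists>b\<in>{1..n} - A - T. {a, b} \<in> \<Union>(edges ` set (take m\<^sub>0 xs)))}
        \<le> exp (2 * real n / L ^ 3 + (n / L ^ 3) * (27 * ln L - L / (16 * K)))" (is "measure_pmf.prob _ ?B \<le> _")
    proof -
      \<comment> \<open>With this weight the total mass \<open>exp (2 * x * n)\<close> is
        \<open>exp (2 * r)\<close>, which \<open>z powr r\<close> outweighs for large
        \<open>n\<close>. The exponent 27 in \<open>z\<close> is 9 times 3, from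
        \<open>x ^ 9\<close>.\<close>
      define x where "x = 1 / L ^ 3"
      define z where "z = exp (- (L / (16 * K))) * L ^ 27"
      have L0: "0 < L" using f2 by linarith
      have x: "0 < x" "x \<le> 1" using L3 L0 by (simp_all add: x_def)
      have "w / 2 \<le> real m\<^sub>0" using f5 m0 unfolding w_mult by linarith
      then have "w / 2 / (8 * real n) \<le> real m\<^sub>0 / (8 * real n)" using n by (intro divide_right_mono) auto
      moreover have "w / 2 / (8 * real n) = L / (16 * K)" using n K by (simp add: w_def)
      ultimately have "exp (- (real m\<^sub>0 / (8 * real n))) \<le> exp (- (L / (16 * K)))" by simp
      moreover have "x ^ 9 = 1 / L ^ 27" by (simp add: x_def power_divide power_mult[symmetric])
      ultimately have zz: "exp (- (real m\<^sub>0 / (8 * real n))) / x ^ 9 \<le> z"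
        using L0 by (simp add: z_def mult_right_mono)
      then have z1: "exp (- (real m\<^sub>0 / (8 * real n))) / x ^ 9 \<le> 1" using f9 unfolding z_def by linarith
      have "?P ?B
        \<le> exp (2 * x * n) * (exp (- (real m\<^sub>0 / (8 * real n))) / x ^ 9) powr r"
        by (rule prob_hole_le[OF kn m0N' x r(1) z1])
      also have "\<dots> \<le> exp (2 * x * n) * z powr r"
        using zz x r(1) by (intro mult_left_mono powr_mono2) auto
      also have "z powr r = exp (r * (27 * ln L - L / (16 * K)))"
      proof -
        have "ln z = 27 * ln L - L / (16 * K)" unfolding z_def using L0 by (simp add: ln_mult ln_realpow)
        moreover have "0 < z" using L0 by (simp add: z_def)
        ultimately show ?thesis by (simp add: powr_def)
      qed
      also have "exp (2 * x * n) * exp (r * (27 * ln L - L / (16 * K)))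
          = exp (2 * real n / L ^ 3 + (n / L ^ 3) * (27 * ln L - L / (16 * K)))"
        by (simp add: exp_add[symmetric] x_def r_def)
      finally show ?thesis .
    qed
    show "?P {xs. \<exists>u\<in>{1..n}. \<exists>v\<in>{1..n}. u \<noteq> v \<and> hdeg (set (take m\<^sub>0 xs)) u < 10 * k \<and> hdeg (set (take m\<^sub>0 xs)) v < 10 * k
        \<and> (\<exists>Ks. distinct Ks \<and> set Ks \<subseteq> set (take m\<^sub>1 xs) \<and> length Ks \<le> 4 \<and> chain Ks u v)}
        \<le> n * (5 * (1 + 3 * K * L) ^ 4) * ((20 * K + 1) * (1 + 6 * L) powr (20 * K)
          * exp (- ((2 * K / n - c / real n ^ 2) * (2 / 3 * real n * L / K - d))))" (is "measure_pmf.prob _ ?B \<le> _")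
    proof -
      define \<beta> where "\<beta> = 2 * real k / n - real k ^ 2 / (real n * (real n - 1)) - (20 * real k + 4) / card (copies H n)"
      have nn: "1 / (real n * (real n - 1)) \<le> 2 / real n ^ 2"
      proof -
        have "real n ^ 2 \<le> 2 * (real n * (real n - 1))"
        proof -
          have "real n * 2 \<le> real n * real n" using n80 by (intro mult_left_mono) auto
          then show ?thesis by (simp add: power2_eq_square algebra_simps)
        qed
        then show ?thesis using n by (simp add: divide_simps)
      qed
      have "K ^ 2 * (1 / (real n * (real n - 1))) \<le> K ^ 2 * (2 / real n ^ 2)"
        using nn by (intro mult_left_mono) auto
      moreover have "(20 * K + 4) * (1 / ?N) \<le> (20 * K + 4) * (4 * real m / real n ^ 2)"
      proof (rule mult_left_mono)
        have "1 / ?N \<le> 2 * real m / (real n * (real n - 1))"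
          using inverse_card_copies_le[OF kn] by simp
        also have "\<dots> = 2 * real m * (1 / (real n * (real n - 1)))" by simp
        also have "\<dots> \<le> 2 * real m * (2 / real n ^ 2)" using nn by (intro mult_left_mono) auto
        finally show "1 / ?N \<le> 4 * real m / real n ^ 2" by simp
      qed (use K in simp)
      \<comment> \<open>\<open>c\<close> collects the two corrections in \<beta>, after replacing 1
        / (n (n - 1)) by 2 / n^2.\<close>
      moreover have "c / real n ^ 2 = K ^ 2 * (2 / real n ^ 2) + (20 * K + 4) * (4 * real m / real n ^ 2)"
        by (simp add: c_def add_divide_distrib)
      ultimately have \<beta>: "2 * K / n - c / real n ^ 2 \<le> \<beta>" unfolding \<beta>_def K_def by simp
      \<comment> \<open>\<open>d\<close> exceeds \<open>20 * K + 4\<close> by 1 to allow for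
        rounding \<open>m\<^sub>0\<close> down.\<close>
      have s: "2 / 3 * real n * L / K - d \<le> real m\<^sub>0 - 20 * real k - 4"
      proof -
        have "2 / 3 * real n * L / K - d = 2 / 3 * w - (20 * real k + 5)"
          unfolding w_mult d_def by (simp add: K_def)
        then show ?thesis using m0(2) by linarith
      qed
      have "20 * k + 4 \<le> m\<^sub>0" using f6 s by linarith
      have m1n: "K * m\<^sub>1 / n \<le> 3 * L"
      proof -
        have "K * m\<^sub>1 / n \<le> K * (3 * w) / n" using m1 K n by (intro divide_right_mono mult_left_mono) auto
        also have "\<dots> = 3 * (K * w / n)" by simp
        finally show ?thesis unfolding Kw .
      qed
      have "?P ?B
        \<le> n * (5 * (1 + real k ^ 2 * m\<^sub>1 / n) ^ 4)
      * ((20 * real k + 1) * (1 + 2 * real k * m\<^sub>1 / n) ^ (20 * k) * exp (- (\<beta> * (real m\<^sub>0 - 20 * real k - 4))))"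
        unfolding \<beta>_def
        by (rule prob_close_pair_le[OF kn m01 m1N' \<open>20 * k + 4 \<le> m\<^sub>0\<close>])
          (use f7 \<beta> in \<open>unfold \<beta>_def, linarith\<close>)
      also have "\<dots> \<le> n * (5 * (1 + 3 * K * L) ^ 4) * ((20 * K + 1) * (1 + 6 * L) powr (20 * K)
          * exp (- ((2 * K / n - c / real n ^ 2) * (2 / 3 * real n * L / K - d))))"
      proof (intro mult_mono)
        have "real k ^ 2 * m\<^sub>1 / n = K * (K * m\<^sub>1 / n)" by (simp add: K_def power2_eq_square)
        also have "\<dots> \<le> K * (3 * L)" using m1n K by (intro mult_left_mono) auto
        finally show "(1 + real k ^ 2 * m\<^sub>1 / n) ^ 4 \<le> (1 + 3 * K * L) ^ 4" by (intro power_mono) auto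
        have "2 * real k * m\<^sub>1 / n \<le> 6 * L" using m1n by (simp add: K_def)
        then have "(1 + 2 * real k * m\<^sub>1 / n) ^ (20 * k) \<le> (1 + 6 * L) ^ (20 * k)" by (intro power_mono) auto
        \<comment> \<open>A real exponent turns the bound into an expression in the real parameter
          \<open>K\<close> alone, ready for the asymptotic analysis.\<close>
        also have "\<dots> = (1 + 6 * L) powr real (20 * k)" using f2 by (intro powr_realpow[symmetric]) linarith
        finally show "(1 + 2 * real k * m\<^sub>1 / n) ^ (20 * k) \<le> (1 + 6 * L) powr (20 * K)" by (simp add: K_def)
        have "(2 * K / n - c / real n ^ 2) * (2 / 3 * real n * L / K - d) \<le> \<beta> * (real m\<^sub>0 - 20 * real k - 4)"
          using \<beta> s f6 f7 by (intro mult_mono) linarith+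
        then show "exp (- (\<beta> * (real m\<^sub>0 - 20 * real k - 4))) \<le> exp (- ((2 * K / n - c / real n ^ 2) * (2 / 3 * real n * L / K - d)))"
          by simp
      qed (use K f2 in \<open>simp_all add: K_def\<close>)
      finally show ?thesis .
    qed
  qed
qed

end

section \<open>Asymptotics of the error terms\<close>

theorem theorem5:
  fixes H :: "'a ugraph"
  assumes "simple_graph H"
    and "verts H \<noteq> {}"
    and "no_isolated_vertices H"
  shows "((\<lambda>n. measure_pmf.prob (motif_process H n) {Hs. \<tau>\<^sub>M n Hs = \<tau>\<^sub>1 n Hs}) \<longlongrightarrow> 1)
           (inf at_top (principal {n. even n}))"
proof -
  interpret motif H using assms by unfold_locales
  define K where "K = real k"
  define c where "c = 2 * K ^ 2 + (20 * K + 4) * (4 * real m)"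
  define d where "d = 20 * K + 5"
  define g where "g = 40 * real m"
  have K: "K > 0" and g: "g > 0" using k_ge_2 m_pos by (simp_all add: K_def g_def)
  let ?err = "\<lambda>n::nat. (exp (5 / 6 * ln n) / n + (exp (16 / 3 * K * ln n / (real n - 1)) - 1)) + 1 / n
      + 2 * (45 * exp 3 * K ^ 2 / ln n)
      + exp (2 * real n / ln n ^ 3 + (n / ln n ^ 3) * (27 * ln (ln n) - ln n / (16 * K)))
      + real n * (5 * (1 + 3 * K * ln n) ^ 4) * ((20 * K + 1) * (1 + 6 * ln n) powr (20 * K)
          * exp (- ((2 * K / n - c / real n ^ 2) * (2 / 3 * real n * ln n / K - d))))"
  \<comment> \<open>The first summand is n^(-1/6), the reciprocal of a lower bound for the expected
    number of isolated vertices.\<close>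
  have "(\<lambda>n::nat. exp (5 / 6 * ln n) / n + (exp (16 / 3 * K * ln n / (real n - 1)) - 1)) \<longlonglongrightarrow> 0"
    using K by real_asymp
  moreover have "(\<lambda>n::nat. 1 / real n) \<longlonglongrightarrow> 0" by real_asymp
  moreover have "(\<lambda>n::nat. 2 * (45 * exp 3 * K ^ 2 / ln n)) \<longlonglongrightarrow> 0"
    using K by real_asymp
  \<comment> \<open>The dominant part of the exponent is - n / (16 K (ln n)^2); the other two are
    smaller by factors of order ln n and ln n / ln (ln n).\<close>
  moreover have "(\<lambda>n::nat. exp (2 * real n / ln n ^ 3 + (n / ln n ^ 3) * (27 * ln (ln n) - ln n / (16 * K)))) \<longlonglongrightarrow> 0"
    using K by real_asymp
  \<comment> \<open>The leading product in the exponent is (2 K / n) (2 n ln n / (3 K)) = (4/3) ln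
    n, so the whole term is n^(-1/3) up to powers of ln n.\<close>
  moreover have "(\<lambda>n::nat. real n * (5 * (1 + 3 * K * ln n) ^ 4) * ((20 * K + 1) * (1 + 6 * ln n) powr (20 * K)
      * exp (- ((2 * K / n - c / real n ^ 2) * (2 / 3 * real n * ln n / K - d))))) \<longlonglongrightarrow> 0"
    using K by real_asymp
  ultimately have "?err \<longlonglongrightarrow> 0 + 0 + 0 + 0 + 0" by (intro tendsto_add)
  then have "(\<lambda>n. 1 - ?err n) \<longlonglongrightarrow> 1 - (0 + 0 + 0 + 0 + 0)" by (intro tendsto_diff tendsto_const)
  then have lower: "((\<lambda>n. 1 - ?err n) \<longlongrightarrow> 1) (inf at_top (principal {n. even n}))"
    by (simp only: add_0_right diff_zero) (rule tendsto_mono[OF inf_le1])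
  have "\<forall>\<^sub>F n::nat in at_top. 40 * k \<le> n" by (rule eventually_ge_at_top)
  moreover have "\<forall>\<^sub>F n::nat in at_top. 3 \<le> ln n" by real_asymp
  moreover have "\<forall>\<^sub>F n::nat in at_top. 1 \<le> n * ln n / K" using K by real_asymp
  moreover have "\<forall>\<^sub>F n::nat in at_top. 3 * real n * ln n / K \<le> real n * (real n - 1) / g"
    using K g by real_asymp
  moreover have "\<forall>\<^sub>F n::nat in at_top. n * ln n / (2 * K) \<le> 2 / 3 * real n * ln n / K - 1"
    using K by real_asymp
  moreover have "\<forall>\<^sub>F n::nat in at_top. 0 \<le> 2 / 3 * real n * ln n / K - d"
    using K by real_asymp
  moreover have "\<forall>\<^sub>F n::nat in at_top. 0 \<le> 2 * K / n - c / real n ^ 2"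
    using K by real_asymp
  moreover have "\<forall>\<^sub>F n::nat in at_top. 45 * exp 3 * K ^ 2 / ln n \<le> 1 / 2"
    using K by real_asymp
  moreover have "\<forall>\<^sub>F n::nat in at_top. exp (- (ln n / (16 * K))) * ln n ^ 27 \<le> 1"
    using K by real_asymp
  \<comment> \<open>The analytic conditions hold for all large \<open>n\<close>, so evenness is
    carried as a premise and moved into the filter afterwards.\<close>
  ultimately have "\<forall>\<^sub>F n::nat in at_top. even n \<longrightarrow>
      1 - ?err n \<le> measure_pmf.prob (motif_process H n) {Hs. \<tau>\<^sub>M n Hs = \<tau>\<^sub>1 n Hs}"
  proof eventually_elim
    case (elim n)
    show ?case
      unfolding K_def c_def d_def
      by (rule impI, rule prob_hitting_times_eq_ge_explicit)
        (use elim in \<open>simp_all only: K_def c_def d_def g_def\<close>)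
  qed
  then have ge: "\<forall>\<^sub>F n in inf at_top (principal {n. even n}).
      1 - ?err n \<le> measure_pmf.prob (motif_process H n) {Hs. \<tau>\<^sub>M n Hs = \<tau>\<^sub>1 n Hs}"
    unfolding eventually_inf_principal by simp
  show ?thesis
  proof (rule tendsto_sandwich[OF ge _ lower tendsto_const])
    show "\<forall>\<^sub>F n in inf at_top (principal {n. even n}).
        measure_pmf.prob (motif_process H n) {Hs. \<tau>\<^sub>M n Hs = \<tau>\<^sub>1 n Hs} \<le> 1"
      by (intro always_eventually allI measure_pmf.prob_le_1)
  qed
qed

end
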